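(* Let $\mathcal{M}$ be a $\sigma$-finite factor of type III and let $A,B\in\mathcal{M}^+$ with $B\ne0$. Then $A=\sum_{j=1}^\infty C_j$ for some $C_j\in\mathcal{M}^+$ with $C_j\sim B$ for all $j$ if and only if one of the following mutually exclusive conditions holds: (1) $\|A\|>\|B\|$; (2) $\|A\|=\|B\|$ and $\chi_{\{\|B\|\}}(B)=0$; (3) $\|A\|=\|B\|$, $\chi_{\{\|B\|\}}(B)\ne0$, $B\ne\|B\|\chi_{\{\|B\|\}}(B)$, and $\chi_{\{\|A\|\}}(A)$ is infinite; (4) $\|A\|=\|B\|$, $B=\|B\|\chi_{\{\|B\|\}}(B)$, $A=\|A\|\chi_{\{\|A\|\}}(A)$, and $\chi_{\{\|A\|\}}(A)$ is infinite. Furthermore, if one of these conditions is satisfied, the decomposition can be chosen so that $N_{C_j}\ne0$ for all $j$.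
   Context: $\mathcal{M}$ acts on a Hilbert space; $\mathcal{M}^+$ is its set of positive elements. For $B,C\in\mathcal{M}^+$, $B\sim C$ means $B=XX^*$ and $C=X^*X$ for some $X\in\mathcal{M}$. $N_C$ is the projection on the null space of $C$. $\chi_S(B)$ is the spectral projection of $B$ for the Borel set $S$. "Infinite" for a projection is meant relative to $\mathcal{M}$ (Murray-von Neumann). Infinite sums of operators converge in the strong operator topology. *)

theory Defs
  imports "HOL-Analysis.Analysis"
begin

section \<open>Complex Hilbert spaces\<close>

text \<open>
  The norm and the topology are those of the underlying real inner product space, whose
  inner product is the real part of the complex one. Hence
  \<open>cinner x x = complex_of_real ((norm x)\<^sup>2)\<close>, so definiteness need not be postulated again.
  The complex inner product is linear in its first argument.
\<close>

class chilbert_space = real_inner + complete_space +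
  fixes scaleC :: "complex \<Rightarrow> 'a \<Rightarrow> 'a" (infixr "*\<^sub>C" 75)
    and cinner :: "'a \<Rightarrow> 'a \<Rightarrow> complex"
  assumes scaleC_add_right: "c *\<^sub>C (x + y) = c *\<^sub>C x + c *\<^sub>C y"
    and scaleC_add_left: "(c + d) *\<^sub>C x = c *\<^sub>C x + d *\<^sub>C x"
    and scaleC_scaleC: "c *\<^sub>C d *\<^sub>C x = (c * d) *\<^sub>C x"
    and scaleR_scaleC: "r *\<^sub>R x = complex_of_real r *\<^sub>C x"
    and cinner_commute: "cinner x y = cnj (cinner y x)"
    and cinner_add_left: "cinner (x + y) z = cinner x z + cinner y z"
    and cinner_scaleC_left: "cinner (c *\<^sub>C x) y = c * cinner x y"
    and inner_eq_Re_cinner: "inner x y = Re (cinner x y)"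

section \<open>Bounded operators\<close>

text \<open>
  The library type \<open>'a \<Rightarrow>\<^sub>L 'a\<close> consists of the bounded real-linear maps; the bounded operators of
  the complex Hilbert space are the complex-linear ones among them. The library norm is the
  operator norm.
\<close>

definition bounded_ops :: "('a::chilbert_space \<Rightarrow>\<^sub>L 'a) set" where
  "bounded_ops = {T. \<forall>c x. blinfun_apply T (c *\<^sub>C x) = c *\<^sub>C blinfun_apply T x}"

text \<open>For \<open>T \<in> bounded_ops\<close> the operator below exists by the Riesz representation theorem.\<close>

definition adj :: "('a::chilbert_space \<Rightarrow>\<^sub>L 'a) \<Rightarrow> ('a \<Rightarrow>\<^sub>L 'a)" where
  "adj T = (THE S. \<forall>x y. cinner (blinfun_apply T x) y = cinner x (blinfun_apply S y))"

definition positive_op :: "('a::chilbert_space \<Rightarrow>\<^sub>L 'a) \<Rightarrow> bool" where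
  "positive_op T \<longleftrightarrow> T \<in> bounded_ops \<and> (\<forall>x. cinner (blinfun_apply T x) x \<in> \<real>\<^sub>\<ge>\<^sub>0)"

definition is_projection :: "('a::chilbert_space \<Rightarrow>\<^sub>L 'a) \<Rightarrow> bool" where
  "is_projection P \<longleftrightarrow> P \<in> bounded_ops \<and> P o\<^sub>L P = P \<and> adj P = P"

text \<open>The orthogonal projection onto a closed complex subspace.\<close>

definition projection_onto :: "'a::chilbert_space set \<Rightarrow> ('a \<Rightarrow>\<^sub>L 'a)" where
  "projection_onto V = (THE P. is_projection P \<and> range (blinfun_apply P) = V)"

definition null_projection :: "('a::chilbert_space \<Rightarrow>\<^sub>L 'a) \<Rightarrow> ('a \<Rightarrow>\<^sub>L 'a)" where
  "null_projection T = projection_onto {x. blinfun_apply T x = 0}"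

section \<open>Spectral projections\<close>

definition projection_valued_measure :: "(real set \<Rightarrow> ('a::chilbert_space \<Rightarrow>\<^sub>L 'a)) \<Rightarrow> bool" where
  "projection_valued_measure E \<longleftrightarrow>
     (\<forall>S\<in>sets borel. is_projection (E S)) \<and>
     E UNIV = id_blinfun \<and>
     (\<forall>S\<in>sets borel. \<forall>T\<in>sets borel. E (S \<inter> T) = E S o\<^sub>L E T) \<and>
     (\<forall>F::nat \<Rightarrow> real set. range F \<subseteq> sets borel \<longrightarrow> disjoint_family F \<longrightarrow>
        limitin strong_operator_topology (\<lambda>n. \<Sum>i<n. E (F i)) (E (\<Union>i. F i)) sequentially)"

definition scalar_measure ::
    "(real set \<Rightarrow> ('a::chilbert_space \<Rightarrow>\<^sub>L 'a)) \<Rightarrow> 'a \<Rightarrow> real measure" where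
  "scalar_measure E x =
     measure_of UNIV (sets borel) (\<lambda>S. ennreal (Re (cinner (blinfun_apply (E S) x) x)))"

text \<open>
  \<open>E\<close> is the boundedly supported resolution of the identity of \<open>T\<close>, that is,
  \<open>T = \<integral> t dE(t)\<close>. The identity is stated on quadratic forms, which determine an operator on a
  complex Hilbert space.
\<close>

definition spectral_measure_of ::
    "('a::chilbert_space \<Rightarrow>\<^sub>L 'a) \<Rightarrow> (real set \<Rightarrow> ('a \<Rightarrow>\<^sub>L 'a)) \<Rightarrow> bool" where
  "spectral_measure_of T E \<longleftrightarrow>
     projection_valued_measure E \<and>
     (\<exists>a. E {-a..a} = id_blinfun) \<and>
     (\<forall>x. integrable (scalar_measure E x) (\<lambda>t. t) \<and>
          cinner (blinfun_apply T x) x = complex_of_real (\<integral>t. t \<partial>scalar_measure E x))"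

text \<open>
  The spectral projection \<open>\<chi>\<^sub>S(T)\<close> of a self-adjoint operator \<open>T\<close> for a Borel set \<open>S\<close>. The description
  is of \<open>E S\<close> and not of \<open>E\<close>, since \<open>E\<close> is arbitrary on sets that are not Borel.
\<close>

definition spectral_projection ::
    "real set \<Rightarrow> ('a::chilbert_space \<Rightarrow>\<^sub>L 'a) \<Rightarrow> ('a \<Rightarrow>\<^sub>L 'a)" where
  "spectral_projection S T = (THE P. \<exists>E. spectral_measure_of T E \<and> P = E S)"

section \<open>Von Neumann algebras\<close>

definition commutant :: "('a::chilbert_space \<Rightarrow>\<^sub>L 'a) set \<Rightarrow> ('a \<Rightarrow>\<^sub>L 'a) set" where
  "commutant M = {T \<in> bounded_ops. \<forall>X\<in>M. T o\<^sub>L X = X o\<^sub>L T}"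

definition von_neumann_algebra :: "('a::chilbert_space \<Rightarrow>\<^sub>L 'a) set \<Rightarrow> bool" where
  "von_neumann_algebra M \<longleftrightarrow>
     M \<subseteq> bounded_ops \<and> (\<forall>T\<in>M. adj T \<in> M) \<and> commutant (commutant M) = M"

definition vn_factor :: "('a::chilbert_space \<Rightarrow>\<^sub>L 'a) set \<Rightarrow> bool" where
  "vn_factor M \<longleftrightarrow>
     von_neumann_algebra M \<and>
     M \<inter> commutant M = {T. \<exists>c. \<forall>x. blinfun_apply T x = c *\<^sub>C x}"

definition positive_part :: "('a::chilbert_space \<Rightarrow>\<^sub>L 'a) set \<Rightarrow> ('a \<Rightarrow>\<^sub>L 'a) set" where
  "positive_part M = {T \<in> M. positive_op T}"

definition projections :: "('a::chilbert_space \<Rightarrow>\<^sub>L 'a) set \<Rightarrow> ('a \<Rightarrow>\<^sub>L 'a) set" where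
  "projections M = {P \<in> M. is_projection P}"

text \<open>On projections this is Murray-von Neumann equivalence.\<close>

definition equiv_in ::
    "('a::chilbert_space \<Rightarrow>\<^sub>L 'a) set \<Rightarrow> ('a \<Rightarrow>\<^sub>L 'a) \<Rightarrow> ('a \<Rightarrow>\<^sub>L 'a) \<Rightarrow> bool" where
  "equiv_in M B C \<longleftrightarrow> (\<exists>X\<in>M. B = X o\<^sub>L adj X \<and> C = adj X o\<^sub>L X)"

definition infinite_projection ::
    "('a::chilbert_space \<Rightarrow>\<^sub>L 'a) set \<Rightarrow> ('a \<Rightarrow>\<^sub>L 'a) \<Rightarrow> bool" where
  "infinite_projection M P \<longleftrightarrow>
     P \<in> projections M \<and>
     (\<exists>Q\<in>projections M. range (blinfun_apply Q) \<subseteq> range (blinfun_apply P) \<and> Q \<noteq> P \<and> equiv_in M Q P)"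

definition type_III_factor :: "('a::chilbert_space \<Rightarrow>\<^sub>L 'a) set \<Rightarrow> bool" where
  "type_III_factor M \<longleftrightarrow>
     vn_factor M \<and> (\<forall>P\<in>projections M. P \<noteq> 0 \<longrightarrow> infinite_projection M P)"

definition sigma_finite_algebra :: "('a::chilbert_space \<Rightarrow>\<^sub>L 'a) set \<Rightarrow> bool" where
  "sigma_finite_algebra M \<longleftrightarrow>
     (\<forall>F. F \<subseteq> projections M - {0} \<longrightarrow> (\<forall>P\<in>F. \<forall>Q\<in>F. P \<noteq> Q \<longrightarrow> P o\<^sub>L Q = 0) \<longrightarrow> countable F)"

section \<open>Sums of operators equivalent to a given one\<close>

definition sot_sums :: "(nat \<Rightarrow> ('a::chilbert_space \<Rightarrow>\<^sub>L 'a)) \<Rightarrow> ('a \<Rightarrow>\<^sub>L 'a) \<Rightarrow> bool" where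
  "sot_sums C A \<longleftrightarrow>
     limitin strong_operator_topology (\<lambda>n. \<Sum>j<n. C j) A sequentially"

abbreviation top_projection :: "('a::chilbert_space \<Rightarrow>\<^sub>L 'a) \<Rightarrow> ('a \<Rightarrow>\<^sub>L 'a)" where
  "top_projection T \<equiv> spectral_projection {norm T} T"

definition condition1 :: "('a::chilbert_space \<Rightarrow>\<^sub>L 'a) \<Rightarrow> ('a \<Rightarrow>\<^sub>L 'a) \<Rightarrow> bool" where
  "condition1 A B \<longleftrightarrow> norm A > norm B"

definition condition2 :: "('a::chilbert_space \<Rightarrow>\<^sub>L 'a) \<Rightarrow> ('a \<Rightarrow>\<^sub>L 'a) \<Rightarrow> bool" where
  "condition2 A B \<longleftrightarrow> norm A = norm B \<and> top_projection B = 0"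

definition condition3 ::
    "('a::chilbert_space \<Rightarrow>\<^sub>L 'a) set \<Rightarrow> ('a \<Rightarrow>\<^sub>L 'a) \<Rightarrow> ('a \<Rightarrow>\<^sub>L 'a) \<Rightarrow> bool" where
  "condition3 M A B \<longleftrightarrow>
     norm A = norm B \<and> top_projection B \<noteq> 0 \<and> B \<noteq> norm B *\<^sub>R top_projection B \<and>
     infinite_projection M (top_projection A)"

definition condition4 ::
    "('a::chilbert_space \<Rightarrow>\<^sub>L 'a) set \<Rightarrow> ('a \<Rightarrow>\<^sub>L 'a) \<Rightarrow> ('a \<Rightarrow>\<^sub>L 'a) \<Rightarrow> bool" where
  "condition4 M A B \<longleftrightarrow>
     norm A = norm B \<and> B = norm B *\<^sub>R top_projection B \<and> A = norm A *\<^sub>R top_projection A \<and>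
     infinite_projection M (top_projection A)"

end

theory Submission
  imports Defs
begin

text \<open>
  In a \<open>\<sigma>\<close>-finite type III factor every nonzero projection is the range projection of an isometry.
  If \<open>\<parallel>A\<parallel> > \<parallel>B\<parallel>\<close>, choose infinitely many orthogonal projections \<open>Q n\<close> commuting with \<open>A\<close> on which
  \<open>A \<ge> c > \<parallel>B\<parallel>\<close>, and put \<open>D = A (1 - \<Sum>n. Q n)\<close>. At step \<open>n\<close> an operator \<open>X\<close> with \<open>X\<^sup>* X = B\<close> can be found
  such that \<open>X X\<^sup>* \<le> A Q n + D\<close> and \<open>X X\<^sup>*\<close> takes a fixed proportion away from \<open>D\<close>; the difference is the new \<open>D\<close>,
  and the remainders tend to \<open>0\<close>. Since decompositions of corners can be added, the other cases follow by cutting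
  \<open>A\<close> and \<open>B\<close> along spectral projections: into pieces with strict norm inequality when \<open>\<parallel>B\<parallel>\<close> is not an
  eigenvalue of \<open>B\<close>, and into multiples of projections on the eigenspaces of \<open>\<parallel>A\<parallel>\<close> and \<open>\<parallel>B\<parallel>\<close>, where the claim is
  that an infinite projection is a sum of projections equivalent to a given one.

  Conversely, if \<open>\<parallel>A\<parallel> = \<parallel>B\<parallel>\<close> then \<open>X j\<close> maps eigenvectors of \<open>B\<close> for \<open>\<parallel>B\<parallel>\<close> to eigenvectors of \<open>A\<close>, and if \<open>B\<close> is a
  multiple of a projection then the \<open>C j\<close> are the same multiple of projections, which must be orthogonal.
\<close>

section \<open>Elementary geometry of real Hilbert spaces and their operators\<close>

section \<open>Real Hilbert spaces\<close>

text \<open>Everything is done over the reals with real adjoints. Complex linearity is one more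
  commutation relation, so the algebra becomes \<open>commuting N\<close>, which contains its strong
  limits and every projection onto a subspace invariant under \<open>N\<close>.

  If copies of \<open>B\<close> were simply subtracted one after another, a remainder could stay
  that dominates no further copy. So a copy is never placed under the remainder \<open>D\<close>. It
  sits under a fresh reserve \<open>A Q n\<close>, and because
  \<open>c > \<parallel>B\<parallel>\<close> the reserve has slack
  \<open>1 - \<parallel>B\<parallel> / c\<close>. The slack pays for tilting \<open>X\<close>
  slightly into the range of \<open>D\<close>, so that the compression of \<open>X X\<^sup>*\<close>
  off \<open>Q n\<close> is \<open>r D\<close>, with the same \<open>r\<close> at every step.
  Vectors that meet only finitely many reserves then see the remainder decay like
  \<open>(1 - r) ^ n\<close>.

  Equality of norms leaves no slack. It is regained by matching the layer of \<open>B\<close> below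
  a level \<open>t n\<close> with a part of \<open>A\<close> above \<open>t (Suc n)\<close>. An
  eigenvalue of \<open>B\<close> at the top defeats this, and is paid for by half of the eigenspace
  of \<open>A\<close>.\<close>

class hilbert_space = real_inner + complete_space

instance hilbert_space \<subseteq> banach ..

instance chilbert_space \<subseteq> hilbert_space ..

lemma blinfun_compose_assoc: "(R o\<^sub>L S) o\<^sub>L T = R o\<^sub>L (S o\<^sub>L T)"
  by (rule blinfun_eqI) simp

lemmas blinfun_apply_simps = blinfun.add_left blinfun.add_right blinfun.diff_left
  blinfun.diff_right blinfun.scaleR_left blinfun.scaleR_right blinfun.zero_left
  blinfun.zero_right blinfun.minus_left blinfun.minus_right blinfun.sum_left

lemma blinfun_compose_id [simp]: "id_blinfun o\<^sub>L T = T" "T o\<^sub>L id_blinfun = T"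
  by (auto intro: blinfun_eqI)

lemma blinfun_compose_diff: "(R - S) o\<^sub>L T = (R o\<^sub>L T) - (S o\<^sub>L T)"
  "T o\<^sub>L (R - S) = (T o\<^sub>L R) - (T o\<^sub>L S)"
  by (auto intro!: blinfun_eqI simp: blinfun_apply_simps)

lemma blinfun_compose_add: "(R + S) o\<^sub>L T = (R o\<^sub>L T) + (S o\<^sub>L T)"
  "T o\<^sub>L (R + S) = (T o\<^sub>L R) + (T o\<^sub>L S)"
  by (auto intro!: blinfun_eqI simp: blinfun_apply_simps)

text \<open>Near \<open>t = 0\<close> the linear term dominates. The value
  \<open>t = - e * a\<close> is small enough for the quadratic term not to compensate, because
  \<open>e * c < 1\<close>.\<close>

lemma quadratic_form_cross_zero:
  fixes a :: real
  assumes "\<And>t. 0 \<le> 2 * t * a + t\<^sup>2 * c"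
  shows "a = 0"
proof (rule ccontr)
  assume a: "a \<noteq> 0"
  define e where "e = 1 / (1 + \<bar>c\<bar>)"
  have e: "0 < e" "e * c < 1"
    by (auto simp: e_def field_simps)
  have "2 * (- e * a) * a + (- e * a)\<^sup>2 * c = (e * a\<^sup>2) * (e * c - 2)"
    by (simp add: algebra_simps power2_eq_square)
  moreover have "(e * a\<^sup>2) * (e * c - 2) < 0"
    using e a by (intro mult_pos_neg) auto
  ultimately show False
    using assms[of "- e * a"] by linarith
qed

text \<open>The sets \<open>S n\<close> of near-minimisers of the distance are closed and nested,
  and by the parallelogram law their diameters tend to 0, so completeness supplies a minimiser.
  Orthogonality is the vanishing of the first variation there.\<close>

lemma hilbert_projection:
  fixes L :: "'a::hilbert_space set"
  assumes L: "subspace L" "closed L"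
  shows "\<exists>p\<in>L. \<forall>y\<in>L. inner (x - p) y = 0"
proof -
  define d where "d = (INF y\<in>L. (norm (x - y))\<^sup>2)"
  have L0: "0 \<in> L"
    using L subspace_0 by blast
  have bdd: "bdd_below ((\<lambda>y. (norm (x - y))\<^sup>2) ` L)"
    by (intro bdd_belowI2[of _ 0]) auto
  have dle: "d \<le> (norm (x - y))\<^sup>2" if "y \<in> L" for y
    unfolding d_def by (rule cINF_lower[OF bdd that])
  define S where "S n = {y \<in> L. (norm (x - y))\<^sup>2 \<le> d + inverse (real (Suc n))}" for n
  have Sne: "S n \<noteq> {}" for n
  proof -
    have "d < d + inverse (real (Suc n))" by simp
    then obtain y where "y \<in> L" "(norm (x - y))\<^sup>2 < d + inverse (real (Suc n))"
      unfolding d_def using cINF_less_iff[OF _ bdd] L0 by blast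
    then show ?thesis unfolding S_def by force
  qed
  have Scl: "closed (S n)" for n
  proof -
    have "S n = L \<inter> {y. (norm (x - y))\<^sup>2 \<le> d + inverse (real (Suc n))}"
      by (auto simp: S_def)
    then show ?thesis
      using L(2) by (auto intro!: closed_Int closed_Collect_le continuous_intros)
  qed
  have Sdiam: "(norm (y - z))\<^sup>2 \<le> 4 * inverse (real (Suc n))" if "y \<in> S n" "z \<in> S n" for y z n
  proof -
    have "(1/2) *\<^sub>R (y + z) \<in> L"
      using that L(1) by (intro subspace_scale subspace_add) (auto simp: S_def)
    then have "d \<le> (norm (x - (1/2) *\<^sub>R (y + z)))\<^sup>2" by (rule dle)
    moreover have "(norm (y - z))\<^sup>2 = 2 * (norm (x - y))\<^sup>2 + 2 * (norm (x - z))\<^sup>2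
        - 4 * (norm (x - (1/2) *\<^sub>R (y + z)))\<^sup>2"
      unfolding power2_norm_eq_inner by (simp add: inner_simps inner_commute algebra_simps)
    ultimately show ?thesis using that unfolding S_def by auto
  qed
  have "\<exists>n. \<forall>y\<in>S n. \<forall>z\<in>S n. dist y z < e" if "e > 0" for e
  proof -
    obtain n where "inverse (real (Suc n)) < e\<^sup>2 / 4"
      using reals_Archimedean[of "e\<^sup>2 / 4"] \<open>e > 0\<close> by auto
    then have "(norm (y - z))\<^sup>2 < e\<^sup>2" if "y \<in> S n" "z \<in> S n" for y z
      using Sdiam[OF that] by linarith
    then show ?thesis
      using \<open>e > 0\<close> by (metis dist_norm power_less_imp_less_base less_imp_le)
  qed
  moreover have "S n \<subseteq> S m" if "m \<le> n" for m n
  proof -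
    have "inverse (real (Suc n)) \<le> inverse (real (Suc m))"
      using that by (intro le_imp_inverse_le) auto
    then show ?thesis unfolding S_def by (auto intro: order_trans)
  qed
  ultimately obtain p where p: "\<And>n. p \<in> S n"
    using decreasing_closed_nest[of S] Scl Sne by blast
  have pL: "p \<in> L" using p[of 0] by (simp add: S_def)
  have "(norm (x - p))\<^sup>2 \<le> d"
  proof (rule field_le_epsilon)
    fix e :: real assume "0 < e"
    then obtain n where "inverse (real (Suc n)) < e" using reals_Archimedean by blast
    then show "(norm (x - p))\<^sup>2 \<le> d + e" using p[of n] by (auto simp: S_def)
  qed
  then have min: "(norm (x - p))\<^sup>2 \<le> (norm (x - y))\<^sup>2" if "y \<in> L" for y
    using dle[OF that] by (rule order_trans)
  have "inner (x - p) y = 0" if y: "y \<in> L" for y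
  proof -
    have "0 \<le> 2 * t * (- inner (x - p) y) + t\<^sup>2 * (norm y)\<^sup>2" for t
    proof -
      have "p + t *\<^sub>R y \<in> L"
        using y pL L(1) by (intro subspace_add subspace_scale)
      from min[OF this] show ?thesis
        unfolding power2_norm_eq_inner
        by (simp add: inner_simps inner_commute algebra_simps power2_eq_square)
    qed
    then show ?thesis
      using quadratic_form_cross_zero by (metis neg_equal_0_iff_equal)
  qed
  then show ?thesis using pL by blast
qed

lemma riesz_representation:
  fixes f :: "'a::hilbert_space \<Rightarrow> real"
  assumes "bounded_linear f"
  shows "\<exists>z. \<forall>x. f x = inner x z"
proof (cases "\<forall>x. f x = 0")
  case True
  then show ?thesis by (intro exI[of _ 0]) simp
next
  case False
  interpret f: bounded_linear f by fact
  obtain u where u: "f u \<noteq> 0" using False by blast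
  let ?L = "{x. f x = 0}"
  have "subspace ?L"
    by (auto simp: subspace_def f.add f.scaleR f.zero)
  moreover have "closed ?L"
    by (intro closed_Collect_eq continuous_intros linear_continuous_on assms)
  ultimately obtain p where p: "f p = 0" "\<And>y. f y = 0 \<Longrightarrow> inner (u - p) y = 0"
    using hilbert_projection[of ?L u] by blast
  \<comment> \<open>\<open>w\<close> spans the orthogonal complement of the kernel of
    \<open>f\<close>, so \<open>f\<close> is a multiple of the inner product with
    \<open>w\<close>.\<close>
  define w where "w = u - p"
  have fw: "f w \<noteq> 0" using u p by (simp add: w_def f.diff)
  then have w0: "inner w w \<noteq> 0" using f.zero by auto
  have "f x = inner x ((f w / inner w w) *\<^sub>R w)" for x
  proof -
    have "f (f w *\<^sub>R x - f x *\<^sub>R w) = 0" by (simp add: f.diff f.scaleR)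
    then have "inner w (f w *\<^sub>R x - f x *\<^sub>R w) = 0" using p(2) unfolding w_def by blast
    then show ?thesis using w0 by (simp add: inner_simps field_simps inner_commute)
  qed
  then show ?thesis by blast
qed

lemma inner_eqI:
  fixes y z :: "'a::real_inner"
  assumes "\<And>x. inner x y = inner x z"
  shows "y = z"
proof -
  have "inner (y - z) (y - z) = 0" using assms by (simp add: inner_diff_right)
  then show ?thesis by simp
qed

text \<open>The adjoint for the real inner product, defined for every real-linear operator. On
  complex-linear operators it is \<open>adj\<close>, see \<open>adj_eq_hadj\<close>.\<close>

definition hadj ::
    "('a::hilbert_space \<Rightarrow>\<^sub>L 'a) \<Rightarrow> ('a \<Rightarrow>\<^sub>L 'a)" ("_\<dagger>" [1000] 1000) where
  "hadj T = (THE S. \<forall>x y. inner (T x) y = inner x (blinfun_apply S y))"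

lemma hadj_exists:
  fixes T :: "'a::hilbert_space \<Rightarrow>\<^sub>L 'a"
  shows "\<exists>!S::'a \<Rightarrow>\<^sub>L 'a. \<forall>x y. inner (T x) y = inner x (S y)"
proof -
  have "\<exists>z. \<forall>x. inner (T x) y = inner x z" for y
    by (rule riesz_representation)
      (intro bounded_linear_intros)
  then obtain g where g: "\<And>x y. inner (T x) y = inner x (g y)" by metis
  have "bounded_linear g"
  proof (rule bounded_linear_intro[of _ "norm T"])
    show "g (x + y) = g x + g y" for x y
      by (rule inner_eqI) (simp add: g[symmetric] inner_add_right)
    show "g (r *\<^sub>R x) = r *\<^sub>R g x" for r x
      by (rule inner_eqI) (simp add: g[symmetric])
    show "norm (g x) \<le> norm x * norm T" for x
    proof (cases "g x = 0")
      case False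
      have "norm (g x) * norm (g x) = inner (T (g x)) x"
        by (simp add: g power2_norm_eq_inner[symmetric] power2_eq_square)
      also have "\<dots> \<le> norm (T (g x)) * norm x" by (rule norm_cauchy_schwarz)
      also have "\<dots> \<le> (norm T * norm (g x)) * norm x"
        by (intro mult_right_mono norm_blinfun) auto
      finally show ?thesis using False by (simp add: mult_ac)
    qed simp
  qed
  then have "\<forall>x y. inner (T x) y = inner x (Blinfun g y)"
    by (simp add: bounded_linear_Blinfun_apply g)
  moreover have "S = S'"
    if "\<forall>x y. inner (T x) y = inner x (S y)" "\<forall>x y. inner (T x) y = inner x (S' y)"
    for S S' :: "'a \<Rightarrow>\<^sub>L 'a"
  proof (rule blinfun_eqI, rule inner_eqI)
    show "inner x (S y) = inner x (S' y)" for x y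
      using that by (metis (no_types))
  qed
  ultimately show ?thesis by blast
qed

lemma inner_hadj: "inner (T x) y = inner x (T\<dagger> y)"
  for T :: "'a::hilbert_space \<Rightarrow>\<^sub>L 'a"
  using theI'[OF hadj_exists[of T]] unfolding hadj_def by blast

lemma inner_hadj': "inner (T\<dagger> x) y = inner x (T y)"
  for T :: "'a::hilbert_space \<Rightarrow>\<^sub>L 'a"
  by (metis inner_hadj inner_commute)

lemma hadj_eqI: "(\<And>x y. inner (T x) y = inner x (S y)) \<Longrightarrow> T\<dagger> = S"
  for S T :: "'a::hilbert_space \<Rightarrow>\<^sub>L 'a"
  using hadj_exists[of T] inner_hadj[of T] by blast

lemma hadj_hadj [simp]: "(T\<dagger>)\<dagger> = T"
  by (rule hadj_eqI) (rule inner_hadj')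

lemma hadj_compose [simp]: "(T o\<^sub>L S)\<dagger> = S\<dagger> o\<^sub>L T\<dagger>"
  by (rule hadj_eqI) (simp add: inner_hadj)

lemma hadj_add [simp]: "(T + S)\<dagger> = T\<dagger> + S\<dagger>"
  by (rule hadj_eqI) (simp add: inner_hadj blinfun.add_left inner_simps)

lemma hadj_diff [simp]: "(T - S)\<dagger> = T\<dagger> - S\<dagger>"
  by (rule hadj_eqI) (simp add: inner_hadj blinfun.diff_left inner_simps)

lemma hadj_scaleR [simp]: "(c *\<^sub>R T)\<dagger> = c *\<^sub>R T\<dagger>"
  by (rule hadj_eqI) (simp add: inner_hadj blinfun.scaleR_left)

lemma hadj_id [simp]: "id_blinfun\<dagger> = id_blinfun"
  by (rule hadj_eqI) simp

lemma hadj_zero [simp]: "0\<dagger> = 0"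
  by (rule hadj_eqI) (simp add: blinfun.zero_left)

lemma norm_hadj_le: "norm (T\<dagger>) \<le> norm T"
proof (rule norm_blinfun_bound)
  fix x
  show "norm (T\<dagger> x) \<le> norm T * norm x"
  proof (cases "T\<dagger> x = 0")
    case False
    have "norm (T\<dagger> x) * norm (T\<dagger> x) = inner (T (T\<dagger> x)) x"
      by (simp add: inner_hadj power2_norm_eq_inner[symmetric] power2_eq_square)
    also have "\<dots> \<le> norm (T (T\<dagger> x)) * norm x" by (rule norm_cauchy_schwarz)
    also have "\<dots> \<le> (norm T * norm (T\<dagger> x)) * norm x"
      by (intro mult_right_mono norm_blinfun) auto
    finally show ?thesis using False by (simp add: mult_ac)
  qed simp
qed simp

lemma norm_hadj [simp]: "norm (T\<dagger>) = norm T"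
  using norm_hadj_le[of T] norm_hadj_le[of "T\<dagger>"] by simp

lemma power2_norm_apply: "(norm (T x))\<^sup>2 = inner ((T\<dagger> o\<^sub>L T) x) x"
  for T :: "'a::hilbert_space \<Rightarrow>\<^sub>L 'a"
  by (simp add: inner_hadj' power2_norm_eq_inner)

section \<open>Positive operators\<close>

definition psd :: "('a::hilbert_space \<Rightarrow>\<^sub>L 'a) \<Rightarrow> bool" where
  "psd T \<longleftrightarrow> T\<dagger> = T \<and> (\<forall>x. 0 \<le> inner (T x) x)"

lemma psdD: "psd T \<Longrightarrow> T\<dagger> = T" "psd T \<Longrightarrow> 0 \<le> inner (T x) x"
  by (auto simp: psd_def)

lemma sa_inner: "T\<dagger> = T \<Longrightarrow> inner (T x) y = inner x (T y)"
  by (metis inner_hadj)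

lemma psd_hadj_compose: "psd (T\<dagger> o\<^sub>L T)" "psd (T o\<^sub>L T\<dagger>)"
  unfolding psd_def using inner_ge_zero[of "T _"] inner_ge_zero[of "T\<dagger> _"]
  by (auto simp: inner_hadj' simp flip: inner_hadj)

lemma psd_scaleR: "0 \<le> c \<Longrightarrow> psd T \<Longrightarrow> psd (c *\<^sub>R T)"
  by (auto simp: psd_def blinfun_apply_simps)

lemma psd_cauchy_schwarz:
  assumes "psd T"
  shows "(inner (T x) y)\<^sup>2 \<le> inner (T x) x * inner (T y) y"
proof -
  have c: "inner (T y) x = inner (T x) y"
    using sa_inner[OF psdD(1)[OF assms]] by (metis inner_commute)
  have *: "0 \<le> inner (T x) x + 2 * t * inner (T x) y + t\<^sup>2 * inner (T y) y" for t
    using psdD(2)[OF assms, of "x + t *\<^sub>R y"]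
    by (simp add: blinfun_apply_simps inner_simps c algebra_simps power2_eq_square)
  show ?thesis
  proof (cases "inner (T y) y = 0")
    case True
    have "inner (T x) y = 0"
    proof (rule ccontr)
      assume a: "inner (T x) y \<noteq> 0"
      \<comment> \<open>With \<open>inner (T y) y = 0\<close> the form is affine in
        \<open>t\<close>, and the chosen \<open>t\<close> gives it the value -1.\<close>
      show False
        using *[of "- (inner (T x) x + 1) / (2 * inner (T x) y)"] True a
        by (simp add: field_simps)
    qed
    then show ?thesis using True by simp
  next
    case False
    then have p: "0 < inner (T y) y" using psdD(2)[OF assms, of y] by simp
    show ?thesis
      using *[of "- inner (T x) y / inner (T y) y"] p
      by (simp add: field_simps power2_eq_square)
  qed
qed

text \<open>The operator inequality \<open>T\<^sup>2 \<le> K T\<close> for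
  \<open>0 \<le> T \<le> K\<close>. It follows from Cauchy-Schwarz for the form of \<open>T\<close>
  at \<open>x\<close> and \<open>T x\<close>, after cancelling a factor
  \<open>(norm (T x))\<^sup>2\<close>. It turns convergence of forms into convergence of
  vectors.\<close>

lemma psd_norm_apply:
  assumes "psd T" "\<And>x. inner (T x) x \<le> K * (norm x)\<^sup>2"
  shows "(norm (T x))\<^sup>2 \<le> K * inner (T x) x"
proof (cases "T x = 0")
  case False
  have "((norm (T x))\<^sup>2)\<^sup>2 \<le> inner (T x) x * inner (T (T x)) (T x)"
    using psd_cauchy_schwarz[OF assms(1), of x "T x"] by (simp add: power2_norm_eq_inner)
  also have "\<dots> \<le> inner (T x) x * (K * (norm (T x))\<^sup>2)"
    using assms psdD by (intro mult_left_mono) auto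
  finally have "(norm (T x))\<^sup>2 * (norm (T x))\<^sup>2 \<le> (K * inner (T x) x) * (norm (T x))\<^sup>2"
    by (simp add: power2_eq_square mult_ac)
  then show ?thesis using False by (metis mult_right_le_imp_le zero_less_norm_iff zero_less_power)
next
  case True
  then show ?thesis by simp
qed

lemma inner_apply_le: "inner (T x) x \<le> norm T * (norm x)\<^sup>2"
  for T :: "'a::real_inner \<Rightarrow>\<^sub>L 'a"
proof -
  have "inner (T x) x \<le> norm (T x) * norm x" by (rule norm_cauchy_schwarz)
  also have "\<dots> \<le> (norm T * norm x) * norm x"
    by (intro mult_right_mono norm_blinfun) auto
  finally show ?thesis by (simp add: power2_eq_square mult_ac)
qed

lemma psd_norm_apply': "psd T \<Longrightarrow> (norm (T x))\<^sup>2 \<le> norm T * inner (T x) x"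
  by (rule psd_norm_apply) (auto intro: inner_apply_le)

lemma psd_apply_eq_0: "psd T \<Longrightarrow> inner (T x) x = 0 \<Longrightarrow> T x = 0"
  using psd_norm_apply'[of T x] by simp

lemma psd_norm_le:
  assumes "psd T" "0 \<le> K" "\<And>x. inner (T x) x \<le> K * (norm x)\<^sup>2"
  shows "norm T \<le> K"
proof (rule norm_blinfun_bound)
  fix x
  have "(norm (T x))\<^sup>2 \<le> K * (K * (norm x)\<^sup>2)"
    using psd_norm_apply[OF assms(1,3), of x] assms(2,3) by (meson mult_left_mono order_trans)
  then have "(norm (T x))\<^sup>2 \<le> (K * norm x)\<^sup>2" by (simp add: power2_eq_square mult_ac)
  then show "norm (T x) \<le> K * norm x"
    using assms(2) by (meson power2_le_imp_le mult_nonneg_nonneg norm_ge_zero)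
qed fact

lemma psd_norm_gt:
  assumes "psd T" "0 \<le> c" "c < norm T"
  shows "\<exists>x. c * (norm x)\<^sup>2 < inner (T x) x"
  using psd_norm_le[OF assms(1,2)] assms(3) by (meson not_le)

text \<open>Polarisation. Over the reals self-adjointness has to enter, since a skew operator such
  as multiplication by \<open>\<i>\<close> has vanishing quadratic form.\<close>

lemma sa_eqI:
  assumes "S\<dagger> = S" "T\<dagger> = T" "\<And>x. inner (S x) x = inner (T x) x"
  shows "S = T"
proof (rule blinfun_eqI, rule inner_eqI)
  fix x y
  have "inner (S (x + y)) (x + y) = inner (T (x + y)) (x + y)" by (rule assms)
  then have "inner (S x) y + inner (S y) x = inner (T x) y + inner (T y) x"
    using assms(3)[of x] assms(3)[of y] by (simp add: blinfun_apply_simps inner_simps)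
  moreover have "inner (S y) x = inner (S x) y" "inner (T y) x = inner (T x) y"
    using sa_inner assms(1,2) by (metis inner_commute)+
  ultimately have "inner (S x) y = inner (T x) y" by simp
  then show "inner y (S x) = inner y (T x)" by (simp add: inner_commute)
qed

section \<open>Orthogonal projections\<close>

definition orth_proj :: "('a::hilbert_space \<Rightarrow>\<^sub>L 'a) \<Rightarrow> bool" where
  "orth_proj P \<longleftrightarrow> P o\<^sub>L P = P \<and> P\<dagger> = P"

lemma orth_projD:
  assumes "orth_proj P"
  shows "P\<dagger> = P" "P o\<^sub>L P = P" "P (P x) = P x"
proof -
  show a: "P\<dagger> = P" "P o\<^sub>L P = P" using assms by (auto simp: orth_proj_def)
  show "P (P x) = P x" using a(2) by (metis blinfun_apply_blinfun_compose)
qed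

lemma orth_proj_inner: "orth_proj P \<Longrightarrow> inner (P x) y = inner x (P y)"
  by (rule sa_inner) (rule orth_projD)

lemma orth_proj_inner_self: "orth_proj P \<Longrightarrow> inner (P x) x = (norm (P x))\<^sup>2"
  using orth_proj_inner[of P "P x" x]
  by (simp add: power2_norm_eq_inner inner_commute orth_projD)

lemma orth_projI: "P\<dagger> = P \<Longrightarrow> (\<And>x. P (P x) = P x) \<Longrightarrow> orth_proj P"
  unfolding orth_proj_def by (auto intro: blinfun_eqI)

lemma orth_proj_psd: "orth_proj P \<Longrightarrow> psd P"
  by (auto simp: psd_def orth_projD orth_proj_inner_self)

lemma orth_proj_pythagoras:
  assumes "orth_proj P"
  shows "(norm x)\<^sup>2 = (norm (P x))\<^sup>2 + (norm (x - P x))\<^sup>2"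
  using orth_proj_inner[OF assms, of x "P x"] orth_projD(3)[OF assms, of x]
  unfolding power2_norm_eq_inner by (simp add: inner_simps inner_commute)

lemma orth_proj_norm_le: "orth_proj P \<Longrightarrow> norm (P x) \<le> norm x"
  using orth_proj_pythagoras[of P x] by (rule_tac power2_le_imp_le) auto

lemma orth_proj_norm_le_1: "orth_proj P \<Longrightarrow> norm P \<le> 1"
  by (intro norm_blinfun_bound) (auto simp: orth_proj_norm_le)

lemma orth_proj_zero [simp]: "orth_proj 0" and orth_proj_id [simp]: "orth_proj id_blinfun"
  by (auto intro: orth_projI simp: blinfun.zero_left)

lemma orth_proj_compl: "orth_proj P \<Longrightarrow> orth_proj (id_blinfun - P)"
  by (intro orth_projI) (auto simp: orth_projD blinfun_apply_simps)

lemma hadj_product_zero: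
  assumes "P\<dagger> = P" "Q\<dagger> = Q" "P o\<^sub>L Q = 0"
  shows "Q o\<^sub>L P = 0"
  by (metis assms hadj_compose hadj_zero)

lemma orth_proj_add:
  assumes "orth_proj P" "orth_proj Q" "P o\<^sub>L Q = 0"
  shows "orth_proj (P + Q)"
proof (rule orth_projI)
  have q: "Q o\<^sub>L P = 0" using assms hadj_product_zero orth_projD(1) by blast
  have "P (Q x) = 0" "Q (P x) = 0" for x
    using assms(3) q by (metis blinfun_apply_blinfun_compose blinfun.zero_left)+
  then show "(P + Q) ((P + Q) x) = (P + Q) x" for x
    using assms by (simp add: blinfun_apply_simps orth_projD)
  show "(P + Q)\<dagger> = P + Q"
    using assms by (simp add: orth_projD)
qed

lemma orth_proj_diff:
  assumes "orth_proj P" "orth_proj Q" "P o\<^sub>L Q = Q"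
  shows "orth_proj (P - Q)" "Q o\<^sub>L P = Q"
proof -
  show q: "Q o\<^sub>L P = Q"
    using arg_cong[OF assms(3), of hadj] assms by (metis hadj_compose orth_projD(1))
  have *: "P (Q x) = Q x" "Q (P x) = Q x" for x
    using assms(3) q by (metis blinfun_apply_blinfun_compose)+
  show "orth_proj (P - Q)"
    using assms by (intro orth_projI) (auto simp: blinfun_apply_simps orth_projD *)
qed

lemma orth_proj_compose:
  assumes "orth_proj P" "orth_proj Q" "P o\<^sub>L Q = Q o\<^sub>L P"
  shows "orth_proj (P o\<^sub>L Q)"
proof (rule orth_projI)
  have *: "P (Q x) = Q (P x)" for x
    using assms(3) by (metis blinfun_apply_blinfun_compose)
  show "(P o\<^sub>L Q) ((P o\<^sub>L Q) x) = (P o\<^sub>L Q) x" for x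
    using assms by (simp add: orth_projD *)
  show "(P o\<^sub>L Q)\<dagger> = P o\<^sub>L Q"
    using assms by (simp add: orth_projD)
qed

text \<open>At a vector of the range of \<open>Q\<close> the form of \<open>Q\<close> already uses
  up the whole squared norm, which leaves nothing for \<open>P\<close>.\<close>

lemma orth_proj_le_1_product_zero:
  assumes "orth_proj P" "orth_proj Q" "\<And>x. inner (P x) x + inner (Q x) x \<le> (norm x)\<^sup>2"
  shows "P o\<^sub>L Q = 0"
proof (rule blinfun_eqI)
  fix x
  have "(norm (P (Q x)))\<^sup>2 \<le> 0"
    using assms(3)[of "Q x"] assms(1,2)
    by (simp add: orth_projD orth_proj_inner_self power2_norm_eq_inner)
  then show "(P o\<^sub>L Q) x = blinfun_apply 0 x" by (simp add: blinfun.zero_left)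
qed

lemma exists_orth_proj:
  fixes L :: "'a::hilbert_space set"
  assumes L: "subspace L" "closed L"
  shows "\<exists>P. orth_proj P \<and> range (blinfun_apply P) = L \<and> (\<forall>x. P x = x \<longleftrightarrow> x \<in> L)"
proof -
  obtain p where p: "\<And>x. p x \<in> L" "\<And>x y. y \<in> L \<Longrightarrow> inner (x - p x) y = 0"
    using hilbert_projection[OF L] by metis
  have uniq: "p x = q" if "q \<in> L" "\<And>y. y \<in> L \<Longrightarrow> inner (x - q) y = 0" for x q
  proof -
    have l: "p x - q \<in> L" using p that L(1) by (intro subspace_diff)
    have "inner (p x - q) (p x - q) = inner (x - q) (p x - q) - inner (x - p x) (p x - q)"
      by (simp add: inner_simps)
    also have "\<dots> = 0" using p(2)[OF l] that(2)[OF l] by simp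
    finally show ?thesis by simp
  qed
  have bl: "bounded_linear p"
  proof (rule bounded_linear_intro[of _ 1])
    show "p (x + y) = p x + p y" for x y
    proof (rule uniq)
      show "inner (x + y - (p x + p y)) z = 0" if "z \<in> L" for z
        using p(2)[OF that, of x] p(2)[OF that, of y] by (simp add: inner_simps)
      show "p x + p y \<in> L" using p L(1) by (intro subspace_add)
    qed
    show "p (r *\<^sub>R x) = r *\<^sub>R p x" for r x
    proof (rule uniq)
      show "inner (r *\<^sub>R x - r *\<^sub>R p x) z = 0" if "z \<in> L" for z
        using p(2)[OF that, of x] by (simp add: inner_simps)
      show "r *\<^sub>R p x \<in> L" using p L(1) by (intro subspace_scale)
    qed
    show "norm (p x) \<le> norm x * 1" for x
    proof -
      have "(norm x)\<^sup>2 = (norm (p x))\<^sup>2 + (norm (x - p x))\<^sup>2"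
        using p(2)[OF p(1), of x x] unfolding power2_norm_eq_inner
        by (simp add: inner_simps inner_commute)
      then show ?thesis by (rule_tac power2_le_imp_le) auto
    qed
  qed
  define P where "P = Blinfun p"
  have P: "P x = p x" for x by (simp add: P_def bounded_linear_Blinfun_apply[OF bl])
  have fx: "p x = x" if "x \<in> L" for x by (rule uniq) (use that in auto)
  have "P\<dagger> = P"
  proof (rule hadj_eqI)
    show "inner (P x) y = inner x (P y)" for x y
      using p(2)[OF p(1), of x y] p(2)[OF p(1), of y x]
      by (simp add: P inner_simps inner_commute)
  qed
  then have "orth_proj P" by (rule orth_projI) (simp add: P fx p)
  moreover have "P x = x \<longleftrightarrow> x \<in> L" for x using fx p(1)[of x] by (auto simp: P)
  moreover have "range (blinfun_apply P) = L"
    using fx p(1) by (auto simp: P image_iff) metis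
  ultimately show ?thesis by blast
qed

lemma orth_proj_range: "orth_proj P \<Longrightarrow> x \<in> range (blinfun_apply P) \<longleftrightarrow> P x = x"
  using orth_projD(3) by (metis rangeE rangeI)

lemma orth_proj_range_eqI:
  assumes "orth_proj P" "orth_proj Q" "\<And>x. P x = x \<longleftrightarrow> Q x = x"
  shows "P = Q"
proof (rule sa_eqI)
  fix x
  have "P (Q x) = Q x" "Q (P x) = P x"
    using assms(1,2) assms(3)[of "Q x"] assms(3)[of "P x"] by (simp_all add: orth_projD)
  then show "inner (P x) x = inner (Q x) x"
    using orth_proj_inner[OF assms(1)] orth_proj_inner[OF assms(2)] by (metis inner_commute)
qed (auto simp: assms orth_projD)

section \<open>Orthogonal sums\<close>

lemma orthogonal_series:
  fixes v :: "nat \<Rightarrow> 'a::hilbert_space"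
  assumes orth: "\<And>i j. i \<noteq> j \<Longrightarrow> inner (v i) (v j) = 0"
    and s: "summable (\<lambda>i. (norm (v i))\<^sup>2)"
  shows "summable v" "(\<lambda>i. (norm (v i))\<^sup>2) sums (norm (\<Sum>i. v i))\<^sup>2"
proof -
  have fin: "(norm (\<Sum>i\<in>I. v i))\<^sup>2 = (\<Sum>i\<in>I. (norm (v i))\<^sup>2)" if "finite I" for I
    using norm_sum_Pythagorean[OF that, of v] orth
    by (simp add: pairwise_def orthogonal_def)
  show sv: "summable v"
    unfolding summable_Cauchy
  proof (intro allI impI)
    fix e :: real assume e: "0 < e"
    then obtain N where N: "\<And>m n. m \<ge> N \<Longrightarrow> norm (\<Sum>i=m..<n. (norm (v i))\<^sup>2) < e\<^sup>2"
      using s unfolding summable_Cauchy by (meson zero_less_power)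
    have "norm (\<Sum>i=m..<n. v i) < e" if "m \<ge> N" for m n
    proof -
      have "(norm (\<Sum>i=m..<n. v i))\<^sup>2 < e\<^sup>2"
        using N[OF that, of n] by (simp add: fin)
      then show ?thesis using e by (meson less_imp_le power_less_imp_less_base)
    qed
    then show "\<exists>N. \<forall>m\<ge>N. \<forall>n. norm (\<Sum>i=m..<n. v i) < e" by blast
  qed
  have "(\<lambda>n. (norm (\<Sum>i<n. v i))\<^sup>2) \<longlonglongrightarrow> (norm (\<Sum>i. v i))\<^sup>2"
    using summable_LIMSEQ[OF sv] by (intro tendsto_intros)
  then show "(\<lambda>i. (norm (v i))\<^sup>2) sums (norm (\<Sum>i. v i))\<^sup>2"
    by (simp add: sums_def fin)
qed

definition orth_family :: "(nat \<Rightarrow> ('a::hilbert_space \<Rightarrow>\<^sub>L 'a)) \<Rightarrow> bool" where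
  "orth_family P \<longleftrightarrow> (\<forall>i. orth_proj (P i)) \<and> (\<forall>i j. i \<noteq> j \<longrightarrow> P i o\<^sub>L P j = 0)"

lemma orth_familyD:
  assumes "orth_family P"
  shows "orth_proj (P i)" "i \<noteq> j \<Longrightarrow> P i o\<^sub>L P j = 0" "i \<noteq> j \<Longrightarrow> P i (P j x) = 0"
proof -
  show "orth_proj (P i)" using assms by (auto simp: orth_family_def)
  show *: "i \<noteq> j \<Longrightarrow> P i o\<^sub>L P j = 0" using assms by (auto simp: orth_family_def)
  show "i \<noteq> j \<Longrightarrow> P i (P j x) = 0"
    using * by (metis blinfun_apply_blinfun_compose blinfun.zero_left)
qed

lemma orth_familyI_less:
  fixes P :: "nat \<Rightarrow> ('a::hilbert_space \<Rightarrow>\<^sub>L 'a)"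
  assumes "\<And>i. orth_proj (P i)" "\<And>i j. i < j \<Longrightarrow> P i o\<^sub>L P j = 0"
  shows "orth_family P"
  unfolding orth_family_def
proof (intro conjI allI impI assms(1))
  fix i j :: nat assume "i \<noteq> j"
  then consider "i < j" | "j < i" by linarith
  then show "P i o\<^sub>L P j = 0"
    using assms(2) hadj_product_zero[OF orth_projD(1)[OF assms(1)] orth_projD(1)[OF assms(1)]]
    by cases auto
qed

lemma orth_family_sum_apply:
  assumes "orth_family P"
  shows "P i (\<Sum>j\<in>J. P j x) = (if i \<in> J \<and> finite J then P i x else 0)"
proof (cases "finite J")
  case True
  have "P i (\<Sum>j\<in>J. P j x) = (\<Sum>j\<in>J. if j = i then P i x else 0)"
    unfolding blinfun.sum_right
    by (intro sum.cong)
      (auto simp: orth_familyD(3)[OF assms] orth_projD(3)[OF orth_familyD(1)[OF assms]])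
  then show ?thesis using True by simp
qed (simp add: blinfun.zero_right)

lemma orth_family_sum_proj:
  assumes "orth_family P" "finite J"
  shows "orth_proj (\<Sum>j\<in>J. P j)"
  using assms(2)
proof (induction J)
  case (insert j J)
  have "P j o\<^sub>L (\<Sum>j\<in>J. P j) = 0"
  proof (rule blinfun_eqI)
    show "(P j o\<^sub>L (\<Sum>j\<in>J. P j)) x = blinfun_apply 0 x" for x
      using orth_family_sum_apply[OF assms(1), of j x J] insert
      by (simp add: blinfun_apply_simps)
  qed
  then have "orth_proj (P j + (\<Sum>j\<in>J. P j))"
    using insert orth_familyD[OF assms(1)] by (intro orth_proj_add) auto
  then show ?case using insert by simp
qed simp

lemma orth_family_bessel:
  assumes "orth_family P" "finite J"
  shows "(\<Sum>j\<in>J. (norm (P j x))\<^sup>2) \<le> (norm x)\<^sup>2"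
proof -
  have "(\<Sum>j\<in>J. (norm (P j x))\<^sup>2) = inner ((\<Sum>j\<in>J. P j) x) x"
    using orth_familyD(1)[OF assms(1)]
    by (simp add: blinfun.sum_left inner_sum_left orth_proj_inner_self)
  also have "\<dots> = (norm ((\<Sum>j\<in>J. P j) x))\<^sup>2"
    by (rule orth_proj_inner_self) (rule orth_family_sum_proj[OF assms])
  also have "\<dots> \<le> (norm x)\<^sup>2"
    by (intro power_mono orth_proj_norm_le orth_family_sum_proj assms) simp
  finally show ?thesis .
qed

text \<open>Orthogonal ranges, given by \<open>P\<close>, make the terms \<open>X i x\<close>
  orthogonal; orthogonal supports, given by \<open>S\<close>, bound the sum of their squared norms
  through Bessel's inequality. The pointwise sum is therefore an operator of norm at most
  \<open>K\<close>.\<close>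

lemma orthogonal_operator_series_half:
  assumes P: "orth_family P" and S: "orth_family S" and K: "0 \<le> K"
    and X: "\<And>i. P i o\<^sub>L X i = X i" "\<And>i. X i o\<^sub>L S i = X i" "\<And>i. norm (X i) \<le> K"
  shows "\<exists>Y. \<forall>x. (\<lambda>i. X i x) sums blinfun_apply Y x \<and>
           (\<lambda>i. (norm (X i x))\<^sup>2) sums (norm (blinfun_apply Y x))\<^sup>2"
proof -
  have px: "P i (X i x) = X i x" "X i (S i x) = X i x" for i x
    using X(1)[of i] X(2)[of i] by (metis blinfun_apply_blinfun_compose)+
  have orth: "inner (X i x) (X j y) = 0" if "i \<noteq> j" for i j x y
    using orth_proj_inner[OF orth_familyD(1)[OF P], of i "X i x" "X j y"]
      orth_familyD(3)[OF P that, of "X j y"] px by simp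
  have le: "(norm (X i x))\<^sup>2 \<le> K\<^sup>2 * (norm (S i x))\<^sup>2" for i x
  proof -
    have "norm (X i x) \<le> K * norm (S i x)"
      using norm_blinfun[of "X i" "S i x"] X(3)[of i]
      by (simp add: px) (meson mult_right_mono norm_ge_zero order_trans)
    then show ?thesis using power_mono[of _ "K * norm (S i x)" 2] by (simp add: power_mult_distrib)
  qed
  have bd: "(\<Sum>i<n. (norm (X i x))\<^sup>2) \<le> K\<^sup>2 * (norm x)\<^sup>2" for n x
  proof -
    have "(\<Sum>i<n. (norm (X i x))\<^sup>2) \<le> K\<^sup>2 * (\<Sum>i<n. (norm (S i x))\<^sup>2)"
      unfolding sum_distrib_left by (intro sum_mono le)
    also have "\<dots> \<le> K\<^sup>2 * (norm x)\<^sup>2"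
      by (intro mult_left_mono orth_family_bessel[OF S]) auto
    finally show ?thesis .
  qed
  have sm: "summable (\<lambda>i. (norm (X i x))\<^sup>2)" for x
    using bd by (intro summableI_nonneg_bounded) auto
  note os = orthogonal_series[OF orth sm]
  define g where "g x = (\<Sum>i. X i x)" for x
  have gs: "(\<lambda>i. X i x) sums g x" for x
    unfolding g_def using os(1) by (rule summable_sums)
  have gn: "(\<lambda>i. (norm (X i x))\<^sup>2) sums (norm (g x))\<^sup>2" for x
    unfolding g_def by (rule os(2))
  have bl: "bounded_linear g"
  proof (rule bounded_linear_intro[of _ K])
    show "g (x + y) = g x + g y" for x y
      using sums_add[OF gs[of x] gs[of y]] gs[of "x + y"]
      by (simp add: blinfun.add_right sums_unique2)
    show "g (r *\<^sub>R x) = r *\<^sub>R g x" for r x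
      using sums_scaleR_right[OF gs[of x], of r] gs[of "r *\<^sub>R x"]
      by (simp add: blinfun.scaleR_right sums_unique2)
    show "norm (g x) \<le> norm x * K" for x
    proof -
      have "(norm (g x))\<^sup>2 \<le> K\<^sup>2 * (norm x)\<^sup>2"
        using gn[of x] bd[of x] unfolding sums_def by (intro LIMSEQ_le_const2) auto
      then have "(norm (g x))\<^sup>2 \<le> (norm x * K)\<^sup>2" by (simp add: power_mult_distrib mult_ac)
      then show ?thesis using K by (meson power2_le_imp_le mult_nonneg_nonneg norm_ge_zero)
    qed
  qed
  show ?thesis
    using gs gn by (intro exI[of _ "Blinfun g"]) (simp add: bounded_linear_Blinfun_apply[OF bl])
qed

text \<open>Taking adjoints is not strongly continuous. The series of adjoints is therefore summed
  on its own, with ranges and supports exchanged, and its sum is identified with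
  \<open>Y\<dagger>\<close> by testing inner products.\<close>

lemma orthogonal_operator_series:
  assumes P: "orth_family P" and S: "orth_family S" and K: "0 \<le> K"
    and X: "\<And>i. P i o\<^sub>L X i = X i" "\<And>i. X i o\<^sub>L S i = X i" "\<And>i. norm (X i) \<le> K"
  obtains Y where "\<And>x. (\<lambda>i. X i x) sums blinfun_apply Y x"
    "\<And>x. (\<lambda>i. (norm (X i x))\<^sup>2) sums (norm (blinfun_apply Y x))\<^sup>2"
    "\<And>x. (\<lambda>i. (X i)\<dagger> x) sums Y\<dagger> x"
    "\<And>x. (\<lambda>i. (norm ((X i)\<dagger> x))\<^sup>2) sums (norm (Y\<dagger> x))\<^sup>2"
proof -
  obtain Y where Y: "\<And>x. (\<lambda>i. X i x) sums blinfun_apply Y x"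
    "\<And>x. (\<lambda>i. (norm (X i x))\<^sup>2) sums (norm (blinfun_apply Y x))\<^sup>2"
    using orthogonal_operator_series_half[OF assms] by blast
  have X': "S i o\<^sub>L (X i)\<dagger> = (X i)\<dagger>" "(X i)\<dagger> o\<^sub>L P i = (X i)\<dagger>" for i
    using arg_cong[OF X(1)[of i], of hadj] arg_cong[OF X(2)[of i], of hadj]
    by (simp_all add: orth_projD(1) orth_familyD(1)[OF P] orth_familyD(1)[OF S])
  obtain Z where Z: "\<And>x. (\<lambda>i. (X i)\<dagger> x) sums blinfun_apply Z x"
    "\<And>x. (\<lambda>i. (norm ((X i)\<dagger> x))\<^sup>2) sums (norm (blinfun_apply Z x))\<^sup>2"
    using orthogonal_operator_series_half[OF S P K X'] X(3) by auto
  have "Y\<dagger> = Z"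
  proof (rule hadj_eqI)
    fix x y
    have "(\<lambda>i. inner (X i x) y) sums inner (Y x) y"
      by (rule bounded_linear.sums[OF bounded_linear_inner_left Y(1)])
    moreover have "(\<lambda>i. inner x ((X i)\<dagger> y)) sums inner x (Z y)"
      by (rule bounded_linear.sums[OF bounded_linear_inner_right Z(1)])
    ultimately show "inner (Y x) y = inner x (Z y)"
      by (simp add: inner_hadj sums_unique2)
  qed
  then show ?thesis using that Y Z by blast
qed

lemma orth_family_sum:
  assumes P: "orth_family P"
  obtains Q where "orth_proj Q" "\<And>x. (\<lambda>i. P i x) sums blinfun_apply Q x"
    "\<And>x. (\<lambda>i. (norm (P i x))\<^sup>2) sums (norm (blinfun_apply Q x))\<^sup>2"
    "\<And>i. Q o\<^sub>L P i = P i" "\<And>i. P i o\<^sub>L Q = P i"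
proof -
  note p = orth_familyD[OF P]
  obtain Q where Q: "\<And>x. (\<lambda>i. P i x) sums blinfun_apply Q x"
    "\<And>x. (\<lambda>i. (norm (P i x))\<^sup>2) sums (norm (blinfun_apply Q x))\<^sup>2"
    "\<And>x. (\<lambda>i. (P i)\<dagger> x) sums Q\<dagger> x"
    "\<And>x. (\<lambda>i. (norm ((P i)\<dagger> x))\<^sup>2) sums (norm (Q\<dagger> x))\<^sup>2"
    by (rule orthogonal_operator_series[OF P P zero_le_one orth_projD(2)[OF p(1)]
        orth_projD(2)[OF p(1)] orth_proj_norm_le_1[OF p(1)]], rule that)
  have sa: "Q\<dagger> = Q"
  proof (rule blinfun_eqI)
    show "Q\<dagger> x = Q x" for x
      using Q(1)[of x] Q(3)[of x] by (simp add: orth_projD(1)[OF p(1)] sums_unique2)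
  qed
  have PQ: "P i o\<^sub>L Q = P i" for i
  proof (rule blinfun_eqI)
    fix x
    have "(\<lambda>j. P i (P j x)) sums P i (Q x)"
      by (rule bounded_linear.sums[OF blinfun.bounded_linear_right Q(1)])
    moreover have "(\<lambda>j. P i (P j x)) sums P i x"
    proof -
      have "(\<lambda>j. P i (P j x)) = (\<lambda>j. if j = i then P i x else 0)"
        by (auto simp: fun_eq_iff p(3) orth_projD(3)[OF p(1)])
      then show ?thesis using sums_single[of i "\<lambda>j. P i x"] by simp
    qed
    ultimately show "(P i o\<^sub>L Q) x = P i x" by (simp add: sums_unique2)
  qed
  then have QP: "Q o\<^sub>L P i = P i" for i
    by (metis PQ sa orth_projD(1)[OF p(1)] hadj_compose)
  have "orth_proj Q"
  proof (rule orth_projI[OF sa])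
    fix x
    have "(\<lambda>i. P i (Q x)) sums Q (Q x)" by (rule Q)
    moreover have "P i (Q x) = P i x" for i using PQ by (metis blinfun_apply_blinfun_compose)
    ultimately show "Q (Q x) = Q x" using Q(1)[of x] by (simp add: sums_unique2)
  qed
  then show ?thesis using that Q QP PQ by blast
qed

section \<open>Commutants as a substitute for functional calculus\<close>

section \<open>Commutants\<close>

text \<open>The commutant among all real-linear operators. Adjoining multiplication by
  \<open>\<i>\<close> to \<open>N\<close> recovers the notion restricted to complex-linear
  ones.\<close>

definition commuting :: "('a::hilbert_space \<Rightarrow>\<^sub>L 'a) set \<Rightarrow> ('a \<Rightarrow>\<^sub>L 'a) set" where
  "commuting N = {T. \<forall>X\<in>N. T o\<^sub>L X = X o\<^sub>L T}"

text \<open>Takes the place of the functions of \<open>T\<close>: whatever is built from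
  \<open>T\<close> in this set lies in every commutant containing \<open>T\<close>, and commutes
  with every projection commuting with \<open>T\<close>.\<close>

abbreviation "bicommuting T \<equiv> commuting (commuting {T})"

lemma commutingI: "(\<And>X x. X \<in> N \<Longrightarrow> T (X x) = X (T x)) \<Longrightarrow> T \<in> commuting N"
  for N :: "('a::hilbert_space \<Rightarrow>\<^sub>L 'a) set" and T :: "'a \<Rightarrow>\<^sub>L 'a"
  unfolding commuting_def by (auto intro!: blinfun_eqI)

lemma commutingD: "T \<in> commuting N \<Longrightarrow> X \<in> N \<Longrightarrow> T (X x) = X (T x)"
  for T X :: "'a::hilbert_space \<Rightarrow>\<^sub>L 'a"
  unfolding commuting_def by (metis (mono_tags, lifting)
      blinfun_apply_blinfun_compose mem_Collect_eq)

lemma commuting_compose [simp, intro]: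
  "S \<in> commuting N \<Longrightarrow> T \<in> commuting N \<Longrightarrow> S o\<^sub>L T \<in> commuting N"
  by (rule commutingI) (simp add: commutingD)

lemma commuting_add [simp, intro]:
  "S \<in> commuting N \<Longrightarrow> T \<in> commuting N \<Longrightarrow> S + T \<in> commuting N"
  by (rule commutingI) (simp add: commutingD blinfun_apply_simps)

lemma commuting_diff [simp, intro]:
  "S \<in> commuting N \<Longrightarrow> T \<in> commuting N \<Longrightarrow> S - T \<in> commuting N"
  by (rule commutingI) (simp add: commutingD blinfun_apply_simps)

lemma commuting_scaleR [simp, intro]: "T \<in> commuting N \<Longrightarrow> c *\<^sub>R T \<in> commuting N"
  by (rule commutingI) (simp add: commutingD blinfun_apply_simps)

lemma commuting_id [intro, simp]: "id_blinfun \<in> commuting N"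
  by (rule commutingI) simp

lemma commuting_zero [intro, simp]: "0 \<in> commuting N"
  by (rule commutingI) (simp add: blinfun_apply_simps)

lemma commuting_sum [simp, intro]: "(\<And>i. i \<in> I \<Longrightarrow> f i \<in> commuting N) \<Longrightarrow> sum f I \<in> commuting N"
  by (induction I rule: infinite_finite_induct) auto

lemma commuting_hadj:
  assumes "T \<in> commuting N" "\<And>X. X \<in> N \<Longrightarrow> X\<dagger> \<in> N"
  shows "T\<dagger> \<in> commuting N"
  unfolding commuting_def
proof (intro CollectI ballI)
  fix X assume "X \<in> N"
  then have "T o\<^sub>L X\<dagger> = X\<dagger> o\<^sub>L T" using assms by (auto simp: commuting_def)
  from arg_cong[OF this, of hadj] show "T\<dagger> o\<^sub>L X = X o\<^sub>L T\<dagger>" by simp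
qed

lemma commuting_tendsto:
  assumes "\<And>n. T n \<in> commuting N" "\<And>x. (\<lambda>n. T n x) \<longlonglongrightarrow> blinfun_apply S x"
  shows "S \<in> commuting N"
proof (rule commutingI)
  fix X x assume X: "X \<in> N"
  have "(\<lambda>n. X (T n x)) \<longlonglongrightarrow> X (S x)"
    by (rule bounded_linear.tendsto[OF blinfun.bounded_linear_right assms(2)])
  moreover have "X (T n x) = T n (X x)" for n using commutingD[OF assms(1) X] by simp
  ultimately show "S (X x) = X (S x)" using assms(2)[of "X x"] LIMSEQ_unique by simp
qed

lemma commuting_sums:
  assumes "\<And>i. T i \<in> commuting N" "\<And>x. (\<lambda>i. T i x) sums blinfun_apply S x"
  shows "S \<in> commuting N"
proof (rule commuting_tendsto)
  show "(\<Sum>i<n. T i) \<in> commuting N" for n using assms by auto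
  show "(\<lambda>n. (\<Sum>i<n. T i) x) \<longlonglongrightarrow> S x" for x
    using assms(2)[of x] by (simp add: sums_def blinfun.sum_left)
qed

lemma commuting_closed: "closed (commuting N)"
  unfolding closed_sequential_limits
proof (intro allI impI, elim conjE)
  fix T S assume T: "\<forall>n. T n \<in> commuting N" "T \<longlonglongrightarrow> S"
  show "S \<in> commuting N"
    by (rule commuting_tendsto[of T])
      (use T in \<open>auto intro: bounded_linear.tendsto[OF blinfun.bounded_linear_left]\<close>)
qed

lemma commuting_bicommuting:
  assumes "T \<in> commuting N"
  shows "bicommuting T \<subseteq> commuting N"
proof -
  have "N \<subseteq> commuting {T}" using assms by (auto simp: commuting_def)
  then show ?thesis by (auto simp: commuting_def)
qed

lemma bicommuting_self [simp]: "T \<in> bicommuting T"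
  by (auto simp: commuting_def)

lemma bicommuting_commute: "S \<in> bicommuting T \<Longrightarrow> X o\<^sub>L T = T o\<^sub>L X \<Longrightarrow> S o\<^sub>L X = X o\<^sub>L S"
  by (auto simp: commuting_def)

lemma bicommuting_commute': "S \<in> bicommuting T \<Longrightarrow> S (T x) = T (S x)"
  for S T :: "'a::hilbert_space \<Rightarrow>\<^sub>L 'a"
  using bicommuting_commute[of S T T] by (metis blinfun_apply_blinfun_compose)

lemma hadj_commuting_single: "T\<dagger> = T \<Longrightarrow> X \<in> commuting {T} \<Longrightarrow> X\<dagger> \<in> commuting {T}"
  by (rule commuting_hadj) auto

text \<open>Invariance of \<open>L\<close> under \<open>X\<close> gives \<open>P X P = X P\<close>.
  The adjoint of the same identity for \<open>X\<dagger>\<close> gives \<open>P X P = P X\<close>,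
  which is where closure of \<open>N\<close> under adjoints enters.\<close>

lemma commuting_proj:
  assumes P: "orth_proj P" "\<And>x. P x = x \<longleftrightarrow> x \<in> L"
    and inv: "\<And>X x. X \<in> N \<Longrightarrow> x \<in> L \<Longrightarrow> blinfun_apply X x \<in> L"
    and N: "\<And>X. X \<in> N \<Longrightarrow> X\<dagger> \<in> N"
  shows "P \<in> commuting N"
proof -
  have pl: "P x \<in> L" for x using P orth_projD(3) by metis
  have *: "P o\<^sub>L X o\<^sub>L P = X o\<^sub>L P" if "X \<in> N" for X
    using inv[OF that pl] P(2) by (intro blinfun_eqI) simp
  show ?thesis
    unfolding commuting_def
  proof (intro CollectI ballI)
    fix X assume X: "X \<in> N"
    have "P o\<^sub>L X o\<^sub>L P = P o\<^sub>L X"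
      using arg_cong[OF *[OF N[OF X]], of hadj] P(1)
      by (simp add: orth_projD blinfun_compose_assoc)
    then show "P o\<^sub>L X = X o\<^sub>L P" using *[OF X] by simp
  qed
qed

section \<open>Square roots and inverses\<close>

lemma bicommuting_trans: "S \<in> bicommuting T \<Longrightarrow> R \<in> bicommuting S \<Longrightarrow> R \<in> bicommuting T"
  using commuting_bicommuting by blast

lemma bounded_linear_hadj: "bounded_linear hadj"
  by (rule bounded_linear_intro[of _ 1]) auto

lemma closed_selfadjoint: "closed {T. T\<dagger> = T}"
  by (intro closed_Collect_eq linear_continuous_on bounded_linear_hadj continuous_on_id)

text \<open>
  The square root of \<open>1 - X\<close> is \<open>1 - Y\<close> where \<open>Y\<close> is the limit of the iteration
  \<open>Y \<mapsto> (X + Y\<^sup>2) / 2\<close>; its increments are dominated by those of the scalar iteration for \<open>X = 1\<close>.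
\<close>

lemma contraction_sqrt:
  fixes X :: "'a::hilbert_space \<Rightarrow>\<^sub>L 'a"
  assumes X: "X\<dagger> = X" "norm X \<le> 1"
  shows "\<exists>Y. Y\<dagger> = Y \<and> norm Y \<le> 1 \<and> 2 *\<^sub>R Y = X + (Y o\<^sub>L Y) \<and> Y \<in> bicommuting X"
proof -
  define Y where "Y = rec_nat 0 (\<lambda>_ Y. (1/2) *\<^sub>R (X + (Y o\<^sub>L Y)))"
  define y where "y = rec_nat (0::real) (\<lambda>_ y. (1 + y\<^sup>2) / 2)"
  have Y0: "Y 0 = 0" and YS: "Y (Suc n) = (1/2) *\<^sub>R (X + (Y n o\<^sub>L Y n))" for n
    by (simp_all add: Y_def)
  have y0: "y 0 = 0" and yS: "y (Suc n) = (1 + (y n)\<^sup>2) / 2" for n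
    by (simp_all add: y_def)
  have y01: "0 \<le> y n \<and> y n \<le> 1" for n
  proof (induction n)
    case (Suc n)
    then have "(y n)\<^sup>2 \<le> 1" by (simp add: power_le_one)
    then show ?case by (simp add: yS)
  qed (simp add: y0)
  have yinc: "y n \<le> y (Suc n)" for n
  proof -
    have "0 \<le> (1 - y n)\<^sup>2" by simp
    then show ?thesis by (simp add: yS power2_eq_square algebra_simps)
  qed
  have Yn: "norm (Y n) \<le> y n" for n
  proof (induction n)
    case (Suc n)
    have "norm (Y n o\<^sub>L Y n) \<le> (y n)\<^sup>2"
      using norm_blinfun_compose[of "Y n" "Y n"] mult_mono[OF Suc Suc] y01[of n]
      by (simp add: power2_eq_square)
    then show ?case
      using norm_triangle_ineq[of X "Y n o\<^sub>L Y n"] X(2) by (simp add: YS yS)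
  qed (simp add: Y0 y0)
  have Yd: "norm (Y (Suc n) - Y n) \<le> y (Suc n) - y n" for n
  proof (induction n)
    case 0
    then show ?case using X(2) by (simp add: YS yS Y0 y0)
  next
    case (Suc n)
    let ?D = "Y (Suc n) - Y n"
    \<comment> \<open>The identity \<open>a\<^sup>2 - b\<^sup>2 = a (a - b) + (a - b) b\<close>, in
      an order of factors that is valid without commutativity.\<close>
    have e: "Y (Suc (Suc n)) - Y (Suc n) = (1/2) *\<^sub>R ((Y (Suc n) o\<^sub>L ?D) + (?D o\<^sub>L Y n))"
      by (rule blinfun_eqI) (simp add: YS[of "Suc n"] YS[of n] blinfun_apply_simps algebra_simps)
    have "norm (Y (Suc n) o\<^sub>L ?D) \<le> y (Suc n) * (y (Suc n) - y n)"
      using norm_blinfun_compose[of "Y (Suc n)" ?D] mult_mono[OF Yn[of "Suc n"] Suc] y01[of "Suc n"]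
      by simp
    moreover have "norm (?D o\<^sub>L Y n) \<le> (y (Suc n) - y n) * y n"
      using norm_blinfun_compose[of ?D "Y n"] mult_mono[OF Suc Yn[of n]] yinc[of n]
      by simp
    ultimately have "norm ((Y (Suc n) o\<^sub>L ?D) + (?D o\<^sub>L Y n)) \<le> (y (Suc n))\<^sup>2 - (y n)\<^sup>2"
      using norm_triangle_ineq[of "Y (Suc n) o\<^sub>L ?D" "?D o\<^sub>L Y n"]
      by (simp add: power2_eq_square algebra_simps)
    then show ?case unfolding e using yS[of "Suc n"] yS[of n] by simp
  qed
  have Yd': "norm (Y (m + k) - Y m) \<le> y (m + k) - y m" for m k
  proof (induction k)
    case (Suc k)
    have "norm (Y (m + Suc k) - Y m) \<le> norm (Y (Suc (m + k)) - Y (m + k)) + norm (Y (m + k) - Y m)"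
      using norm_triangle_ineq[of "Y (Suc (m + k)) - Y (m + k)" "Y (m + k) - Y m"] by simp
    then show ?case using Suc Yd[of "m + k"] by simp
  qed simp
  have "incseq y" using yinc by (rule incseq_SucI)
  then have "convergent y"
    using y01 by (intro Bseq_mono_convergent) (auto simp: incseq_def intro!: BseqI'[of _ 1])
  then have cy: "Cauchy y" by (rule convergent_Cauchy)
  have "Cauchy Y"
  proof (rule metric_CauchyI)
    fix e :: real assume "0 < e"
    then obtain N where N: "\<And>m n. m \<ge> N \<Longrightarrow> n \<ge> N \<Longrightarrow> dist (y m) (y n) < e"
      using cy unfolding Cauchy_def by meson
    have *: "dist (Y (m + k)) (Y m) < e" if "m \<ge> N" for m k
      using Yd'[of m k] N[of "m + k" m] that by (simp add: dist_norm)
    have "dist (Y m) (Y n) < e" if "m \<ge> N" "n \<ge> N" for m n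
      using *[of m "n - m"] *[of n "m - n"] that by (cases "m \<le> n") (auto simp: dist_commute)
    then show "\<exists>N. \<forall>m\<ge>N. \<forall>n\<ge>N. dist (Y m) (Y n) < e" by blast
  qed
  then obtain Z where Z: "Y \<longlonglongrightarrow> Z" using Cauchy_convergent convergentD by blast
  have Yp: "(Y n)\<dagger> = Y n \<and> Y n \<in> bicommuting X" for n
    by (induction n) (auto simp: Y0 YS X(1))
  have "Z\<dagger> = Z"
    using closed_sequentially[OF closed_selfadjoint _ Z] Yp by auto
  moreover have "Z \<in> bicommuting X"
    using closed_sequentially[OF commuting_closed _ Z] Yp by auto
  moreover have "norm Z \<le> 1"
    by (rule LIMSEQ_le_const2[OF tendsto_norm[OF Z]]) (meson Yn y01 order_trans)
  moreover have "2 *\<^sub>R Z = X + (Z o\<^sub>L Z)"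
  proof -
    have "(\<lambda>n. (1/2) *\<^sub>R (X + (Y n o\<^sub>L Y n))) \<longlonglongrightarrow> (1/2) *\<^sub>R (X + (Z o\<^sub>L Z))"
      by (intro tendsto_intros Z bounded_bilinear.tendsto[OF bounded_bilinear_blinfun_compose])
    then have "(\<lambda>n. Y (Suc n)) \<longlonglongrightarrow> (1/2) *\<^sub>R (X + (Z o\<^sub>L Z))" by (simp add: YS)
    then have "Z = (1/2) *\<^sub>R (X + (Z o\<^sub>L Z))"
      using LIMSEQ_Suc[OF Z] LIMSEQ_unique by blast
    then show ?thesis
      by (metis (no_types) scaleR_scaleR scaleR_one nonzero_mult_div_cancel_left
          times_divide_eq_right mult.right_neutral zero_neq_numeral)
  qed
  ultimately show ?thesis by blast
qed

text \<open>After rescaling, \<open>0 \<le> U \<le> 1\<close>, so \<open>X = 1 - U\<close> is a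
  contraction, and \<open>2 Y = X + Y\<^sup>2\<close> says exactly that
  \<open>(1 - Y)\<^sup>2 = U\<close>. The summand 1 in \<open>K\<close> keeps the scale positive
  when \<open>T = 0\<close>.\<close>

lemma psd_sqrt_exists:
  fixes T :: "'a::hilbert_space \<Rightarrow>\<^sub>L 'a"
  assumes T: "psd T"
  shows "\<exists>S. psd S \<and> S o\<^sub>L S = T \<and> S \<in> bicommuting T"
proof -
  define K where "K = norm T + 1"
  have K: "0 < K" by (simp add: K_def add_nonneg_pos)
  define U where "U = (1 / K) *\<^sub>R T"
  define X where "X = id_blinfun - U"
  have U: "psd U" unfolding U_def using T K by (intro psd_scaleR) auto
  have nU: "norm U \<le> 1" using K by (simp add: U_def K_def)
  have "norm X \<le> 1"
  proof (rule norm_blinfun_bound)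
    fix x
    have "(norm (U x))\<^sup>2 \<le> inner (U x) x"
      using psd_norm_apply'[OF U, of x] mult_right_mono[OF nU psdD(2)[OF U, of x]] by simp
    then have "(norm (X x))\<^sup>2 \<le> (norm x)\<^sup>2"
      using psdD(2)[OF U, of x] unfolding X_def power2_norm_eq_inner
      by (simp add: blinfun_apply_simps inner_simps inner_commute)
    then show "norm (X x) \<le> 1 * norm x" by (simp add: power2_le_iff_abs_le)
  qed simp
  moreover have Xs: "X\<dagger> = X" using psdD(1)[OF U] by (simp add: X_def)
  ultimately obtain Y where Y: "Y\<dagger> = Y" "norm Y \<le> 1" "2 *\<^sub>R Y = X + (Y o\<^sub>L Y)"
    "Y \<in> bicommuting X" using contraction_sqrt by blast
  define S where "S = sqrt K *\<^sub>R (id_blinfun - Y)"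
  have "psd (id_blinfun - Y)"
    unfolding psd_def
  proof (intro conjI allI)
    show "0 \<le> inner ((id_blinfun - Y) x) x" for x
      using inner_apply_le[of Y x] mult_right_mono[OF Y(2), of "(norm x)\<^sup>2"]
      by (simp add: blinfun_apply_simps inner_simps power2_norm_eq_inner)
  qed (simp add: Y)
  then have "psd S" unfolding S_def using K by (intro psd_scaleR) auto
  moreover have "S o\<^sub>L S = T"
  proof (rule blinfun_eqI)
    fix x
    have "2 *\<^sub>R Y x = X x + Y (Y x)"
      using arg_cong[OF Y(3), of "\<lambda>f. blinfun_apply f x"] by (simp add: blinfun_apply_simps)
    then have "x - Y x - (Y x - Y (Y x)) = U x"
      by (simp add: X_def blinfun_apply_simps algebra_simps scaleR_2)
    then show "(S o\<^sub>L S) x = T x"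
      using K by (simp add: S_def U_def blinfun_apply_simps flip: scaleR_diff_right)
  qed
  moreover have "S \<in> bicommuting T"
  proof -
    have "X \<in> bicommuting T" unfolding X_def U_def by auto
    then have "Y \<in> bicommuting T" using Y(4) bicommuting_trans by blast
    then show ?thesis unfolding S_def by auto
  qed
  ultimately show ?thesis by blast
qed

text \<open>A Neumann series in the form of a fixed point: \<open>Z = 1 - T / K\<close> has norm
  below 1, and \<open>Y = 1 + Z Y\<close> says that \<open>Y / K\<close> is a right inverse of
  \<open>T\<close>. Running the iteration inside the complete set \<open>s\<close> delivers
  self-adjointness and the bicommutant property together with existence.\<close>

lemma psd_inverse_exists:
  fixes T :: "'a::hilbert_space \<Rightarrow>\<^sub>L 'a"
  assumes T: "psd T" and e: "0 < e" "\<And>x. e * (norm x)\<^sup>2 \<le> inner (T x) x"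
  shows "\<exists>Y. psd Y \<and> T o\<^sub>L Y = id_blinfun \<and> Y \<in> bicommuting T"
proof -
  define K where "K = norm T + e"
  have K: "0 < K" "e \<le> K" using e by (auto simp: K_def add_nonneg_pos)
  define Z where "Z = id_blinfun - (1 / K) *\<^sub>R T"
  have Zin: "inner (Z x) x = (norm x)\<^sup>2 - inner (T x) x / K" for x
    by (simp add: Z_def blinfun_apply_simps inner_simps power2_norm_eq_inner)
  have "psd Z"
    unfolding psd_def
  proof (intro conjI allI)
    show "Z\<dagger> = Z" using psdD(1)[OF T] by (simp add: Z_def)
    fix x
    have "inner (T x) x \<le> K * (norm x)\<^sup>2"
      using inner_apply_le[of T x] mult_nonneg_nonneg[OF less_imp_le[OF e(1)], of "(norm x)\<^sup>2"]
      by (simp add: K_def algebra_simps del: mult_nonneg_nonneg zero_le_mult_iff)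
    then show "0 \<le> inner (Z x) x" using K by (simp add: Zin field_simps)
  qed
  moreover have "inner (Z x) x \<le> (1 - e / K) * (norm x)\<^sup>2" for x
    using e(2)[of x] K by (simp add: Zin field_simps)
  ultimately have nZ: "norm Z \<le> 1 - e / K"
    using K by (intro psd_norm_le) auto
  then have nZ1: "norm Z < 1" using e K by (smt (verit) divide_pos_pos)
  have ZT: "Z \<in> bicommuting T" unfolding Z_def by auto
  have ZT': "Z o\<^sub>L T = T o\<^sub>L Z"
    by (rule blinfun_eqI) (simp add: Z_def blinfun_apply_simps)
  have Zs: "Z\<dagger> = Z" using \<open>psd Z\<close> psdD by blast
  define s where "s = bicommuting T \<inter> {Y. Y\<dagger> = Y}"
  define g where "g Y = id_blinfun + (Z o\<^sub>L Y)" for Y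
  have "\<exists>!Y. Y \<in> s \<and> g Y = Y"
  proof (rule Banach_fix[of s "norm Z" g])
    show "complete s"
      unfolding s_def by (intro closed_Int commuting_closed closed_selfadjoint complete_eq_closed[THEN iffD2])
    show "s \<noteq> {}" by (auto simp: s_def intro!: exI[of _ id_blinfun])
    show "g ` s \<subseteq> s"
    proof
      fix V assume "V \<in> g ` s"
      then obtain Y where Y: "Y \<in> bicommuting T" "Y\<dagger> = Y" "V = g Y" by (auto simp: s_def)
      \<comment> \<open>Commutation makes \<open>Z Y\<close>, and with it the next iterate,
        self-adjoint.\<close>
      have "Y o\<^sub>L Z = Z o\<^sub>L Y" using bicommuting_commute[OF Y(1) ZT'] .
      then show "V \<in> s" using Y ZT by (auto simp: s_def g_def Zs)
    qed
    show "dist (g x) (g y) \<le> norm Z * dist x y" for x y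
    proof -
      have "g x - g y = Z o\<^sub>L (x - y)"
        by (rule blinfun_eqI) (simp add: g_def blinfun_apply_simps)
      then show ?thesis using norm_blinfun_compose[of Z "x - y"] by (simp add: dist_norm)
    qed
  qed (use nZ1 in auto)
  then obtain Y where Y: "Y \<in> bicommuting T" "Y\<dagger> = Y" "id_blinfun + (Z o\<^sub>L Y) = Y"
    unfolding s_def g_def by blast
  define V where "V = (1 / K) *\<^sub>R Y"
  have TV: "T (V x) = x" for x
    using arg_cong[OF Y(3), of "\<lambda>f. blinfun_apply f x"]
    by (simp add: V_def Z_def blinfun_apply_simps)
  have "V\<dagger> = V" by (simp add: V_def Y)
  moreover have "0 \<le> inner (V x) x" for x
    using psdD(2)[OF T, of "V x"] by (simp add: TV inner_commute)
  ultimately have "psd V" by (simp add: psd_def)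
  moreover have "T o\<^sub>L V = id_blinfun" by (rule blinfun_eqI) (simp add: TV)
  moreover have "V \<in> bicommuting T" unfolding V_def using Y by auto
  ultimately show ?thesis by blast
qed

section \<open>The spectral family\<close>

text \<open>\<open>E\<close> is the spectral projection of \<open>T\<close> for
  \<open>{..l}\<close>, described through the form alone. Strictness on the kernel puts the
  eigenvectors for \<open>l\<close> into the range of \<open>E\<close>; this decides monotonicity
  and right continuity in \<open>l\<close>.\<close>

definition spectral_cut ::
    "('a::hilbert_space \<Rightarrow>\<^sub>L 'a) \<Rightarrow> real \<Rightarrow> ('a \<Rightarrow>\<^sub>L 'a) \<Rightarrow> bool" where
  "spectral_cut T l E \<longleftrightarrow> orth_proj E \<and> E \<in> bicommuting T \<and>
     (\<forall>x. E x = x \<longrightarrow> inner (T x) x \<le> l * (norm x)\<^sup>2) \<and>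
     (\<forall>x. E x = 0 \<longrightarrow> x \<noteq> 0 \<longrightarrow> l * (norm x)\<^sup>2 < inner (T x) x)"

lemma spectral_cutD:
  assumes "spectral_cut T l E"
  shows "orth_proj E" "E \<in> bicommuting T" "E x = x \<Longrightarrow> inner (T x) x \<le> l * (norm x)\<^sup>2"
    "E x = 0 \<Longrightarrow> x \<noteq> 0 \<Longrightarrow> l * (norm x)\<^sup>2 < inner (T x) x"
    "E x = 0 \<Longrightarrow> l * (norm x)\<^sup>2 \<le> inner (T x) x"
  using assms by (auto simp: spectral_cut_def blinfun.zero_right le_less)

text \<open>With \<open>X = T - l\<close>, the projection onto the kernel of \<open>\<bar>X\<bar> + X\<close> works.\<close>

lemma spectral_cut_exists:
  fixes T :: "'a::hilbert_space \<Rightarrow>\<^sub>L 'a"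
  assumes T: "T\<dagger> = T"
  shows "\<exists>E. spectral_cut T l E"
proof -
  define X where "X = T - l *\<^sub>R id_blinfun"
  have Xs: "X\<dagger> = X" using T by (simp add: X_def)
  have Xin: "inner (X x) x = inner (T x) x - l * (norm x)\<^sup>2" for x
    by (simp add: X_def blinfun_apply_simps inner_simps power2_norm_eq_inner)
  have XT: "X \<in> bicommuting T" unfolding X_def by auto
  have "psd (X o\<^sub>L X)" using psd_hadj_compose(1)[of X] Xs by simp
  then obtain S where S: "psd S" "S o\<^sub>L S = X o\<^sub>L X" "S \<in> bicommuting (X o\<^sub>L X)"
    using psd_sqrt_exists by blast
  have ST: "S \<in> bicommuting T"
    using S(3) XT by (meson bicommuting_trans commuting_compose)
  have SX: "S (X x) = X (S x)" for x
  proof -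
    have "S o\<^sub>L X = X o\<^sub>L S"
      by (rule bicommuting_commute[OF S(3)]) (simp add: blinfun_compose_assoc)
    then show ?thesis by (metis blinfun_apply_blinfun_compose)
  qed
  have SS: "S (S x) = X (X x)" for x using S(2) by (metis blinfun_apply_blinfun_compose)
  define L where "L = {x. S x + X x = 0}"
  have "subspace L"
    by (auto simp: L_def subspace_def blinfun_apply_simps algebra_simps
        simp flip: scaleR_add_right)
  moreover have "closed L"
    unfolding L_def by (intro closed_Collect_eq continuous_intros)
  ultimately obtain E where E: "orth_proj E" "\<And>x. E x = x \<longleftrightarrow> x \<in> L"
    using exists_orth_proj by blast
  have ET: "E \<in> bicommuting T"
  proof (rule commuting_proj[OF E])
    show "Y x \<in> L" if Y: "Y \<in> commuting {T}" and "x \<in> L" for Y x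
    proof -
      have "S (Y x) + X (Y x) = Y (S x + X x)"
        using commutingD[OF ST Y] commutingD[OF XT Y] by (simp add: blinfun.add_right)
      also have "\<dots> = 0" using \<open>x \<in> L\<close> by (simp add: L_def blinfun.zero_right)
      finally show ?thesis by (simp add: L_def)
    qed
  qed (rule hadj_commuting_single[OF T])
  have "inner (X x) x \<le> 0" if "E x = x" for x
  proof -
    have "X x = - S x" using that E(2) by (simp add: L_def eq_neg_iff_add_eq_0 add.commute)
    then show ?thesis using psdD(2)[OF S(1), of x] by simp
  qed
  moreover have "0 < inner (X x) x" if "E x = 0" "x \<noteq> 0" for x
  proof -
    have c: "E (S x) = S (E x)" "E (X x) = X (E x)"
    proof -
      have "S \<in> commuting {T}" "X \<in> commuting {T}"
        using bicommuting_commute'[OF ST] bicommuting_commute'[OF XT]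
        by (auto intro!: commutingI)
      then show "E (S x) = S (E x)" "E (X x) = X (E x)"
        using commutingD[OF ET] by blast+
    qed
    \<comment> \<open>From \<open>S\<^sup>2 = X\<^sup>2\<close> and commutation,
      \<open>(S + X) (S - X) = 0\<close>. So \<open>E\<close> fixes \<open>S x - X x\<close>, but
      also kills it because \<open>E x = 0\<close>; hence \<open>X\<close> agrees at
      \<open>x\<close> with the positive operator \<open>S\<close>.\<close>
    have "S x - X x \<in> L" by (simp add: L_def blinfun_apply_simps SS SX)
    then have "S x - X x = E (S x - X x)" using E(2) by metis
    also have "\<dots> = 0" using c that by (simp add: blinfun_apply_simps)
    finally have e: "X x = S x" by simp
    have "inner (S x) x \<noteq> 0"
    proof
      assume "inner (S x) x = 0"
      then have "S x = 0" by (rule psd_apply_eq_0[OF S(1)])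
      then have "x \<in> L" using e by (simp add: L_def)
      then show False using E(2)[of x] that by simp
    qed
    then show ?thesis using psdD(2)[OF S(1), of x] e by simp
  qed
  ultimately show ?thesis
    using E(1) ET unfolding spectral_cut_def by (intro exI[of _ E]) (auto simp: Xin)
qed

section \<open>Partial isometries\<close>

lemma hadj_compose_self_eq_0:
  assumes "X\<dagger> o\<^sub>L X = 0"
  shows "X = 0"
proof (rule blinfun_eqI)
  show "X x = blinfun_apply 0 x" for x
    using power2_norm_apply[of X x] by (simp add: assms blinfun.zero_left)
qed

lemma partial_isometry_initial:
  assumes "V\<dagger> o\<^sub>L V = F" "orth_proj F"
  shows "V o\<^sub>L F = V" "F o\<^sub>L V\<dagger> = V\<dagger>"
proof -
  have "(V - (V o\<^sub>L F))\<dagger> o\<^sub>L (V - (V o\<^sub>L F)) = 0"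
  proof (rule blinfun_eqI)
    fix x
    have *: "V\<dagger> (V y) = F y" for y using assms(1) by (metis blinfun_apply_blinfun_compose)
    show "((V - (V o\<^sub>L F))\<dagger> o\<^sub>L (V - (V o\<^sub>L F))) x = blinfun_apply 0 x"
      using assms(2) by (simp add: blinfun_apply_simps orth_projD * )
  qed
  then show 1: "V o\<^sub>L F = V" using hadj_compose_self_eq_0 by fastforce
  show "F o\<^sub>L V\<dagger> = V\<dagger>"
    using arg_cong[OF 1, of hadj] assms(2) by (simp add: orth_projD)
qed

lemma partial_isometry_norm:
  assumes "V\<dagger> o\<^sub>L V = F" "orth_proj F"
  shows "norm (V x) = norm (F x)" "norm V \<le> 1"
proof -
  have "(norm (V x))\<^sup>2 = (norm (F x))\<^sup>2" for x
    using power2_norm_apply[of V x] assms by (simp add: orth_proj_inner_self)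
  then show *: "norm (V x) = norm (F x)" for x by simp
  show "norm V \<le> 1"
    by (rule norm_blinfun_bound) (auto simp: * orth_proj_norm_le[OF assms(2)])
qed

lemma orthogonal_partial_isometries:
  assumes T: "\<And>k l. (T k)\<dagger> o\<^sub>L T l = (if k = l then F else 0)" and F: "orth_proj F"
  shows "orth_family (\<lambda>k. T k o\<^sub>L (T k)\<dagger>)"
    "(T k o\<^sub>L (T k)\<dagger>) o\<^sub>L T k = T k"
proof -
  have TF: "T k o\<^sub>L F = T k" for k
    by (rule partial_isometry_initial(1)[OF _ F]) (simp add: T)
  have a: "T k ((T k)\<dagger> (T l x)) = (if k = l then T k x else 0)" for k l x
  proof -
    have "(T k)\<dagger> (T l x) = (if k = l then F x else 0)"
      using T[of k l] by (metis blinfun_apply_blinfun_compose blinfun.zero_left)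
    then show ?thesis using TF[of k]
      by (auto simp: blinfun.zero_right) (metis blinfun_apply_blinfun_compose)
  qed
  show "(T k o\<^sub>L (T k)\<dagger>) o\<^sub>L T k = T k"
    by (rule blinfun_eqI) (simp add: a)
  show "orth_family (\<lambda>k. T k o\<^sub>L (T k)\<dagger>)"
    unfolding orth_family_def
    by (auto intro!: orth_projI blinfun_eqI simp: a blinfun_apply_simps)
qed

text \<open>\<open>R\<close> is wandering for \<open>V\<close>, as in the Wold decomposition:
  \<open>V\<dagger> R = 0\<close>, so cancelling common factors \<open>V\<dagger> V\<close> leaves
  either \<open>R\<close> or 0. The operator \<open>T k\<close> is \<open>V ^ k R\<close>.\<close>

lemma orthogonal_iterates:
  assumes V: "V\<dagger> o\<^sub>L V = F" "F o\<^sub>L V = V" and R: "orth_proj R" "F o\<^sub>L R = R" "R o\<^sub>L V = 0"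
  defines "T \<equiv> \<lambda>k. ((o\<^sub>L) V ^^ k) R"
  shows "F o\<^sub>L T k = T k" "(T k)\<dagger> o\<^sub>L T l = (if k = l then R else 0)"
proof -
  have T0: "T 0 = R" and TS: "T (Suc k) = V o\<^sub>L T k" for k by (simp_all add: T_def)
  show FT: "F o\<^sub>L T k = T k" for k
    by (cases k) (simp_all add: T0 TS R(2) V(2) flip: blinfun_compose_assoc)
  have VR: "V\<dagger> o\<^sub>L R = 0" using R(1,3) by (metis hadj_compose hadj_zero orth_projD(1))
  show "(T k)\<dagger> o\<^sub>L T l = (if k = l then R else 0)"
  proof (induction k arbitrary: l)
    case 0
    show ?case
      by (cases l) (simp_all add: T0 TS orth_projD[OF R(1)] R(3) flip: blinfun_compose_assoc)
  next
    case (Suc k)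
    show ?case
    proof (cases l)
      case 0
      then show ?thesis by (simp add: T0 TS blinfun_compose_assoc VR)
    next
      case (Suc l')
      have "(T (Suc k))\<dagger> o\<^sub>L T l = (T k)\<dagger> o\<^sub>L ((V\<dagger> o\<^sub>L V) o\<^sub>L T l')"
        by (simp add: TS Suc blinfun_compose_assoc)
      then show ?thesis using Suc.IH[of l'] Suc by (simp add: V(1) FT)
    qed
  qed
qed

section \<open>Comparison of projections in a factor of type III\<close>

section \<open>Factors of type III\<close>

text \<open>
  A von Neumann algebra is presented as the commutant, among all real-linear operators, of a
  \<open>\<dagger>\<close>-closed set \<open>N\<close>: its complex commutant together with the multiplication by \<open>\<plusminus>\<i>\<close>.
\<close>

locale type_III_commutant =
  fixes N :: "('a::hilbert_space \<Rightarrow>\<^sub>L 'a) set"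
  assumes N_hadj: "X \<in> N \<Longrightarrow> X\<dagger> \<in> N"
    and central_proj: "orth_proj P \<Longrightarrow> P \<in> commuting N \<Longrightarrow> P \<in> commuting (commuting N) \<Longrightarrow>
      P = 0 \<or> P = id_blinfun"
    and infinite_proj: "orth_proj F \<Longrightarrow> F \<in> commuting N \<Longrightarrow> F \<noteq> 0 \<Longrightarrow>
      \<exists>V\<in>commuting N. V\<dagger> o\<^sub>L V = F \<and> F o\<^sub>L (V o\<^sub>L V\<dagger>) = V o\<^sub>L V\<dagger> \<and> V o\<^sub>L V\<dagger> \<noteq> F"
    and sigma_finite: "\<A> \<subseteq> {P \<in> commuting N. orth_proj P \<and> P \<noteq> 0} \<Longrightarrow>
      (\<And>P Q. P \<in> \<A> \<Longrightarrow> Q \<in> \<A> \<Longrightarrow> P \<noteq> Q \<Longrightarrow> P o\<^sub>L Q = 0) \<Longrightarrow> countable \<A>"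
begin

abbreviation "M \<equiv> commuting N"

lemma M_hadj [simp, intro]: "X \<in> M \<Longrightarrow> X\<dagger> \<in> M"
  using commuting_hadj N_hadj by blast

lemma M_bicommuting: "T \<in> M \<Longrightarrow> S \<in> bicommuting T \<Longrightarrow> S \<in> M"
  using commuting_bicommuting by blast

text \<open>The vectors that \<open>F X\<close> annihilates for all \<open>X\<close> in
  \<open>M\<close> form a subspace \<open>L\<close> invariant under both \<open>N\<close> and
  \<open>M\<close>, so its projection is central, hence 0 or 1. If nothing connected
  \<open>E\<close> to \<open>F\<close>, then \<open>L\<close> would contain the range of
  \<open>E\<close> and so be the whole space, and \<open>X = 1\<close> would give
  \<open>F = 0\<close>.\<close>

lemma M_connects:
  assumes E: "orth_proj E" "E \<in> M" "E \<noteq> 0" and F: "F \<in> M" "F \<noteq> 0"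
  shows "\<exists>X\<in>M. F o\<^sub>L (X o\<^sub>L E) \<noteq> 0"
proof (rule ccontr)
  assume neg: "\<not> ?thesis"
  define L where "L = {x. \<forall>X\<in>M. F (X x) = 0}"
  have "subspace L" by (auto simp: L_def subspace_def blinfun_apply_simps)
  moreover have "closed L"
  proof -
    have "L = (\<Inter>X\<in>M. {x. F (blinfun_apply X x) = 0})" by (auto simp: L_def)
    moreover have "closed {x. F (blinfun_apply X x) = 0}" for X
      by (intro closed_Collect_eq continuous_intros)
    ultimately show ?thesis by auto
  qed
  ultimately obtain P where P: "orth_proj P" "\<And>x. P x = x \<longleftrightarrow> x \<in> L"
    using exists_orth_proj by blast
  have "P \<in> commuting N"
  proof (rule commuting_proj[OF P])
    show "Y x \<in> L" if "Y \<in> N" "x \<in> L" for Y x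
      using that commutingD[OF _ that(1)] F(1) by (auto simp: L_def blinfun.zero_right)
  qed (rule N_hadj)
  moreover have "P \<in> commuting (commuting N)"
  proof (rule commuting_proj[OF P])
    show "Y x \<in> L" if "Y \<in> M" "x \<in> L" for Y x
      unfolding L_def
    proof (intro CollectI ballI)
      fix X assume "X \<in> M"
      then have "X o\<^sub>L Y \<in> M" using that by auto
      then show "F (X (Y x)) = 0" using that(2) unfolding L_def by fastforce
    qed
  qed (rule M_hadj)
  ultimately have "P = 0 \<or> P = id_blinfun" using central_proj P(1) by blast
  moreover have "E x \<in> L" for x
    unfolding L_def using neg by (auto dest!: arg_cong[of _ _ "\<lambda>f. blinfun_apply f x"]
        simp: blinfun.zero_left)
  then have "P (E x) = E x" for x using P(2) by blast
  then have "P \<noteq> 0" using E(3) by (auto intro!: blinfun_eqI simp: blinfun.zero_left)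
  ultimately have "x \<in> L" for x using P(2) by auto
  then have "F x = 0" for x
    unfolding L_def using commuting_id by fastforce
  then show False using F(2) by (auto intro!: blinfun_eqI simp: blinfun.zero_left)
qed

text \<open>A piece of the polar decomposition of \<open>X = F X0 E\<close>. On the spectral
  subspace \<open>S\<close> where \<open>T = X\<dagger> X\<close> is bounded below, the root
  \<open>K\<close> of an inverse of \<open>T\<close> exists, and \<open>X K S\<close> is a partial
  isometry with initial projection \<open>S\<close>. This avoids polar decomposition of operators
  that are not bounded below.\<close>

lemma partial_isometry_exists:
  assumes E: "orth_proj E" "E \<in> M" "E \<noteq> 0" and F: "F \<in> M" "F \<noteq> 0" "orth_proj F"
  shows "\<exists>U\<in>M. orth_proj (U\<dagger> o\<^sub>L U) \<and> U\<dagger> o\<^sub>L U \<noteq> 0 \<and> (U\<dagger> o\<^sub>L U) o\<^sub>L E = U\<dagger> o\<^sub>L U \<and> F o\<^sub>L U = U"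
proof -
  obtain X0 where X0: "X0 \<in> M" "F o\<^sub>L (X0 o\<^sub>L E) \<noteq> 0"
    using M_connects[OF E F(1,2)] by blast
  define X where "X = F o\<^sub>L (X0 o\<^sub>L E)"
  have X: "X \<in> M" "X \<noteq> 0" using X0 E F by (auto simp: X_def)
  have XE: "X (E x) = X x" "F (X x) = X x" for x
    using E(1) F(3) by (simp_all add: X_def orth_projD)
  define T where "T = X\<dagger> o\<^sub>L X"
  have T: "psd T" "T \<in> M" "T \<noteq> 0"
    using X hadj_compose_self_eq_0[of X] psd_hadj_compose(1)[of X] by (auto simp: T_def)
  have TE: "T (E x) = T x" for x by (simp add: T_def XE)
  \<comment> \<open>A level strictly between 0 and \<open>norm T\<close>: positive so that
    \<open>T\<close> is bounded below on \<open>S\<close>, and less than the norm so that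
    \<open>S\<close> is nonzero.\<close>
  define e where "e = norm T / 2"
  have e: "0 < e" "e < norm T" using T(3) by (auto simp: e_def)
  obtain C where C: "spectral_cut T e C" using spectral_cut_exists psdD(1)[OF T(1)] by blast
  note c = spectral_cutD[OF C]
  define S where "S = id_blinfun - C"
  have S: "orth_proj S" "S \<in> bicommuting T" "S \<noteq> 0"
  proof -
    show "orth_proj S" unfolding S_def by (rule orth_proj_compl) (rule c)
    show "S \<in> bicommuting T" unfolding S_def using c(2) by auto
    show "S \<noteq> 0"
    proof
      assume "S = 0"
      then have "C = id_blinfun" by (simp add: S_def)
      then have "inner (T x) x \<le> e * (norm x)\<^sup>2" for x using c(3) by simp
      then have "norm T \<le> e" using e by (intro psd_norm_le[OF T(1)]) auto
      then show False using e by simp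
    qed
  qed
  note s = orth_projD(3)[OF S(1)] orth_projD(1)[OF S(1)]
  have CS: "C (S x) = 0" for x by (simp add: S_def blinfun_apply_simps orth_projD[OF c(1)])
  have TS: "S (T x) = T (S x)" for x by (rule bicommuting_commute'[OF S(2)])
  \<comment> \<open>\<open>S\<close> lies below \<open>E\<close> because \<open>T\<close> vanishes
    off \<open>E\<close>, while its form is bounded below on the range of \<open>S\<close>.\<close>
  have SE: "S (E x) = S x" for x
  proof -
    define y where "y = S (x - E x)"
    have "T y = 0"
      unfolding y_def by (simp add: TE blinfun_apply_simps flip: TS)
    then have "e * (norm y)\<^sup>2 \<le> 0" using c(5)[of y] CS[of "x - E x"] by (simp add: y_def)
    then have "y = 0" using e(1) by (simp add: mult_le_0_iff)
    then show ?thesis by (simp add: y_def blinfun_apply_simps)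
  qed
  \<comment> \<open>Equal to \<open>T\<close> on the range of \<open>S\<close> and to the identity
    off it, so that it is invertible on the whole space.\<close>
  define T1 where "T1 = (T o\<^sub>L S) + C"
  have T1: "T1 \<in> bicommuting T" unfolding T1_def using S c(2) by auto
  have T1S: "T1 (S x) = T (S x)" for x by (simp add: T1_def blinfun_apply_simps s CS)
  have T1in: "inner (T1 x) x = inner (T (S x)) (S x) + (norm (C x))\<^sup>2" for x
  proof -
    have "inner (T (S x)) x = inner (T (S x)) (S x)"
      by (metis TS orth_proj_inner[OF S(1)] s(1))
    then show ?thesis
      by (simp add: T1_def blinfun_apply_simps inner_simps orth_proj_inner_self[OF c(1)])
  qed
  have T1low: "min e 1 * (norm x)\<^sup>2 \<le> inner (T1 x) x" for x
  proof -
    have "(norm x)\<^sup>2 = (norm (S x))\<^sup>2 + (norm (C x))\<^sup>2"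
      using orth_proj_pythagoras[OF c(1), of x] by (simp add: S_def blinfun_apply_simps)
    then have "min e 1 * (norm x)\<^sup>2 = min e 1 * (norm (S x))\<^sup>2 + min e 1 * (norm (C x))\<^sup>2"
      by (simp add: algebra_simps)
    also have "\<dots> \<le> e * (norm (S x))\<^sup>2 + 1 * (norm (C x))\<^sup>2"
      by (intro add_mono mult_right_mono) auto
    also have "\<dots> \<le> inner (T1 x) x"
      using c(5)[of "S x"] CS by (simp add: T1in)
    finally show ?thesis .
  qed
  have "psd T1"
    unfolding psd_def
  proof (intro conjI allI)
    have "S o\<^sub>L T = T o\<^sub>L S" by (rule blinfun_eqI) (simp add: TS)
    then show "T1\<dagger> = T1"
      by (simp add: T1_def s(2) psdD(1)[OF T(1)] orth_projD(1)[OF c(1)])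
    show "0 \<le> inner (T1 x) x" for x using psdD(2)[OF T(1)] by (simp add: T1in)
  qed
  then obtain Y where Y: "psd Y" "T1 o\<^sub>L Y = id_blinfun" "Y \<in> bicommuting T1"
    using psd_inverse_exists[OF _ _ T1low] e(1) by auto
  obtain K where K: "psd K" "K o\<^sub>L K = Y" "K \<in> bicommuting Y"
    using psd_sqrt_exists[OF Y(1)] by blast
  have KT: "K \<in> bicommuting T" using K(3) Y(3) T1 bicommuting_trans by blast
  have KTc: "K (T x) = T (K x)" for x by (rule bicommuting_commute'[OF KT])
  have KSc: "K (S x) = S (K x)" for x
  proof -
    have "K o\<^sub>L S = S o\<^sub>L K"
      by (rule bicommuting_commute[OF KT], rule blinfun_eqI) (simp add: TS)
    then show ?thesis by (metis blinfun_apply_blinfun_compose)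
  qed
  have KK: "K (K x) = Y x" for x using K(2) by (metis blinfun_apply_blinfun_compose)
  define U where "U = X o\<^sub>L (K o\<^sub>L S)"
  have UU: "U\<dagger> o\<^sub>L U = S"
  proof (rule blinfun_eqI)
    fix x
    have "(U\<dagger> o\<^sub>L U) x = S (K (T (K (S x))))"
      by (simp add: U_def T_def s psdD(1)[OF K(1)])
    also have "\<dots> = T (S (Y x))" by (simp add: KTc KSc TS s flip: KK)
    also have "\<dots> = T1 (Y (S x))" by (simp add: T1S KSc flip: KK)
    also have "\<dots> = S x" using Y(2)
        by (metis blinfun_apply_blinfun_compose id_blinfun.rep_eq id_apply)
    finally show "(U\<dagger> o\<^sub>L U) x = S x" .
  qed
  moreover have "U \<in> M" unfolding U_def
    using X(1) M_bicommuting[OF T(2)] S(2) KT by blast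
  moreover have "F o\<^sub>L U = U" by (rule blinfun_eqI) (simp add: U_def XE)
  moreover have "S o\<^sub>L E = S" by (rule blinfun_eqI) (simp add: SE)
  ultimately show ?thesis using S by auto
qed

text \<open>An infinite projection contains infinitely many orthogonal copies of a nonzero one: the
  defect \<open>F0 = F - V V\<dagger>\<close> is nonzero by infiniteness, and the powers of
  \<open>V\<close> move it to orthogonal places inside \<open>F\<close>.\<close>

lemma shifted_copies:
  assumes F: "orth_proj F" "F \<in> M" "F \<noteq> 0"
  obtains F0 T where "orth_proj F0" "F0 \<in> M" "F0 \<noteq> 0" "\<And>k::nat. T k \<in> M" "\<And>k. F o\<^sub>L T k = T k"
    "\<And>k l. (T k)\<dagger> o\<^sub>L T l = (if k = l then F0 else 0)"
proof -
  obtain V where V: "V \<in> M" "V\<dagger> o\<^sub>L V = F" "F o\<^sub>L (V o\<^sub>L V\<dagger>) = V o\<^sub>L V\<dagger>" "V o\<^sub>L V\<dagger> \<noteq> F"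
    using infinite_proj[OF F] by blast
  define Q where "Q = V o\<^sub>L V\<dagger>"
  have VF: "V o\<^sub>L F = V" using partial_isometry_initial[OF V(2) F(1)] by blast
  have QV: "Q o\<^sub>L V = V" by (simp add: Q_def blinfun_compose_assoc V(2) VF)
  have Q: "orth_proj Q"
    unfolding orth_proj_def by (simp add: Q_def blinfun_compose_assoc[symmetric] QV[unfolded Q_def])
  define F0 where "F0 = F - Q"
  have F0: "orth_proj F0" "F0 \<in> M" "F0 \<noteq> 0"
    unfolding F0_def using orth_proj_diff(1)[OF F(1) Q] V F by (auto simp: Q_def)
  have FV: "F (V x) = V x" for x
    using QV V(3) unfolding Q_def by (metis blinfun_apply_blinfun_compose)
  have QV': "Q (V x) = V x" for x using QV by (metis blinfun_apply_blinfun_compose)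
  have FF0: "F (F0 x) = F0 x" for x
    using V(3) F(1) by (simp add: F0_def blinfun_apply_simps orth_projD Q_def)
      (metis blinfun_apply_blinfun_compose)
  have F0V: "F0 o\<^sub>L V = 0"
    by (rule blinfun_eqI) (simp add: F0_def blinfun_apply_simps FV QV')
  have FV': "F o\<^sub>L V = V" and FF0': "F o\<^sub>L F0 = F0" by (auto intro: blinfun_eqI simp: FV FF0)
  define T where "T k = ((o\<^sub>L) V ^^ k) F0" for k
  have TM: "T k \<in> M" for k by (induction k) (auto simp: T_def F0 V)
  show ?thesis
    by (rule that[OF F0 TM orthogonal_iterates[OF V(2) FV' F0(1) FF0' F0V, folded T_def]])
qed

text \<open>Take a maximal orthogonal family of nonzero projections that embed into
  \<open>F\<close>. Its sum must be 1, since otherwise \<open>partial_isometry_exists\<close> finds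
  another such projection in the complement; \<open>\<sigma>\<close>-finiteness makes it a
  sequence.\<close>

lemma exhausting_copies:
  assumes F: "orth_proj F" "F \<in> M" "F \<noteq> 0"
  obtains E U where "orth_family E" "\<And>x. (\<lambda>k. E k x) sums x" "\<And>k::nat. U k \<in> M"
    "\<And>k. (U k)\<dagger> o\<^sub>L U k = E k" "\<And>k. F o\<^sub>L U k = U k"
proof -
  define \<P> where "\<P> = {P \<in> M. orth_proj P \<and> P \<noteq> 0 \<and> (\<exists>U\<in>M. U\<dagger> o\<^sub>L U = P \<and> F o\<^sub>L U = U)}"
  define \<C> where "\<C> = {\<A>. \<A> \<subseteq> \<P> \<and> (\<forall>P\<in>\<A>. \<forall>Q\<in>\<A>. P \<noteq> Q \<longrightarrow> P o\<^sub>L Q = 0)}"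
  have "\<exists>\<A>\<in>\<C>. \<forall>X\<in>\<C>. \<A> \<subseteq> X \<longrightarrow> X = \<A>"
  proof (rule subset_Zorn')
    fix C assume "subset.chain \<C> C"
    then have C: "C \<subseteq> \<C>" "\<And>X Y. X \<in> C \<Longrightarrow> Y \<in> C \<Longrightarrow> X \<subseteq> Y \<or> Y \<subseteq> X"
      by (auto simp: subset_chain_def)
    have "P o\<^sub>L Q = 0" if m: "X \<in> C" "P \<in> X" "Y \<in> C" "Q \<in> Y" "P \<noteq> Q" for P Q X Y
    proof -
      have "X \<subseteq> Y \<or> Y \<subseteq> X" by (rule C(2)[OF m(1,3)])
      then obtain Z where "Z \<in> C" "P \<in> Z" "Q \<in> Z" using m(1-4) by auto
      then show ?thesis using C(1) \<open>P \<noteq> Q\<close> unfolding \<C>_def by blast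
    qed
    then show "\<Union>C \<in> \<C>" using C(1) unfolding \<C>_def by blast
  qed
  then obtain \<A> where AC: "\<A> \<in> \<C>" and max: "\<And>X. X \<in> \<C> \<Longrightarrow> \<A> \<subseteq> X \<Longrightarrow> X = \<A>"
    by metis
  have A: "\<A> \<subseteq> \<P>" "\<And>P Q. P \<in> \<A> \<Longrightarrow> Q \<in> \<A> \<Longrightarrow> P \<noteq> Q \<Longrightarrow> P o\<^sub>L Q = 0"
    using AC by (simp_all add: \<C>_def)
  have "\<A> \<subseteq> {P \<in> M. orth_proj P \<and> P \<noteq> 0}" using A(1) unfolding \<P>_def by blast
  then have "countable \<A>" using sigma_finite A(2) by blast
  then obtain f :: "_ \<Rightarrow> nat" where f: "inj_on f \<A>" by (rule countableE)
  \<comment> \<open>Indices that number no member of the family receive the zero projection.\<close>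
  define E where "E k = (if k \<in> f ` \<A> then the_inv_into \<A> f k else 0)" for k
  have Ef: "E (f P) = P" if "P \<in> \<A>" for P
    using that f by (auto simp: E_def the_inv_into_f_f)
  have E: "E k = 0 \<or> (E k \<in> \<A> \<and> f (E k) = k)" for k
  proof (cases "k \<in> f ` \<A>")
    case True
    then show ?thesis using Ef by auto
  qed (simp add: E_def)
  have EU: "orth_proj (E k) \<and> E k \<in> M \<and> (\<exists>U\<in>M. U\<dagger> o\<^sub>L U = E k \<and> F o\<^sub>L U = U)" for k
  proof (cases "E k = 0")
    case True
    then show ?thesis by (auto intro!: bexI[of _ 0])
  next
    case False
    then have "E k \<in> \<P>" using E[of k] A(1) by auto
    then show ?thesis by (auto simp: \<P>_def)
  qed
  have "E i o\<^sub>L E j = 0" if "i \<noteq> j" for i j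
    using E[of i] E[of j] A(2)[of "E i" "E j"] that by (metis blinfun_compose_zero)
  then have oE: "orth_family E" using EU by (auto simp: orth_family_def)
  obtain G where G: "orth_proj G" "\<And>x. (\<lambda>k. E k x) sums G x" "\<And>k. G o\<^sub>L E k = E k" "\<And>k. E k o\<^sub>L G
      = E k"
    using orth_family_sum[OF oE] by metis
  have GM: "G \<in> M" using commuting_sums[of E N G] EU G(2) by blast
  have "G = id_blinfun"
  proof (rule ccontr)
    assume "G \<noteq> id_blinfun"
    then have "id_blinfun - G \<noteq> 0" by auto
    then obtain U where U: "U \<in> M" "orth_proj (U\<dagger> o\<^sub>L U)" "U\<dagger> o\<^sub>L U \<noteq> 0"
      "(U\<dagger> o\<^sub>L U) o\<^sub>L (id_blinfun - G) = U\<dagger> o\<^sub>L U" "F o\<^sub>L U = U"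
      using partial_isometry_exists[of "id_blinfun - G" F] orth_proj_compl[OF G(1)] GM F by auto
    define P where "P = U\<dagger> o\<^sub>L U"
    have PG: "P o\<^sub>L G = 0"
    proof (rule blinfun_eqI)
      show "(P o\<^sub>L G) x = blinfun_apply 0 x" for x
        using arg_cong[OF U(4), of "\<lambda>f. blinfun_apply f (G x)"] orth_projD(3)[OF G(1)]
        by (simp add: P_def blinfun_apply_simps)
    qed
    have "P o\<^sub>L E k = 0" for k
    proof -
      have "P o\<^sub>L E k = (P o\<^sub>L G) o\<^sub>L E k" by (simp add: blinfun_compose_assoc G(3))
      then show ?thesis by (simp add: PG)
    qed
    then have o: "P o\<^sub>L Q = 0" if "Q \<in> \<A>" for Q using Ef[OF that] by metis
    then have o': "Q o\<^sub>L P = 0" if "Q \<in> \<A>" for Q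
      using that A(1) U(2) hadj_product_zero orth_projD(1) unfolding \<P>_def P_def by blast
    have "P \<in> \<P>" using U unfolding \<P>_def P_def by blast
    then have "insert P \<A> \<in> \<C>" using A o o' unfolding \<C>_def by auto
    then have "P \<in> \<A>" using max by blast
    then have "P o\<^sub>L P = 0" using o by blast
    then show False using U(2,3) orth_projD(2) unfolding P_def by metis
  qed
  then have "(\<lambda>k. E k x) sums x" for x using G(2)[of x] by simp
  moreover obtain U where "\<And>k. U k \<in> M" "\<And>k. (U k)\<dagger> o\<^sub>L U k = E k" "\<And>k. F o\<^sub>L U k = U k"
    using EU by metis
  ultimately show ?thesis using that oE by blast
qed

text \<open>The space is a sum of pieces \<open>E k\<close>, each embeddable in the single small
  projection \<open>F0\<close>. Sending the \<open>k\<close>-th piece on into the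
  \<open>k\<close>-th orthogonal copy of \<open>F0\<close> makes the images orthogonal, so the
  embeddings add up to an isometry.\<close>

lemma isometry_into:
  assumes F: "orth_proj F" "F \<in> M" "F \<noteq> 0"
  shows "\<exists>W\<in>M. W\<dagger> o\<^sub>L W = id_blinfun \<and> F o\<^sub>L W = W"
proof -
  obtain F0 T where F0: "orth_proj F0" "F0 \<in> M" "F0 \<noteq> 0"
    and T: "\<And>k::nat. T k \<in> M" "\<And>k. F o\<^sub>L T k = T k"
    "\<And>k l. (T k)\<dagger> o\<^sub>L T l = (if k = l then F0 else 0)"
    using shifted_copies[OF F] by metis
  obtain E U where E: "orth_family E" "\<And>x. (\<lambda>k. E k x) sums x" and U: "\<And>k::nat. U k \<in> M"
    "\<And>k. (U k)\<dagger> o\<^sub>L U k = E k" "\<And>k. F0 o\<^sub>L U k = U k"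
    using exhausting_copies[OF F0] by metis
  define X where "X k = T k o\<^sub>L U k" for k
  note TT = orthogonal_partial_isometries[OF T(3) F0(1)]
  have EE: "orth_proj (E k)" for k using orth_familyD(1)[OF E(1)] .
  have XX: "(X k)\<dagger> o\<^sub>L X k = E k" for k
  proof -
    have "(X k)\<dagger> o\<^sub>L X k = (U k)\<dagger> o\<^sub>L (((T k)\<dagger> o\<^sub>L T k) o\<^sub>L U k)"
      by (simp add: X_def blinfun_compose_assoc)
    then show ?thesis by (simp add: T(3) U)
  qed
  note xn = partial_isometry_norm[OF XX EE]
  have 1: "(T k o\<^sub>L (T k)\<dagger>) o\<^sub>L X k = X k" for k
    using TT(2)[of k] by (metis X_def blinfun_compose_assoc)
  have 2: "X k o\<^sub>L E k = X k" for k using partial_isometry_initial(1)[OF XX EE] .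
  obtain W where W: "\<And>x. (\<lambda>i. X i x) sums blinfun_apply W x"
    "\<And>x. (\<lambda>i. (norm (X i x))\<^sup>2) sums (norm (blinfun_apply W x))\<^sup>2"
    using orthogonal_operator_series_half[OF TT(1) E(1) zero_le_one 1 2 xn(2)] by blast
  have "W \<in> M" by (rule commuting_sums[OF _ W(1)]) (auto simp: X_def T U)
  moreover have "W\<dagger> o\<^sub>L W = id_blinfun"
  proof (rule sa_eqI)
    fix x
    obtain Q where Q: "\<And>x. (\<lambda>i. E i x) sums blinfun_apply Q x"
      "\<And>x. (\<lambda>i. (norm (E i x))\<^sup>2) sums (norm (blinfun_apply Q x))\<^sup>2"
      using orth_family_sum[OF E(1)] by metis
    have "Q x = x" using Q(1)[of x] E(2)[of x] sums_unique2 by blast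
    then have "(norm (W x))\<^sup>2 = (norm x)\<^sup>2"
      using Q(2)[of x] W(2)[of x] by (simp add: xn(1) sums_unique2)
    then show "inner ((W\<dagger> o\<^sub>L W) x) x = inner (id_blinfun x) x"
      by (metis power2_norm_apply power2_norm_eq_inner id_blinfun.rep_eq id_apply)
  qed auto
  moreover have "F o\<^sub>L W = W"
  proof (rule blinfun_eqI)
    fix x
    have "(\<lambda>i. F (X i x)) sums F (W x)"
      by (rule bounded_linear.sums[OF blinfun.bounded_linear_right W(1)])
    moreover have "F (X i x) = X i x" for i
      using T(2)[of i] by (metis X_def blinfun_apply_blinfun_compose)
    ultimately show "(F o\<^sub>L W) x = W x" using W(1)[of x] sums_unique2 by simp
  qed
  ultimately show ?thesis by blast
qed

text \<open>Cantor-Bernstein, applied to the isometry into the range of \<open>F\<close> and the inclusion.\<close>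

lemma isometry_onto:
  assumes F: "orth_proj F" "F \<in> M" "F \<noteq> 0"
  shows "\<exists>U\<in>M. U\<dagger> o\<^sub>L U = id_blinfun \<and> U o\<^sub>L U\<dagger> = F"
proof -
  obtain W where W: "W \<in> M" "W\<dagger> o\<^sub>L W = id_blinfun" "F o\<^sub>L W = W"
    using isometry_into[OF F] by blast
  have WW: "W\<dagger> (W x) = x" for x using W(2)
      by (metis blinfun_apply_blinfun_compose id_blinfun.rep_eq id_apply)
  have FW: "F (W x) = W x" for x using W(3) by (metis blinfun_apply_blinfun_compose)
  define R where "R = id_blinfun - F"
  have R: "orth_proj R" "R \<in> M" unfolding R_def using orth_proj_compl F by auto
  have RW: "R (W x) = 0" for x by (simp add: R_def blinfun_apply_simps FW)
  have RW': "R o\<^sub>L W = 0" by (rule blinfun_eqI) (simp add: RW blinfun.zero_left)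
  define T where "T k = ((o\<^sub>L) W ^^ k) R" for k
  have T0: "T 0 = R" and TS: "T (Suc k) = W o\<^sub>L T k" for k by (simp_all add: T_def)
  have TM: "T k \<in> M" for k by (induction k) (auto simp: T0 TS R W)
  have T: "(T k)\<dagger> o\<^sub>L T l = (if k = l then R else 0)" for k l
    unfolding T_def by (rule orthogonal_iterates(2)[OF W(2) _ R(1) _ RW']) auto
  define P where "P k = T k o\<^sub>L (T k)\<dagger>" for k
  have "orth_family P" unfolding P_def using orthogonal_partial_isometries[OF T R(1)] by blast
  then obtain G where G: "orth_proj G" "\<And>x. (\<lambda>i. P i x) sums blinfun_apply G x"
    using orth_family_sum by metis
  have GM: "G \<in> M" using commuting_sums[of P N G] G(2) TM by (auto simp: P_def)
  have P0: "P 0 = R" using R by (simp add: P_def T0 orth_projD)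
  have PS: "P (Suc k) x = W (P k (W\<dagger> x))" for k x by (simp add: P_def TS)
  have GW: "G (W x) = W (G x)" for x
  proof -
    have "(\<lambda>k. W (P k x)) sums W (G x)"
      by (rule bounded_linear.sums[OF blinfun.bounded_linear_right G(2)])
    then have "(\<lambda>k. P (Suc k) (W x)) sums W (G x)" by (simp add: PS WW)
    then have "(\<lambda>k. P k (W x)) sums (W (G x) + P 0 (W x))" by (subst sums_Suc_iff[symmetric]) simp
    then show ?thesis using G(2)[of "W x"] sums_unique2 by (fastforce simp: P0 RW)
  qed
  have WGW: "W (G (W\<dagger> x)) = G x - R x" for x
  proof -
    have "(\<lambda>k. P (Suc k) x) sums (G x - P 0 x)" using G(2)[of x] by (subst sums_Suc_iff) simp
    moreover have "(\<lambda>k. P (Suc k) x) sums W (G (W\<dagger> x))"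
      unfolding PS by (rule bounded_linear.sums[OF blinfun.bounded_linear_right G(2)])
    ultimately show ?thesis using sums_unique2 by (simp add: P0)
  qed
  have GW': "G (W\<dagger> x) = W\<dagger> (G x)" for x
  proof -
    have "G o\<^sub>L W = W o\<^sub>L G" by (rule blinfun_eqI) (simp add: GW)
    then have "W\<dagger> o\<^sub>L G = G o\<^sub>L W\<dagger>" using orth_projD(1)[OF G(1)] by (metis hadj_compose)
    then show ?thesis by (metis blinfun_apply_blinfun_compose)
  qed
  \<comment> \<open>\<open>G\<close> is the sum of the copies \<open>W ^ k R\<close> of the
    complement \<open>R\<close> of \<open>F\<close>. Shifting by \<open>W\<close> on
    \<open>G\<close> and fixing the rest gives
    \<open>U U\<dagger> = (G - R) + (1 - G) = F\<close>.\<close>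
  define U where "U = (W o\<^sub>L G) + (id_blinfun - G)"
  have "U \<in> M" unfolding U_def using W GM by auto
  moreover have "U\<dagger> o\<^sub>L U = id_blinfun"
    by (rule blinfun_eqI)
      (simp add: U_def blinfun_apply_simps orth_projD[OF G(1)] GW GW' WW)
  moreover have "U o\<^sub>L U\<dagger> = F"
    by (rule blinfun_eqI)
      (simp add: U_def blinfun_apply_simps orth_projD[OF G(1)] GW WGW R_def flip: GW')
  ultimately show ?thesis by blast
qed

end

context type_III_commutant
begin

section \<open>Splitting projections along a positive operator\<close>

lemma proper_subprojection:
  assumes Q: "orth_proj Q" "Q \<in> M" "Q \<noteq> 0"
  obtains P where "orth_proj P" "P \<in> M" "P \<noteq> 0" "P \<noteq> Q" "Q o\<^sub>L P = P"
proof -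
  obtain V where V: "V \<in> M" "V\<dagger> o\<^sub>L V = Q" "Q o\<^sub>L (V o\<^sub>L V\<dagger>) = V o\<^sub>L V\<dagger>" "V o\<^sub>L V\<dagger> \<noteq> Q"
    using infinite_proj[OF Q] by blast
  define P where "P = V o\<^sub>L V\<dagger>"
  have VQ: "V o\<^sub>L Q = V" using partial_isometry_initial[OF V(2) Q(1)] by blast
  then have PV: "P o\<^sub>L V = V" by (simp add: P_def blinfun_compose_assoc V(2))
  then have "orth_proj P"
    unfolding orth_proj_def by (simp add: P_def blinfun_compose_assoc[symmetric])
  moreover have "P \<in> M" using V by (simp add: P_def)
  moreover have "P \<noteq> 0"
  proof
    assume "P = 0"
    then have "V = 0" using PV by (metis blinfun_compose_zero(1))
    then show False using V(2) Q(3) by simp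
  qed
  ultimately show ?thesis using that V by (simp add: P_def)
qed

text \<open>Either some spectral projection of \<open>A\<close> cuts \<open>Q\<close> properly, or
  \<open>A\<close> is a scalar on the range of \<open>Q\<close>, and then every subprojection of
  \<open>Q\<close> commutes with \<open>A\<close>.\<close>

lemma commuting_subprojection:
  assumes A: "psd A" "A \<in> M" and Q: "orth_proj Q" "Q \<in> M" "Q \<noteq> 0" "Q o\<^sub>L A = A o\<^sub>L Q"
  obtains P where "orth_proj P" "P \<in> M" "P \<noteq> 0" "P \<noteq> Q" "Q o\<^sub>L P = P" "P o\<^sub>L A = A o\<^sub>L P"
proof -
  obtain C where C: "\<And>t. spectral_cut A t (C t)"
    using spectral_cut_exists[OF psdD(1)[OF A(1)]] by metis
  note c = spectral_cutD[OF C]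
  have CM: "C t \<in> M" for t using c(2) M_bicommuting[OF A(2)] by blast
  have CQ: "C t o\<^sub>L Q = Q o\<^sub>L C t" for t by (rule bicommuting_commute[OF c(2) Q(4)])
  have CA: "C t o\<^sub>L A = A o\<^sub>L C t" for t by (rule bicommuting_commute[OF c(2) refl])
  show ?thesis
  proof (cases "\<exists>t. Q o\<^sub>L C t \<noteq> 0 \<and> Q o\<^sub>L C t \<noteq> Q")
    case True
    then obtain t where t: "Q o\<^sub>L C t \<noteq> 0" "Q o\<^sub>L C t \<noteq> Q" by blast
    have "orth_proj (Q o\<^sub>L C t)" using orth_proj_compose[OF Q(1) c(1)] CQ by simp
    moreover have "Q o\<^sub>L (Q o\<^sub>L C t) = Q o\<^sub>L C t"
      by (simp add: blinfun_compose_assoc[symmetric] orth_projD Q)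
    moreover have "(Q o\<^sub>L C t) o\<^sub>L A = A o\<^sub>L (Q o\<^sub>L C t)"
      by (metis CA Q(4) blinfun_compose_assoc)
    ultimately show ?thesis using that t Q CM by blast
  next
    case False
    have Qe: "Q (C t x) = C t (Q x)" for t x using CQ by (metis blinfun_apply_blinfun_compose)
    have dich: "C t x = x" if "Q o\<^sub>L C t = Q" "Q x = x" for t x
      using that Qe[of t x] by (metis blinfun_apply_blinfun_compose)
    have dich0: "C t x = 0" if "Q o\<^sub>L C t \<noteq> Q" "Q x = x" for t x
      using that Qe[of t x] False by (metis blinfun_apply_blinfun_compose blinfun.zero_left)
    obtain u where "Q u \<noteq> 0" using Q(3) by (metis blinfun_eqI blinfun.zero_left)
    then obtain v where v: "Q v = v" "v \<noteq> 0" using orth_projD(3)[OF Q(1)] by metis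
    \<comment> \<open>Each \<open>C t\<close> now contains \<open>Q\<close> or is orthogonal to it.
      The threshold \<open>l = Inf S\<close> between the two alternatives is the only spectral value
      of \<open>A\<close> on the range of \<open>Q\<close>.\<close>
    define S where "S = {t. Q o\<^sub>L C t = Q}"
    have S0: "0 \<le> t" if "t \<in> S" for t
    proof -
      have "C t v = v" using that v dich by (simp add: S_def)
      then have "inner (A v) v \<le> t * (norm v)\<^sup>2" by (rule c(3))
      then have "0 \<le> t * (norm v)\<^sup>2" using psdD(2)[OF A(1), of v] by linarith
      then show ?thesis using v(2) by (simp add: zero_le_mult_iff)
    qed
    have "C (norm A) v \<noteq> 0"
      using c(4)[of "norm A" v] v(2) inner_apply_le[of A v] by auto
    then have SA: "norm A \<in> S" using dich0 v(1) by (auto simp: S_def)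
    define l where "l = Inf S"
    have bdd: "bdd_below S" using S0 by (auto simp: bdd_below_def)
    have eig: "inner (A x) x = l * (norm x)\<^sup>2" if x: "Q x = x" for x
    proof (rule antisym)
      show "inner (A x) x \<le> l * (norm x)\<^sup>2"
      proof (rule field_le_epsilon)
        fix e :: real assume e: "0 < e"
        define d where "d = e / ((norm x)\<^sup>2 + 1)"
        have d: "0 < d" "d * (norm x)\<^sup>2 \<le> e"
          using e by (auto simp: d_def field_simps add_pos_nonneg add_nonneg_pos)
        obtain t where t: "t \<in> S" "t < l + d"
          using cInf_lessD[of S "l + d"] SA d(1) unfolding l_def by auto
        have "inner (A x) x \<le> t * (norm x)\<^sup>2"
          using c(3) dich t(1) x by (simp add: S_def)
        also have "\<dots> \<le> (l + d) * (norm x)\<^sup>2" using t(2) by (intro mult_right_mono) auto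
        finally show "inner (A x) x \<le> l * (norm x)\<^sup>2 + e" using d(2) by (simp add: distrib_right)
      qed
      show "l * (norm x)\<^sup>2 \<le> inner (A x) x"
      proof (rule field_le_epsilon)
        fix e :: real assume e: "0 < e"
        define d where "d = e / ((norm x)\<^sup>2 + 1)"
        have d: "0 < d" "d * (norm x)\<^sup>2 \<le> e"
          using e by (auto simp: d_def field_simps add_pos_nonneg add_nonneg_pos)
        have "l - d \<notin> S" using cInf_lower[OF _ bdd, of "l - d"] d(1) unfolding l_def by auto
        then have "(l - d) * (norm x)\<^sup>2 \<le> inner (A x) x"
          using c(5) dich0 x by (simp add: S_def)
        then show "l * (norm x)\<^sup>2 \<le> inner (A x) x + e" using d(2) by (simp add: left_diff_distrib)
      qed
    qed
    have QA: "Q (A x) = A (Q x)" for x using Q(4) by (metis blinfun_apply_blinfun_compose)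
    have AQ: "A o\<^sub>L Q = l *\<^sub>R Q"
    proof (rule sa_eqI)
      show "(A o\<^sub>L Q)\<dagger> = A o\<^sub>L Q" using Q(4) by (simp add: psdD(1)[OF A(1)] orth_projD(1)[OF Q(1)])
      show "(l *\<^sub>R Q)\<dagger> = l *\<^sub>R Q" by (simp add: orth_projD(1)[OF Q(1)])
      show "inner ((A o\<^sub>L Q) x) x = inner ((l *\<^sub>R Q) x) x" for x
      proof -
        have "inner (A (Q x)) x = inner (A (Q x)) (Q x)"
          by (metis QA orth_proj_inner[OF Q(1)] orth_projD(3)[OF Q(1)])
        then show ?thesis
          using eig[of "Q x"] by (simp add: orth_projD(3)[OF Q(1)]
              blinfun.scaleR_left orth_proj_inner_self[OF Q(1)])
      qed
    qed
    obtain P where P: "orth_proj P" "P \<in> M" "P \<noteq> 0" "P \<noteq> Q" "Q o\<^sub>L P = P"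
      using proper_subprojection[OF Q(1-3)] .
    have AP: "A o\<^sub>L P = l *\<^sub>R P"
    proof (rule blinfun_eqI)
      fix x
      have "P x = Q (P x)" using P(5) by (metis blinfun_apply_blinfun_compose)
      then have "A (P x) = (A o\<^sub>L Q) (P x)" by simp
      also have "\<dots> = l *\<^sub>R P x" unfolding AQ using \<open>P x = Q (P x)\<close>
          by (simp add: blinfun.scaleR_left)
      finally show "(A o\<^sub>L P) x = (l *\<^sub>R P) x" by (simp add: blinfun.scaleR_left)
    qed
    have "P o\<^sub>L A = A o\<^sub>L P"
      by (metis AP hadj_compose hadj_scaleR orth_projD(1)[OF P(1)] psdD(1)[OF A(1)])
    then show ?thesis using that P by blast
  qed
qed

text \<open>For positive \<open>A\<close> this says that cutting \<open>A\<close> down to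
  \<open>E\<close> does not lower its norm, so that pieces near the top of the spectrum are still
  available inside \<open>E\<close>.\<close>

definition heavy :: "('a \<Rightarrow>\<^sub>L 'a) \<Rightarrow> ('a \<Rightarrow>\<^sub>L 'a) \<Rightarrow> bool" where
  "heavy A E \<longleftrightarrow> orth_proj E \<and> E \<in> M \<and> E o\<^sub>L A = A o\<^sub>L E \<and>
     (\<forall>c. 0 \<le> c \<longrightarrow> c < norm A \<longrightarrow> (\<exists>x. E x = x \<and> c * (norm x)\<^sup>2 < inner (A x) x))"

lemma form_split:
  assumes "orth_proj P" "P o\<^sub>L A = A o\<^sub>L P"
  shows "inner (A x) x = inner (A (P x)) (P x) + inner (A (x - P x)) (x - P x)"
proof -
  have c: "P (A y) = A (P y)" for y using assms(2) by (metis blinfun_apply_blinfun_compose)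
  have "inner (A (P x)) x = inner (A (P x)) (P x)" "inner (A x) (P x) = inner (A (P x)) (P x)"
    by (metis c orth_proj_inner[OF assms(1)] orth_projD(3)[OF assms(1)])+
  then show ?thesis by (simp add: blinfun_apply_simps inner_simps)
qed

text \<open>Let \<open>F\<close> be the part of \<open>E\<close> where \<open>A\<close> exceeds
  \<open>c\<close>, and split it into two nonzero commuting pieces \<open>P\<close> and
  \<open>R\<close>. The top of the spectrum survives in at least one of them, so the other one can
  be removed without losing heaviness.\<close>

lemma heavy_step:
  assumes A: "psd A" "A \<in> M" "A \<noteq> 0" and E: "heavy A E" and c: "0 \<le> c" "c < norm A"
  shows "\<exists>P. orth_proj P \<and> P \<in> M \<and> P \<noteq> 0 \<and> P o\<^sub>L A = A o\<^sub>L P \<and> E o\<^sub>L P = P \<and>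
           (\<forall>x. P x = x \<longrightarrow> c * (norm x)\<^sup>2 \<le> inner (A x) x) \<and> heavy A (E - P)"
proof -
  have e: "orth_proj E" "E \<in> M" "E o\<^sub>L A = A o\<^sub>L E"
    and eh: "\<And>c. 0 \<le> c \<Longrightarrow> c < norm A \<Longrightarrow> \<exists>x. E x = x \<and> c * (norm x)\<^sup>2 < inner (A x) x"
    using E by (auto simp: heavy_def)
  obtain C where C: "spectral_cut A c C" using spectral_cut_exists[OF psdD(1)[OF A(1)]] by blast
  note k = spectral_cutD[OF C]
  have CE: "C o\<^sub>L E = E o\<^sub>L C" by (rule bicommuting_commute[OF k(2) e(3)])
  have CA: "C o\<^sub>L A = A o\<^sub>L C" by (rule bicommuting_commute[OF k(2) refl])
  have CE': "C (E x) = E (C x)" for x using CE by (metis blinfun_apply_blinfun_compose)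
  have CA': "C (A x) = A (C x)" for x using CA by (metis blinfun_apply_blinfun_compose)
  have EA': "E (A x) = A (E x)" for x using e(3) by (metis blinfun_apply_blinfun_compose)
  define F where "F = E - (E o\<^sub>L C)"
  have Fx: "F x = E (x - C x)" for x by (simp add: F_def blinfun_apply_simps)
  have F: "orth_proj F" "F \<in> M" "F o\<^sub>L A = A o\<^sub>L F" "E o\<^sub>L F = F"
  proof -
    show "orth_proj F" unfolding F_def
    proof (rule orth_proj_diff(1)[OF e(1)])
      show "orth_proj (E o\<^sub>L C)" using orth_proj_compose[OF e(1) k(1)] CE by simp
      show "E o\<^sub>L (E o\<^sub>L C) = E o\<^sub>L C"
        by (simp add: blinfun_compose_assoc[symmetric] orth_projD(2)[OF e(1)])
    qed
    show "F \<in> M" unfolding F_def using e(2) k(2) M_bicommuting[OF A(2)] by blast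
    show "F o\<^sub>L A = A o\<^sub>L F"
      by (rule blinfun_eqI) (simp add: Fx CA' EA' blinfun.diff_right)
    show "E o\<^sub>L F = F" by (rule blinfun_eqI) (simp add: Fx orth_projD[OF e(1)])
  qed
  have CF: "C x = 0" if "F x = x" for x
  proof -
    have "C (F x) = 0" by (simp add: Fx CE' blinfun_apply_simps orth_projD[OF k(1)])
    then show ?thesis using that by simp
  qed
  have Fheavy: "\<exists>y. F y = y \<and> d * (norm y)\<^sup>2 < inner (A y) y" if d: "0 \<le> d" "d < norm A" for d
  proof -
    \<comment> \<open>Testing at \<open>max c d\<close> makes the component of \<open>x\<close> in
      the range of \<open>C\<close>, where \<open>A\<close> is at most \<open>c\<close>, fall short
      of its share, so the excess comes from \<open>y\<close>.\<close>
    obtain x where x: "E x = x" "max c d * (norm x)\<^sup>2 < inner (A x) x"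
      using eh[of "max c d"] c d by (metis max.coboundedI1 max_less_iff_conj)
    define y where "y = x - C x"
    have "F y = y" by (simp add: y_def Fx blinfun_apply_simps orth_projD[OF k(1)] x flip: CE')
    moreover have "d * (norm y)\<^sup>2 < inner (A y) y"
    proof -
      have "inner (A (C x)) (C x) \<le> max c d * (norm (C x))\<^sup>2"
        using k(3)[of "C x"] orth_projD(3)[OF k(1), of x]
        by (smt (verit) mult_right_mono zero_le_power2)
      moreover have "inner (A x) x = inner (A (C x)) (C x) + inner (A y) y"
        unfolding y_def by (rule form_split[OF k(1) CA])
      moreover have "max c d * (norm x)\<^sup>2 = max c d * (norm (C x))\<^sup>2 + max c d * (norm y)\<^sup>2"
        using orth_proj_pythagoras[OF k(1), of x] by (simp add: y_def distrib_left)
      moreover have "d * (norm y)\<^sup>2 \<le> max c d * (norm y)\<^sup>2" by (intro mult_right_mono) auto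
      ultimately show ?thesis using x(2) by linarith
    qed
    ultimately show ?thesis by blast
  qed
  have "F \<noteq> 0"
  proof
    assume "F = 0"
    then show False using Fheavy[of 0] A(3) by (auto simp: blinfun.zero_left blinfun.zero_right)
  qed
  then obtain P where P: "orth_proj P" "P \<in> M" "P \<noteq> 0" "P \<noteq> F" "F o\<^sub>L P = P" "P o\<^sub>L A = A o\<^sub>L P"
    using commuting_subprojection[OF A(1,2) F(1,2) _ F(3)] by blast
  have FP: "F (P x) = P x" "P (F x) = P x" for x
    using P(5) orth_proj_diff(2)[OF F(1) P(1,5)] by (metis blinfun_apply_blinfun_compose)+
  define R where "R = F - P"
  have R: "orth_proj R" "R \<in> M" "R \<noteq> 0" "F o\<^sub>L R = R" "R o\<^sub>L A = A o\<^sub>L R"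
  proof -
    show "orth_proj R" unfolding R_def by (rule orth_proj_diff(1)[OF F(1) P(1,5)])
    show "R \<in> M" "R \<noteq> 0" using F P by (auto simp: R_def)
    show "F o\<^sub>L R = R"
      by (rule blinfun_eqI) (simp add: R_def blinfun_apply_simps FP orth_projD[OF F(1)])
    show "R o\<^sub>L A = A o\<^sub>L R"
      by (simp add: R_def blinfun_compose_diff F(3) P(6))
  qed
  have ge: "c * (norm x)\<^sup>2 \<le> inner (A x) x" if "F o\<^sub>L S = S" "S x = x" for S x
  proof -
    have "F x = x" using that by (metis blinfun_apply_blinfun_compose)
    then show ?thesis using k(5) CF by blast
  qed
  have hv: "heavy A (E - S)"
    if S: "orth_proj S" "S \<in> M" "F o\<^sub>L S = S" "S o\<^sub>L A = A o\<^sub>L S"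
      and T: "\<And>d. 0 \<le> d \<Longrightarrow> d < norm A \<Longrightarrow> \<exists>y. S y = 0 \<and> F y = y \<and> d * (norm y)\<^sup>2 < inner (A y) y" for S
    unfolding heavy_def
  proof (intro conjI allI impI)
    have ES: "E o\<^sub>L S = S" using S(3) F(4) by (metis blinfun_compose_assoc)
    show "orth_proj (E - S)" by (rule orth_proj_diff(1)[OF e(1) S(1) ES])
    show "E - S \<in> M" using e S by auto
    show "(E - S) o\<^sub>L A = A o\<^sub>L (E - S)"
      by (simp add: blinfun_compose_diff e(3) S(4))
    fix d assume "0 \<le> d" "d < norm A"
    then obtain y where y: "S y = 0" "F y = y" "d * (norm y)\<^sup>2 < inner (A y) y" using T by blast
    then have "E y = y" using F(4) by (metis blinfun_apply_blinfun_compose)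
    then show "\<exists>x. (E - S) x = x \<and> d * (norm x)\<^sup>2 < inner (A x) x"
      using y by (intro exI[of _ y]) (simp add: blinfun_apply_simps)
  qed
  have EP: "E o\<^sub>L P = P" "E o\<^sub>L R = R" using F(4) P(5) R(4) by (metis blinfun_compose_assoc)+
  have PR: "P (R x) = 0" "R (P x) = 0" for x
    by (simp_all add: R_def blinfun_apply_simps FP orth_projD[OF P(1)])
  show ?thesis
  proof (cases "\<forall>d. 0 \<le> d \<longrightarrow> d < norm A \<longrightarrow> (\<exists>y. P y = 0 \<and> F y = y \<and> d * (norm y)\<^sup>2 < inner (A y) y)")
    case True
    then have "heavy A (E - P)" using hv[OF P(1,2,5,6)] by blast
    then show ?thesis using P ge EP by blast
  next
    case False
    then obtain d0 where d0: "0 \<le> d0" "d0 < norm A"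
      "\<And>y. P y = 0 \<Longrightarrow> F y = y \<Longrightarrow> inner (A y) y \<le> d0 * (norm y)\<^sup>2" by (auto simp: not_less)
    \<comment> \<open>On the range of \<open>R\<close> the form of \<open>A\<close> is at most
      \<open>d0\<close>, which is less than \<open>norm A\<close>. A vector testing above
      \<open>max d0 d\<close> therefore has its excess in the range of \<open>P\<close>.\<close>
    have "heavy A (E - R)"
    proof (rule hv[OF R(1,2,4,5)])
      fix d assume d: "0 \<le> d" "d < norm A"
      obtain x where x: "F x = x" "max d0 d * (norm x)\<^sup>2 < inner (A x) x"
        using Fheavy[of "max d0 d"] d d0(1,2) by (metis max.coboundedI1 max_less_iff_conj)
      define y where "y = x - P x"
      have y: "P y = 0" "F y = y"
          by (simp_all add: y_def blinfun_apply_simps FP x orth_projD[OF P(1)])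
      have "inner (A y) y \<le> max d0 d * (norm y)\<^sup>2"
        using d0(3)[OF y] by (smt (verit) mult_right_mono zero_le_power2)
      moreover have "inner (A x) x = inner (A (P x)) (P x) + inner (A y) y"
        unfolding y_def by (rule form_split[OF P(1,6)])
      moreover have "max d0 d * (norm x)\<^sup>2 = max d0 d * (norm (P x))\<^sup>2 + max d0 d * (norm y)\<^sup>2"
        using orth_proj_pythagoras[OF P(1), of x] by (simp add: y_def distrib_left)
      moreover have "d * (norm (P x))\<^sup>2 \<le> max d0 d * (norm (P x))\<^sup>2" by (intro mult_right_mono) auto
      ultimately have "d * (norm (P x))\<^sup>2 < inner (A (P x)) (P x)" using x(2) by linarith
      then show "\<exists>y. R y = 0 \<and> F y = y \<and> d * (norm y)\<^sup>2 < inner (A y) y"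
        using PR FP by blast
    qed
    then show ?thesis using R ge EP by blast
  qed
qed

text \<open>Removes one piece after the other while the rest stays heavy. The levels may vary with
  \<open>n\<close>, so that they can approach \<open>norm A\<close> when \<open>A\<close> and
  \<open>B\<close> have equal norms.\<close>

lemma heavy_sequence:
  assumes A: "psd A" "A \<in> M" "A \<noteq> 0" and c: "\<And>n::nat. 0 \<le> c n" "\<And>n. c n < norm A"
  obtains Q where "orth_family Q" "\<And>n. Q n \<in> M" "\<And>n. Q n \<noteq> 0" "\<And>n. Q n o\<^sub>L A = A o\<^sub>L Q n"
    "\<And>n x. Q n x = x \<Longrightarrow> c n * (norm x)\<^sup>2 \<le> inner (A x) x"
proof -
  obtain p where p: "\<And>E n. heavy A E \<Longrightarrow> orth_proj (p E n) \<and> p E n \<in> M \<and> p E n \<noteq> 0 \<and>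
      p E n o\<^sub>L A = A o\<^sub>L p E n \<and> E o\<^sub>L p E n = p E n \<and>
      (\<forall>x. p E n x = x \<longrightarrow> c n * (norm x)\<^sup>2 \<le> inner (A x) x) \<and> heavy A (E - p E n)"
    using heavy_step[OF A _ c] by metis
  define E where "E = rec_nat id_blinfun (\<lambda>n E. E - p E n)"
  define Q where "Q n = p (E n) n" for n
  have E0: "E 0 = id_blinfun" and ES: "E (Suc n) = E n - Q n" for n
    by (simp_all add: E_def Q_def)
  have h: "heavy A (E n)" for n
  proof (induction n)
    case 0
    show ?case using psd_norm_gt[OF A(1)] by (simp add: E0 heavy_def)
  next
    case (Suc n)
    then show ?case using p[of "E n" n] by (simp add: ES Q_def)
  qed
  have q: "orth_proj (Q n)" "Q n \<in> M" "Q n \<noteq> 0" "Q n o\<^sub>L A = A o\<^sub>L Q n" "E n o\<^sub>L Q n = Q n"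
    "Q n x = x \<Longrightarrow> c n * (norm x)\<^sup>2 \<le> inner (A x) x" for n x
    using p[OF h, of n n] unfolding Q_def by blast+
  have eo: "orth_proj (E n)" for n using h unfolding heavy_def by blast
  have EE: "E n o\<^sub>L E (n + k) = E (n + k)" for n k
  proof (induction k)
    case 0
    then show ?case using orth_projD(2)[OF eo] by simp
  next
    case (Suc k)
    have "E n o\<^sub>L Q (n + k) = Q (n + k)"
      by (metis Suc q(5) blinfun_compose_assoc)
    then show ?case using Suc by (simp add: ES blinfun_compose_diff)
  qed
  have lt: "Q m o\<^sub>L Q n = 0" if "m < n" for m n
  proof -
    obtain k where n: "n = Suc m + k" using less_imp_Suc_add[OF \<open>m < n\<close>] by auto
    have "Q m o\<^sub>L E (Suc m) = 0"
    proof (rule blinfun_eqI)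
      have "Q m o\<^sub>L E m = Q m" by (rule orth_proj_diff(2)[OF eo q(1,5)])
      then show "(Q m o\<^sub>L E (Suc m)) x = blinfun_apply 0 x" for x
        using orth_projD(3)[OF q(1), of m x]
        by (simp add: ES blinfun_apply_simps) (metis blinfun_apply_blinfun_compose)
    qed
    moreover have "Q n = E (Suc m) o\<^sub>L Q n"
      by (metis EE n q(5) blinfun_compose_assoc)
    ultimately show ?thesis by (metis blinfun_compose_assoc blinfun_compose_zero(1))
  qed
  have "orth_family Q" by (rule orth_familyI_less[OF q(1) lt])
  then show ?thesis using that q by blast
qed

text \<open>The complement of the sum is added to the single member \<open>m\<close>. The choice of
  \<open>m\<close> is left open because the corresponding piece of \<open>B\<close> must be able to
  absorb the additional part of \<open>A\<close>.\<close>

lemma complete_orth_family: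
  assumes Q: "orth_family Q" "\<And>n::nat. Q n \<in> M" "\<And>n. Q n o\<^sub>L A = A o\<^sub>L Q n"
  obtains P where "orth_family P" "\<And>n. P n \<in> M" "\<And>n. P n o\<^sub>L A = A o\<^sub>L P n"
    "\<And>x. (\<lambda>n. P n x) sums x" "\<And>n. P n o\<^sub>L Q n = Q n"
    "\<And>n. n \<noteq> m \<Longrightarrow> P n = Q n"
proof -
  note q = orth_familyD[OF Q(1)]
  obtain G where G: "orth_proj G" "\<And>x. (\<lambda>i. Q i x) sums blinfun_apply G x"
    "\<And>i. G o\<^sub>L Q i = Q i" "\<And>i. Q i o\<^sub>L G = Q i"
    using orth_family_sum[OF Q(1)] by metis
  define H where "H = id_blinfun - G"
  have GM: "G \<in> M" by (rule commuting_sums[OF Q(2) G(2)])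
  have "G \<in> commuting {A}" by (rule commuting_sums[OF _ G(2)]) (simp add: commuting_def Q(3))
  then have HA: "H \<in> commuting {A}" unfolding H_def by auto
  have HQ: "H (Q i x) = 0" "Q i (H x) = 0" for i x
    using G(3)[of i] G(4)[of i] by (simp_all add: H_def blinfun_apply_simps)
        (metis blinfun_apply_blinfun_compose)+
  define P where "P n = (if n = m then Q m + H else Q n)" for n
  have Px: "P n x = Q n x + (if n = m then H x else 0)" for n x
    by (simp add: P_def blinfun.add_left)
  have Ho: "orth_proj H" unfolding H_def by (rule orth_proj_compl[OF G(1)])
  have "orth_family P"
    unfolding orth_family_def
  proof (intro conjI allI impI)
    have "Q m o\<^sub>L H = 0" by (rule blinfun_eqI) (simp add: HQ blinfun.zero_left)
    then show "orth_proj (P n)" for n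
      using q(1) orth_proj_add[OF q(1) Ho] by (auto simp: P_def)
    show "P i o\<^sub>L P j = 0" if "i \<noteq> j" for i j
      by (rule blinfun_eqI) (use q(3) HQ that in \<open>auto simp: Px blinfun_apply_simps\<close>)
  qed
  moreover have "P n \<in> M" for n using Q(2) GM by (auto simp: P_def H_def)
  moreover have "P n o\<^sub>L A = A o\<^sub>L P n" for n
    using Q(3) HA by (auto simp: P_def commuting_def blinfun_compose_add)
  moreover have "(\<lambda>n. P n x) sums x" for x
  proof -
    have "(\<lambda>n. Q n x + (if n = m then H x else 0)) sums (G x + H x)"
      using sums_add[OF G(2)[of x] sums_single[of m "\<lambda>_. H x"]] by simp
    then show ?thesis by (simp add: Px H_def blinfun_apply_simps)
  qed
  moreover have "P n o\<^sub>L Q n = Q n" for n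
    by (rule blinfun_eqI) (simp add: Px HQ orth_projD(3)[OF q(1)])
  moreover have "P n = Q n" if "n \<noteq> m" for n using that by (simp add: P_def)
  ultimately show ?thesis using that by blast
qed

end

section \<open>The case of strictly larger norm\<close>

section \<open>Decomposing an operator of larger norm\<close>

text \<open>Cauchy-Schwarz in the plane for \<open>(sqrt (b / c), sqrt r)\<close> and
  \<open>(sqrt c * q, h)\<close>. The inequality \<open>b / c + r \<le> 1\<close> is the budget:
  \<open>b / c\<close> for a copy of \<open>B\<close> inside the reserve, \<open>r\<close> for the
  absorbed share.\<close>

lemma weighted_square_sum:
  fixes a b c r q h :: real
  assumes "0 \<le> b" "0 < c" "0 \<le> r" "b / c + r \<le> 1"
  shows "(sqrt b * q + sqrt r * h)\<^sup>2 \<le> c * q\<^sup>2 + h\<^sup>2"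
proof -
  define u where "u = sqrt (b / c)"
  define v where "v = sqrt r"
  define p where "p = sqrt c * q"
  have e: "sqrt b * q = u * p"
    using assms by (simp add: u_def p_def real_sqrt_divide)
  have 1: "u\<^sup>2 + v\<^sup>2 \<le> 1" using assms by (simp add: u_def v_def)
  have "(u * p + v * h)\<^sup>2 \<le> (u\<^sup>2 + v\<^sup>2) * (p\<^sup>2 + h\<^sup>2)"
  proof -
    have "(u\<^sup>2 + v\<^sup>2) * (p\<^sup>2 + h\<^sup>2) - (u * p + v * h)\<^sup>2 = (u * h - v * p)\<^sup>2"
      by (simp add: power2_eq_square algebra_simps)
    then show ?thesis by (metis diff_ge_0_iff_ge zero_le_power2)
  qed
  also have "\<dots> \<le> 1 * (p\<^sup>2 + h\<^sup>2)" by (intro mult_right_mono 1) simp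
  finally show ?thesis using assms(2) unfolding e by (simp add: p_def v_def power_mult_distrib)
qed

context type_III_commutant
begin

text \<open>With \<open>H\<close> the root of \<open>D\<close> and isometries \<open>V\<close> into
  \<open>R\<close> and \<open>W\<close> into \<open>Q\<close>, take
  \<open>X = W S + sqrt r H V\<dagger>\<close>. The ranges of \<open>W\<close> and \<open>H\<close>
  are orthogonal since \<open>D Q = 0\<close>, so
  \<open>X\<dagger> X = S\<^sup>2 + r V D V\<dagger>\<close>, and \<open>S\<close> is chosen to make
  this \<open>B\<close>. Off \<open>Q\<close> only the second summand contributes to
  \<open>X X\<dagger>\<close>, which gives \<open>r D\<close>; the mixed terms are controlled by
  \<open>weighted_square_sum\<close>.\<close>

lemma absorbing_operator:
  assumes B: "psd B" "B \<in> M" and R: "orth_proj R" "R \<in> M" "R \<noteq> 0" "R o\<^sub>L B = B o\<^sub>L R"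
    and Re: "\<And>x. R x = x \<Longrightarrow> e * (norm x)\<^sup>2 \<le> inner (B x) x"
    and D: "psd D" "D \<in> M" "\<And>x. inner (D x) x \<le> K * (norm x)\<^sup>2"
    and Q: "orth_proj Q" "Q \<in> M" "Q \<noteq> 0" "D o\<^sub>L Q = 0"
    and r: "0 \<le> r" "r * K \<le> e" "0 < c" "norm B / c + r \<le> 1"
  shows "\<exists>X\<in>M. (\<forall>x. (norm (blinfun_apply X x))\<^sup>2 = inner (B x) x) \<and>
      (\<forall>x. (norm (X\<dagger> x))\<^sup>2 \<le> c * (norm (Q x))\<^sup>2 + inner (D x) x) \<and>
      (\<forall>x. Q x = 0 \<longrightarrow> (norm (X\<dagger> x))\<^sup>2 = r * inner (D x) x)"
proof -
  obtain V where V: "V \<in> M" "V\<dagger> o\<^sub>L V = id_blinfun" "R o\<^sub>L V = V"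
    using isometry_into[OF R(1-3)] by blast
  obtain W where W: "W \<in> M" "W\<dagger> o\<^sub>L W = id_blinfun" "Q o\<^sub>L W = W"
    using isometry_into[OF Q(1-3)] by blast
  note nV = partial_isometry_norm[OF V(2) orth_proj_id] and nW = partial_isometry_norm[OF W(2)
      orth_proj_id]
  have VR: "V\<dagger> x = V\<dagger> (R x)" for x
  proof -
    have "V\<dagger> o\<^sub>L R = V\<dagger>" using arg_cong[OF V(3), of hadj] by (simp add: orth_projD(1)[OF R(1)])
    then show ?thesis by (metis blinfun_apply_blinfun_compose)
  qed
  have WQ: "W\<dagger> x = W\<dagger> (Q x)" for x
  proof -
    have "W\<dagger> o\<^sub>L Q = W\<dagger>" using arg_cong[OF W(3), of hadj] by (simp add: orth_projD(1)[OF Q(1)])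
    then show ?thesis by (metis blinfun_apply_blinfun_compose)
  qed
  have contr: "norm (U\<dagger> x) \<le> norm x" if "norm U \<le> 1" for U :: "'a \<Rightarrow>\<^sub>L 'a" and x
    using norm_blinfun[of "U\<dagger>" x] mult_right_mono[OF that, of "norm x"] by simp
  obtain H where H: "psd H" "H o\<^sub>L H = D" "H \<in> M"
    using psd_sqrt_exists[OF D(1)] M_bicommuting[OF D(2)] by blast
  have Hn: "(norm (H x))\<^sup>2 = inner (D x) x" for x
    using power2_norm_apply[of H x] H(2) psdD(1)[OF H(1)] by simp
  have QH: "Q (H x) = 0" for x
  proof -
    have "D (Q y) = 0" for y using Q(4) by (metis blinfun_apply_blinfun_compose blinfun.zero_left)
    then have "H (Q y) = 0" for y using Hn[of "Q y"] by simp
    then have "H o\<^sub>L Q = 0" by (auto intro: blinfun_eqI simp: blinfun.zero_left)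
    then have "Q o\<^sub>L H = 0" using psdD(1)[OF H(1)] orth_projD(1)[OF Q(1)]
        by (metis hadj_product_zero)
    then show ?thesis by (metis blinfun_apply_blinfun_compose blinfun.zero_left)
  qed
  \<comment> \<open>The part of \<open>B\<close> left for \<open>S\<close>. It is positive because
    \<open>r V D V\<dagger> \<le> r K R \<le> e R\<close>, and \<open>B\<close> dominates
    \<open>e\<close> on the range of \<open>R\<close>.\<close>
  define B' where "B' = B - r *\<^sub>R (V o\<^sub>L (D o\<^sub>L V\<dagger>))"
  have B'in: "inner (B' x) x = inner (B x) x - r * inner (D (V\<dagger> x)) (V\<dagger> x)" for x
    by (simp add: B'_def blinfun_apply_simps inner_simps inner_hadj)
  have "psd B'"
    unfolding psd_def
  proof (intro conjI allI)
    show "B'\<dagger> = B'"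
      by (simp add: B'_def psdD(1)[OF B(1)] psdD(1)[OF D(1)] blinfun_compose_assoc)
    fix x
    have "r * inner (D (V\<dagger> x)) (V\<dagger> x) \<le> r * (K * (norm (V\<dagger> x))\<^sup>2)"
      using D(3) r(1) by (intro mult_left_mono)
    also have "\<dots> \<le> e * (norm (V\<dagger> x))\<^sup>2"
      using r(2) by (simp add: mult_right_mono flip: mult.assoc)
    also have "\<dots> \<le> e * (norm (R x))\<^sup>2"
    proof (cases "R x = 0")
      case True
      then show ?thesis using VR[of x] by (simp add: blinfun.zero_right)
    next
      case False
      have "0 \<le> K"
        using D(3)[of "R x"] psdD(2)[OF D(1), of "R x"] False
        by (smt (verit) mult_neg_pos zero_less_norm_iff zero_less_power)
      then have "0 \<le> e" using r by (smt (verit) mult_nonneg_nonneg)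
      then show ?thesis
        using contr[OF nV(2), of "R x"] VR[of x] by (intro mult_left_mono power_mono) auto
    qed
    also have "\<dots> \<le> inner (B (R x)) (R x)" using Re[of "R x"] orth_projD(3)[OF R(1)] by blast
    also have "\<dots> \<le> inner (B x) x"
      using form_split[OF R(1,4), of x] psdD(2)[OF B(1), of "x - R x"] by simp
    finally show "0 \<le> inner (B' x) x" by (simp add: B'in)
  qed
  moreover have "B' \<in> M" using B V D by (simp add: B'_def)
  ultimately obtain S where S: "psd S" "S o\<^sub>L S = B'" "S \<in> M"
    using psd_sqrt_exists M_bicommuting by blast
  have Sn: "(norm (S x))\<^sup>2 = inner (B' x) x" for x
    using power2_norm_apply[of S x] S(2) psdD(1)[OF S(1)] by simp
  define X where "X = (W o\<^sub>L S) + sqrt r *\<^sub>R (H o\<^sub>L V\<dagger>)"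
  have "X \<in> M" using W V S H by (simp add: X_def)
  moreover have "(norm (X x))\<^sup>2 = inner (B x) x" for x
  proof -
    have o: "inner (W y) (H z) = 0" for y z
    proof -
      have "Q (W y) = W y" using W(3) by (metis blinfun_apply_blinfun_compose)
      then show ?thesis using orth_proj_inner[OF Q(1), of "W y" "H z"] QH by simp
    qed
    have "(norm (X x))\<^sup>2 = (norm (W (S x)))\<^sup>2 + (norm (sqrt r *\<^sub>R H (V\<dagger> x)))\<^sup>2"
      unfolding X_def blinfun.add_left blinfun.scaleR_left blinfun_apply_blinfun_compose
      by (rule norm_add_Pythagorean) (simp add: orthogonal_def o)
    also have "\<dots> = inner (B' x) x + r * inner (D (V\<dagger> x)) (V\<dagger> x)"
      using r(1) by (simp add: nW(1) Sn Hn power_mult_distrib)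
    finally show ?thesis by (simp add: B'in)
  qed
  moreover have Xa: "X\<dagger> x = S (W\<dagger> x) + sqrt r *\<^sub>R V (H x)" for x
    by (simp add: X_def blinfun_apply_simps psdD(1)[OF S(1)] psdD(1)[OF H(1)])
  moreover have "(norm (X\<dagger> x))\<^sup>2 \<le> c * (norm (Q x))\<^sup>2 + inner (D x) x" for x
  proof -
    have "(norm (S (W\<dagger> x)))\<^sup>2 \<le> inner (B (W\<dagger> x)) (W\<dagger> x)"
      using r(1) psdD(2)[OF D(1)] by (simp add: Sn B'in)
    also have "\<dots> \<le> norm B * (norm (W\<dagger> x))\<^sup>2" by (rule inner_apply_le)
    also have "\<dots> \<le> norm B * (norm (Q x))\<^sup>2"
      using contr[OF nW(2), of "Q x"] WQ[of x] by (intro mult_left_mono power_mono) auto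
    finally have "norm (S (W\<dagger> x)) \<le> sqrt (norm B) * norm (Q x)"
      using real_le_rsqrt by (fastforce simp: real_sqrt_mult)
    moreover have "norm (sqrt r *\<^sub>R V (H x)) = sqrt r * norm (H x)"
      using r(1) by (simp add: nV(1))
    ultimately have "norm (X\<dagger> x) \<le> sqrt (norm B) * norm (Q x) + sqrt r * norm (H x)"
      unfolding Xa by (metis add_mono norm_triangle_le order_refl)
    then have "(norm (X\<dagger> x))\<^sup>2 \<le> (sqrt (norm B) * norm (Q x) + sqrt r * norm (H x))\<^sup>2"
      by (rule power_mono) simp
    also have "\<dots> \<le> c * (norm (Q x))\<^sup>2 + (norm (H x))\<^sup>2"
      by (rule weighted_square_sum) (use r in auto)
    finally show ?thesis by (simp add: Hn)
  qed
  moreover have "(norm (X\<dagger> x))\<^sup>2 = r * inner (D x) x" if "Q x = 0" for x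
  proof -
    have "W\<dagger> x = 0" using WQ[of x] that by (simp add: blinfun.zero_right)
    then show ?thesis using r(1)
      by (simp add: Xa blinfun.zero_right nV(1) Hn power_mult_distrib)
  qed
  ultimately show ?thesis by blast
qed

text \<open>
  The operators \<open>X j\<close> realise \<open>A = \<Sum>j. X j (X j)\<dagger>\<close> with \<open>(X j)\<dagger> X j = B\<close>. The vector in the third
  clause is kept outside the kernel of \<open>A\<close> so that the clause survives orthogonal direct sums.
\<close>

definition decomposes :: "('a \<Rightarrow>\<^sub>L 'a) \<Rightarrow> ('a \<Rightarrow>\<^sub>L 'a) \<Rightarrow> (nat \<Rightarrow> ('a \<Rightarrow>\<^sub>L 'a)) \<Rightarrow> bool" where
  "decomposes A B X \<longleftrightarrow> (\<forall>j. X j \<in> M) \<and>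
     (\<forall>j x. (norm (blinfun_apply (X j) x))\<^sup>2 = inner (B x) x) \<and>
     (B \<noteq> 0 \<longrightarrow> (\<forall>j. \<exists>x. (X j)\<dagger> x = 0 \<and> A x \<noteq> 0)) \<and>
     (\<forall>x. (\<lambda>j. (norm ((X j)\<dagger> x))\<^sup>2) sums inner (A x) x)"

text \<open>
  The operator \<open>X n\<close> maps into the range of \<open>Q n\<close> except for a small part, which absorbs a
  fixed proportion of what the previous steps left over, so that nothing remains in the limit.
\<close>

lemma decomposes_larger_norm:
  assumes A: "psd A" "A \<in> M" and B: "psd B" "B \<in> M" "B \<noteq> 0" and lt: "norm B < norm A"
  shows "\<exists>X. decomposes A B X"
proof -
  define b where "b = norm B"
  define a where "a = norm A"
  \<comment> \<open>Below \<open>a\<close>, so that reserves with \<open>A \<ge> c\<close> exist;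
    above \<open>b\<close>, so that \<open>1 - b / c\<close> is positive.\<close>
  define c where "c = (a + b) / 2"
  have b: "0 < b" "b < c" "c < a" "0 < a" "0 < c"
  proof -
    have "0 < b" "b < a" using B(3) lt by (auto simp: a_def b_def)
    then show "0 < b" "b < c" "c < a" "0 < a" "0 < c" by (auto simp: c_def)
  qed
  have A0: "A \<noteq> 0" using b by (auto simp: a_def)
  obtain Q where Q: "orth_family Q" "\<And>n::nat. Q n \<in> M" "\<And>n. Q n \<noteq> 0" "\<And>n. Q n o\<^sub>L A = A o\<^sub>L Q n"
    "\<And>n x. Q n x = x \<Longrightarrow> c * (norm x)\<^sup>2 \<le> inner (A x) x"
    by (rule heavy_sequence[OF A A0, of "\<lambda>_. c"]) (use b a_def in \<open>auto intro: that\<close>)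
  note q = orth_familyD[OF Q(1)]
  obtain G where G: "orth_proj G" "\<And>x. (\<lambda>i. Q i x) sums blinfun_apply G x"
    "\<And>i. G o\<^sub>L Q i = Q i" "\<And>i. Q i o\<^sub>L G = Q i"
    using orth_family_sum[OF Q(1)] by metis
  have GM: "G \<in> M" by (rule commuting_sums[OF Q(2) G(2)])
  have "G \<in> commuting {A}" by (rule commuting_sums[OF _ G(2)]) (simp add: commuting_def Q(4))
  then have GA: "G o\<^sub>L A = A o\<^sub>L G" by (simp add: commuting_def)
  define Gn where "Gn n = G - (\<Sum>k<n. Q k)" for n
  have Gn0: "Gn 0 = G" and GnS: "Gn (Suc n) = Gn n - Q n" for n
    by (simp_all add: Gn_def algebra_simps)
  have Gnx: "Gn n x = G x - (\<Sum>k<n. Q k x)" for n x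
    by (simp add: Gn_def blinfun_apply_simps)
  have QG: "Q k (G x) = Q k x" "G (Q k x) = Q k x" for k x
    using G(3,4) by (metis blinfun_apply_blinfun_compose)+
  have QGn: "Gn n (Q k x) = (if k < n then 0 else Q k x)" for n k x
  proof -
    have "(\<Sum>i<n. Q i (Q k x)) = (\<Sum>i<n. if i = k then Q k x else 0)"
      by (intro sum.cong) (auto simp: q(3) orth_projD(3)[OF q(1)])
    then show ?thesis by (simp add: Gnx QG)
  qed
  have QGn': "Q k (Gn n x) = (if k < n then 0 else Q k x)" for n k x
    using orth_family_sum_apply[OF Q(1), of k x "{..<n}"] by (simp add: Gnx blinfun.diff_right QG)
  \<comment> \<open>Less than \<open>b\<close>, so that the spectral part \<open>R\<close> of
    \<open>B\<close> above \<open>e\<close> is nonzero; positive, so that the absorbed share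
    \<open>r\<close> can be positive.\<close>
  define e where "e = b / 2"
  have e: "0 < e" "e < b" using b by (auto simp: e_def)
  obtain C where C: "spectral_cut B e C" using spectral_cut_exists[OF psdD(1)[OF B(1)]] by blast
  note k = spectral_cutD[OF C]
  define R where "R = id_blinfun - C"
  have R: "orth_proj R" "R \<in> M" "R \<noteq> 0" "R o\<^sub>L B = B o\<^sub>L R"
  proof -
    show "orth_proj R" unfolding R_def by (rule orth_proj_compl[OF k(1)])
    show "R \<in> M" unfolding R_def using k(2) M_bicommuting[OF B(2)] by auto
    show "R \<noteq> 0"
    proof
      assume "R = 0"
      then have "C = id_blinfun" by (simp add: R_def)
      then have "norm B \<le> e" using k(3) e by (intro psd_norm_le[OF B(1)]) auto
      then show False using e by (simp add: b_def)
    qed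
    show "R o\<^sub>L B = B o\<^sub>L R"
      using bicommuting_commute[OF k(2) refl] by (simp add: R_def blinfun_compose_diff)
  qed
  have Re: "e * (norm x)\<^sup>2 \<le> inner (B x) x" if "R x = x" for x
    using that k(5) by (simp add: R_def blinfun_apply_simps)
  \<comment> \<open>The two bounds are the two requirements of \<open>absorbing_operator\<close>:
    \<open>r * a \<le> e\<close>, as every remainder is at most \<open>a\<close>, and
    \<open>b / c + r \<le> 1\<close>.\<close>
  define r where "r = min (e / a) (1 - b / c)"
  have r: "0 < r" "r < 1" "r * a \<le> e" "norm B / c + r \<le> 1"
    using e b by (auto simp: r_def min_def field_simps b_def)
  have Aa: "inner (A x) x \<le> a * (norm x)\<^sup>2" for x unfolding a_def by (rule inner_apply_le)
  \<comment> \<open>\<open>Gn n\<close> projects onto the reserves not yet spent. Remainder and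
    unspent reserve together stay below \<open>A\<close>; hence \<open>D\<close> is bounded by
    \<open>a\<close> uniformly in \<open>n\<close> and vanishes on all reserves to come.\<close>
  define inv where "inv n D \<longleftrightarrow> psd D \<and> D \<in> M \<and>
      (\<forall>x. inner (blinfun_apply D x) x + inner (A (Gn n x)) (Gn n x) \<le> inner (A x) x)" for n D
  have inv_le: "inner (D x) x \<le> a * (norm x)\<^sup>2" if "inv n D" for n D x
    using that Aa[of x] psdD(2)[OF A(1), of "Gn n x"] unfolding inv_def by (smt (verit))
  have inv_Q: "D (Q k x) = 0" if "inv n D" "n \<le> k" for n D k x
  proof -
    have "inner (D (Q k x)) (Q k x) \<le> 0" using that(1)[unfolded inv_def] that(2) QGn[of n k x]
      by (smt (verit) not_less)
    then show ?thesis using that(1) unfolding inv_def by (meson antisym psdD(2) psd_apply_eq_0)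
  qed
  have step: "\<exists>X\<in>M. (\<forall>x. (norm (blinfun_apply X x))\<^sup>2 = inner (B x) x) \<and>
      (\<forall>x. Q n x = 0 \<longrightarrow> (norm (X\<dagger> x))\<^sup>2 = r * inner (D x) x) \<and>
      inv (Suc n) (((A o\<^sub>L Q n) + D) - (X o\<^sub>L X\<dagger>))" if D: "inv n D" for n D
  proof -
    have d: "psd D" "D \<in> M" using D by (auto simp: inv_def)
    have "D o\<^sub>L Q n = 0" by (rule blinfun_eqI) (simp add: inv_Q[OF D] blinfun.zero_left)
    then obtain X where X: "X \<in> M" "\<And>x. (norm (blinfun_apply X x))\<^sup>2 = inner (B x) x"
      "\<And>x. (norm (X\<dagger> x))\<^sup>2 \<le> c * (norm (Q n x))\<^sup>2 + inner (D x) x"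
      "\<And>x. Q n x = 0 \<Longrightarrow> (norm (X\<dagger> x))\<^sup>2 = r * inner (D x) x"
      using absorbing_operator[OF B(1,2) R Re d inv_le[OF D] q(1) Q(2,3) _ less_imp_le[OF r(1)]
          r(3) b(5) r(4)]
      by metis
    have QA: "Q n (A x) = A (Q n x)" for x using Q(4) by (metis blinfun_apply_blinfun_compose)
    have AQ: "inner (A (Q n x)) x = inner (A (Q n x)) (Q n x)" for x
      by (metis QA orth_proj_inner[OF q(1)] orth_projD(3)[OF q(1)])
    let ?D = "((A o\<^sub>L Q n) + D) - (X o\<^sub>L X\<dagger>)"
    have Din: "inner (?D x) x = inner (A (Q n x)) (Q n x) + inner (D x) x - (norm (X\<dagger> x))\<^sup>2" for x
      by (simp add: blinfun_apply_simps inner_simps AQ inner_hadj[of X] power2_norm_eq_inner)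
    have "psd ?D"
      unfolding psd_def
    proof (intro conjI allI)
      show "?D\<dagger> = ?D"
        by (simp add: psdD(1)[OF d(1)] psdD(1)[OF A(1)] orth_projD(1)[OF q(1)] Q(4))
      show "0 \<le> inner (?D x) x" for x
        using X(3)[of x] Q(5)[of n "Q n x"] orth_projD(3)[OF q(1), of n x] by (simp add: Din)
    qed
    moreover have "?D \<in> M" using A d Q(2) X(1) by simp
    moreover have "inner (?D x) x + inner (A (Gn (Suc n) x)) (Gn (Suc n) x) \<le> inner (A x) x" for x
    proof -
      have "inner (A (Gn n x)) (Gn n x) = inner (A (Q n (Gn n x))) (Q n (Gn n x))
          + inner (A (Gn n x - Q n (Gn n x))) (Gn n x - Q n (Gn n x))"
        by (rule form_split[OF q(1) Q(4)])
      then have "inner (A (Gn n x)) (Gn n x) = inner (A (Q n x)) (Q n x)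
          + inner (A (Gn (Suc n) x)) (Gn (Suc n) x)"
        by (simp add: QGn' GnS blinfun.diff_left)
      moreover have "inner (D x) x + inner (A (Gn n x)) (Gn n x) \<le> inner (A x) x"
        using D by (simp add: inv_def)
      moreover have "0 \<le> (norm (X\<dagger> x))\<^sup>2" by simp
      ultimately show ?thesis unfolding Din by linarith
    qed
    ultimately have "inv (Suc n) ?D" by (simp add: inv_def)
    then show ?thesis using X by blast
  qed
  then obtain f where f: "\<And>n D. inv n D \<Longrightarrow> f n D \<in> M \<and>
      (\<forall>x. (norm (blinfun_apply (f n D) x))\<^sup>2 = inner (B x) x) \<and>
      (\<forall>x. Q n x = 0 \<longrightarrow> (norm ((f n D)\<dagger> x))\<^sup>2 = r * inner (D x) x) \<and>
      inv (Suc n) (((A o\<^sub>L Q n) + D) - (f n D o\<^sub>L (f n D)\<dagger>))" by metis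
  \<comment> \<open>The remainder starts with the part of \<open>A\<close> outside all reserves;
    \<open>A Q n\<close> enters it only at step \<open>n\<close>.\<close>
  define D where "D = rec_nat (A - (A o\<^sub>L G)) (\<lambda>n D. ((A o\<^sub>L Q n) + D) - (f n D o\<^sub>L (f n D)\<dagger>))"
  define X where "X n = f n (D n)" for n
  have D0: "D 0 = A - (A o\<^sub>L G)" and DS: "D (Suc n) = ((A o\<^sub>L Q n) + D n) - (X n o\<^sub>L (X n)\<dagger>)" for n
    by (simp_all add: D_def X_def)
  have AG: "inner (A x) x = inner (A (G x)) (G x) + inner (D 0 x) x" for x
  proof -
    have "inner (A (G x)) x = inner (A (G x)) (G x)"
      by (metis GA blinfun_apply_blinfun_compose orth_proj_inner[OF G(1)] orth_projD(3)[OF G(1)])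
    then show ?thesis by (simp add: D0 blinfun_apply_simps inner_simps)
  qed
  have iD: "inv n (D n)" for n
  proof (induction n)
    case 0
    have "0 \<le> inner (D 0 x) x" for x
      using AG[of x] form_split[OF G(1) GA, of x] psdD(2)[OF A(1), of "x - G x"] by simp
    moreover have "(D 0)\<dagger> = D 0"
      by (simp add: D0 psdD(1)[OF A(1)] orth_projD(1)[OF G(1)] GA)
    ultimately have "psd (D 0)" by (simp add: psd_def)
    moreover have "D 0 \<in> M" using A GM by (simp add: D0)
    moreover have "inner (D 0 x) x + inner (A (G x)) (G x) \<le> inner (A x) x" for x
      using AG[of x] by linarith
    ultimately show ?case by (simp add: inv_def Gn0)
  next
    case (Suc n)
    then show ?case using f[of n "D n"] by (simp add: DS X_def)
  qed
  have X: "X n \<in> M" "(norm (X n x))\<^sup>2 = inner (B x) x"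
    "Q n x = 0 \<Longrightarrow> (norm ((X n)\<dagger> x))\<^sup>2 = r * inner (D n x) x" for n x
    using f[OF iD, of n] by (simp_all add: X_def)
  have Dp: "psd (D n)" for n using iD[of n] by (simp add: inv_def)
  have DSin: "inner (D (Suc n) x) x = inner (A (Q n x)) x + inner (D n x) x - (norm ((X n)\<dagger> x))\<^sup>2"
      for n x
    by (simp add: DS blinfun_apply_simps inner_simps inner_hadj[of "X n"] power2_norm_eq_inner)
  have partial: "(\<Sum>k<n. (norm ((X k)\<dagger> x))\<^sup>2) = (\<Sum>k<n. inner (A (Q k x)) x) + inner (D 0 x)
      x - inner (D n x) x" for n x
    by (induction n) (simp_all add: DSin)
  have D_lim: "(\<lambda>n. inner (D n x) x) \<longlonglongrightarrow> 0" for x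
  proof (rule LIMSEQ_I)
    fix d :: real assume d: "0 < d"
    have "(\<lambda>m. Gn m x) \<longlonglongrightarrow> G x - G x"
      unfolding Gnx using G(2)[of x] by (intro tendsto_intros) (simp add: sums_def)
    then have "(\<lambda>m. 2 * (a * (norm (Gn m x))\<^sup>2)) \<longlonglongrightarrow> 2 * (a * (norm (G x - G x))\<^sup>2)"
      by (intro tendsto_intros)
    then have "(\<lambda>m. 2 * (a * (norm (Gn m x))\<^sup>2)) \<longlonglongrightarrow> 0" by simp
    then obtain m where m: "2 * (a * (norm (Gn m x))\<^sup>2) < d / 2"
      using eventually_happens'[OF sequentially_bot order_tendstoD(2)] d half_gt_zero by blast
    \<comment> \<open>\<open>y\<close> meets no reserve from \<open>m\<close> on, so the remainder
      decays on it by the factor \<open>1 - r\<close> at each step. The tail \<open>z\<close> is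
      small and every remainder is at most \<open>a\<close> there. The factors 2 come from
      \<open>D (y + z) \<le> 2 D y + 2 D z\<close> for forms.\<close>
    define z where "z = Gn m x"
    define y where "y = x - z"
    have Qy: "Q k y = 0" if "m \<le> k" for k
      using that by (simp add: y_def z_def blinfun.diff_right QGn')
    have geo: "inner (D (m + j) y) y = (1 - r) ^ j * inner (D m y) y" for j
    proof (induction j)
      case (Suc j)
      then show ?case using Qy[of "m + j"] X(3)[of "m + j" y]
        by (simp add: DSin blinfun.zero_right algebra_simps)
    qed simp
    have "(\<lambda>j. 2 * ((1 - r) ^ j * inner (D m y) y)) \<longlonglongrightarrow> 2 * (0 * inner (D m y) y)"
      using r by (intro tendsto_intros LIMSEQ_realpow_zero) auto
    then have "(\<lambda>j. 2 * ((1 - r) ^ j * inner (D m y) y)) \<longlonglongrightarrow> 0" by simp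
    then have "\<forall>\<^sub>F j in sequentially. 2 * ((1 - r) ^ j * inner (D m y) y) < d / 2"
      by (rule order_tendstoD(2)) (use d in simp)
    then obtain J where J: "\<And>j. j \<ge> J \<Longrightarrow> 2 * ((1 - r) ^ j * inner (D m y) y) < d / 2"
      unfolding eventually_sequentially by blast
    have "norm (inner (D n x) x - 0) < d" if n: "n \<ge> m + J" for n
    proof -
      have "inner (D n x) x \<le> 2 * inner (D n y) y + 2 * inner (D n z) z"
        using psdD(2)[OF Dp, of n "y - z"] unfolding y_def
        by (simp add: blinfun_apply_simps inner_simps)
      moreover have "2 * inner (D n y) y < d / 2"
        using J[of "n - m"] geo[of "n - m"] n by simp
      moreover have "inner (D n z) z \<le> a * (norm z)\<^sup>2" by (rule inv_le[OF iD])
      ultimately have "inner (D n x) x < d" using m by (simp add: z_def)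
      then show ?thesis using psdD(2)[OF Dp, of n x] by simp
    qed
    then show "\<exists>no. \<forall>n\<ge>no. norm (inner (D n x) x - 0) < d" by blast
  qed
  have sums: "(\<lambda>j. (norm ((X j)\<dagger> x))\<^sup>2) sums inner (A x) x" for x
  proof -
    have "(\<lambda>k. inner (A (Q k x)) x) sums inner (A (G x)) x"
      by (intro bounded_linear.sums[OF bounded_linear_inner_left]
          bounded_linear.sums[OF blinfun.bounded_linear_right] G(2))
    then have "(\<lambda>n. (\<Sum>k<n. inner (A (Q k x)) x) + inner (D 0 x) x - inner (D n x) x)
        \<longlonglongrightarrow> inner (A (G x)) x + inner (D 0 x) x - 0"
      unfolding sums_def by (intro tendsto_intros D_lim)
    moreover have "inner (A (G x)) x + inner (D 0 x) x = inner (A x) x"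
      by (simp add: D0 blinfun_apply_simps inner_simps)
    ultimately show ?thesis by (simp add: sums_def partial)
  qed
  \<comment> \<open>Step \<open>j\<close> does not touch the next reserve: on the range of
    \<open>Q (Suc j)\<close> both \<open>Q j\<close> and \<open>D j\<close> vanish, hence so does
    \<open>(X j)\<dagger>\<close>, while \<open>A \<ge> c > 0\<close> there.\<close>
  have "\<exists>x. (X j)\<dagger> x = 0 \<and> A x \<noteq> 0" for j
  proof -
    obtain u where u: "Q (Suc j) u \<noteq> 0"
      using Q(3)[of "Suc j"] by (metis blinfun_eqI blinfun.zero_left)
    define x where "x = Q (Suc j) u"
    have "Q j x = 0" using q(3)[of j "Suc j" u] by (simp add: x_def)
    moreover have "D j x = 0" unfolding x_def by (rule inv_Q[OF iD]) simp
    ultimately have "(X j)\<dagger> x = 0" using X(3)[of j x] by simp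
    moreover have "A x \<noteq> 0"
    proof
      assume "A x = 0"
      then have "c * (norm x)\<^sup>2 \<le> 0" using Q(5)[of "Suc j" x] orth_projD(3)[OF q(1)]
          by (simp add: x_def)
      then show False using b u by (simp add: x_def mult_le_0_iff)
    qed
    ultimately show ?thesis by blast
  qed
  then show ?thesis using X sums unfolding decomposes_def by blast
qed

end

section \<open>Direct sums of decompositions\<close>

lemma double_sums_le:
  fixes f :: "nat \<Rightarrow> nat \<Rightarrow> real"
  assumes "\<And>i j. 0 \<le> f i j" "\<And>i. f i sums F i" "F sums S" "\<And>j. (\<lambda>i. f i j) sums g j"
  shows "\<exists>T\<le>S. g sums T"
proof -
  have "(\<Sum>j<n. g j) \<le> S" for n
  proof -
    have 1: "(\<lambda>i. \<Sum>j<n. f i j) sums (\<Sum>j<n. g j)" by (rule sums_sum) (rule assms)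
    have 2: "(\<Sum>j<n. f i j) \<le> F i" for i
    proof -
      have "summable (f i)" "F i = suminf (f i)" using assms(2)[of i] by (auto simp: sums_iff)
      then show ?thesis using sum_le_suminf[of "f i" "{..<n}"] assms(1) by simp
    qed
    show ?thesis by (rule sums_le[OF 2 1 assms(3)])
  qed
  moreover have "0 \<le> g j" for j using assms(1) sums_le[OF _ sums_zero assms(4)] by blast
  ultimately have "summable g" by (intro summableI_nonneg_bounded)
  then show ?thesis
    using suminf_le_const \<open>\<And>n. (\<Sum>j<n. g j) \<le> S\<close> summable_sums by blast
qed

text \<open>Tonelli's theorem for nonnegative double series: the inequality of
  \<open>double_sums_le\<close> is applied in both orders of summation.\<close>

lemma double_sums_swap:
  fixes f :: "nat \<Rightarrow> nat \<Rightarrow> real"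
  assumes "\<And>i j. 0 \<le> f i j" "\<And>i. f i sums F i" "F sums S" "\<And>j. (\<lambda>i. f i j) sums g j"
  shows "g sums S"
proof -
  obtain T where T: "T \<le> S" "g sums T" using double_sums_le[OF assms] by blast
  obtain S' where "S' \<le> T" "F sums S'"
    using double_sums_le[of "\<lambda>j i. f i j" g T F] assms(1,2,4) T(2) by blast
  then show ?thesis using T assms(3) sums_unique2 by (metis antisym)
qed

text \<open>A nonzero vector in the range of \<open>E\<close> and the kernel of \<open>F\<close>
  would have its form at most \<open>l\<close> and strictly above \<open>m\<close>.\<close>

lemma spectral_cut_mono:
  assumes E: "spectral_cut T l E" and F: "spectral_cut T m F" and lm: "l \<le> m"
  shows "F o\<^sub>L E = E"
proof (rule blinfun_eqI)
  fix x
  note e = spectral_cutD[OF E] and f = spectral_cutD[OF F]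
  have "E o\<^sub>L F = F o\<^sub>L E"
    by (rule bicommuting_commute[OF e(2)]) (rule bicommuting_commute[OF f(2) refl])
  then have c: "E (F y) = F (E y)" for y by (metis blinfun_apply_blinfun_compose)
  define y where "y = E x - F (E x)"
  have "E y = y" by (simp add: y_def blinfun_apply_simps c orth_projD[OF e(1)])
  moreover have "F y = 0" by (simp add: y_def blinfun_apply_simps orth_projD[OF f(1)])
  moreover have "l * (norm y)\<^sup>2 \<le> m * (norm y)\<^sup>2" by (intro mult_right_mono lm) simp
  ultimately have "y = 0" using e(3)[of y] f(4)[of y] by linarith
  then show "(F o\<^sub>L E) x = E x" by (simp add: y_def)
qed

lemma psd_compose_proj:
  assumes "psd A" "orth_proj P" "P o\<^sub>L A = A o\<^sub>L P"
  shows "psd (A o\<^sub>L P)" "inner ((A o\<^sub>L P) x) x = inner (A (P x)) (P x)"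
proof -
  have c: "P (A y) = A (P y)" for y using assms(3) by (metis blinfun_apply_blinfun_compose)
  have *: "inner ((A o\<^sub>L P) x) x = inner (A (P x)) (P x)" for x
    by (simp, metis c orth_proj_inner[OF assms(2)] orth_projD(3)[OF assms(2)])
  then show "inner ((A o\<^sub>L P) x) x = inner (A (P x)) (P x)" .
  show "psd (A o\<^sub>L P)"
    unfolding psd_def * using psdD[OF assms(1)] assms(3) by (simp add: orth_projD(1)[OF assms(2)])
qed

text \<open>Expand the squared norm of \<open>T x - norm T *\<^sub>R x\<close> and use
  \<open>T\<^sup>2 \<le> \<parallel>T\<parallel> T\<close>. A vector at which the form attains its
  upper bound is thus an eigenvector.\<close>

lemma psd_top_eigenvector:
  assumes "psd T" "norm T * (norm x)\<^sup>2 \<le> inner (T x) x"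
  shows "T x = norm T *\<^sub>R x"
proof -
  have "(norm (T x - norm T *\<^sub>R x))\<^sup>2 = (norm (T x))\<^sup>2 - 2 * norm T * inner (T x)
      x + (norm T)\<^sup>2 * (norm x)\<^sup>2"
    unfolding power2_norm_eq_inner by (simp add: inner_simps inner_commute power2_eq_square)
  also have "(norm (T x))\<^sup>2 \<le> norm T * inner (T x) x" by (rule psd_norm_apply'[OF assms(1)])
  also have "norm T * inner (T x) x - 2 * norm T * inner (T x) x + (norm T)\<^sup>2 * (norm x)\<^sup>2
      = norm T * (norm T * (norm x)\<^sup>2 - inner (T x) x)"
    by (simp add: algebra_simps power2_eq_square)
  also have "\<dots> \<le> 0" using assms(2) by (intro mult_nonneg_nonpos) auto
  finally show ?thesis by simp
qed

context type_III_commutant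
begin

text \<open>The \<open>j\<close>-th operator of the sum collects the \<open>j\<close>-th operators
  \<open>X i j\<close> of all blocks; ranges below \<open>P i\<close> and supports below
  \<open>S i\<close> make the series over \<open>i\<close> converge. The sum over \<open>j\<close>
  is recovered by exchanging two sums of nonnegative terms.\<close>

lemma decomposes_direct_sum:
  assumes A: "psd A" "A \<in> M" and B: "psd B" "B \<in> M"
    and P: "orth_family P" "\<And>n. P n \<in> M" "\<And>n. P n o\<^sub>L A = A o\<^sub>L P n" "\<And>x. (\<lambda>n. P n x) sums x"
    and S: "orth_family S" "\<And>n. S n \<in> M" "\<And>n. S n o\<^sub>L B = B o\<^sub>L S n" "\<And>x. (\<lambda>n. S n x) sums x"
    and d: "\<And>n. \<exists>X. decomposes (A o\<^sub>L P n) (B o\<^sub>L S n) X"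
  shows "\<exists>X. decomposes A B X"
proof -
  note p = orth_familyD[OF P(1)] and s = orth_familyD[OF S(1)]
  obtain X where X: "\<And>n. decomposes (A o\<^sub>L P n) (B o\<^sub>L S n) (X n)" using d by metis
  have XM: "X i j \<in> M" for i j using X[of i] by (simp add: decomposes_def)
  have Xn: "(norm (X i j x))\<^sup>2 = inner (B (S i x)) (S i x)" for i j x
    using X[of i] psd_compose_proj(2)[OF B(1) s(1) S(3)] by (simp add: decomposes_def)
  have Xs: "(\<lambda>j. (norm ((X i j)\<dagger> x))\<^sup>2) sums inner (A (P i x)) (P i x)" for i x
    using X[of i] psd_compose_proj(2)[OF A(1) p(1) P(3)] unfolding decomposes_def by metis
  have XS: "X i j o\<^sub>L S i = X i j" for i j
  proof (rule blinfun_eqI)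
    fix x
    have "X i j (x - S i x) = 0"
      using Xn[of i j "x - S i x"] by (simp add: blinfun.diff_right orth_projD(3)[OF s(1)]
          blinfun.zero_right)
    then show "(X i j o\<^sub>L S i) x = X i j x" by (simp add: blinfun.diff_right)
  qed
  \<comment> \<open>The squares of \<open>(X i j)\<dagger>\<close> over all \<open>j\<close> add up
    to the form of \<open>A P i\<close>, which vanishes off \<open>P i\<close>, so each of them
    vanishes there.\<close>
  have XP': "(X i j)\<dagger> (P i x) = (X i j)\<dagger> x" for i j x
  proof -
    have "(\<lambda>j. (norm ((X i j)\<dagger> (x - P i x)))\<^sup>2) sums 0"
      using Xs[of i "x - P i x"] by (simp add: blinfun.diff_right orth_projD(3)[OF p(1)]
          blinfun.zero_right)
    then have "(norm ((X i j)\<dagger> (x - P i x)))\<^sup>2 = 0"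
      using suminf_eq_zero_iff[of "\<lambda>j. (norm ((X i j)\<dagger> (x - P i x)))\<^sup>2"] by (simp add: sums_iff)
    then show ?thesis by (simp add: blinfun.diff_right)
  qed
  have XP: "P i o\<^sub>L X i j = X i j" for i j
  proof -
    have "(X i j)\<dagger> o\<^sub>L P i = (X i j)\<dagger>" by (rule blinfun_eqI) (simp add: XP')
    then show ?thesis by (metis hadj_compose hadj_hadj orth_projD(1)[OF p(1)])
  qed
  have nX: "norm (X i j) \<le> sqrt (norm B)" for i j
  proof (rule norm_blinfun_bound)
    fix x
    have "(norm (X i j x))\<^sup>2 \<le> norm B * (norm (S i x))\<^sup>2" unfolding Xn by (rule inner_apply_le)
    also have "\<dots> \<le> norm B * (norm x)\<^sup>2"
      by (intro mult_left_mono power_mono orth_proj_norm_le s) auto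
    finally show "norm (X i j x) \<le> sqrt (norm B) * norm x"
      using real_le_rsqrt by (fastforce simp: real_sqrt_mult)
  qed simp
  have "\<exists>Y. (\<forall>x. (\<lambda>i. X i j x) sums blinfun_apply Y x) \<and>
      (\<forall>x. (\<lambda>i. (norm (X i j x))\<^sup>2) sums (norm (blinfun_apply Y x))\<^sup>2) \<and>
      (\<forall>x. (\<lambda>i. (X i j)\<dagger> x) sums Y\<dagger> x) \<and>
      (\<forall>x. (\<lambda>i. (norm ((X i j)\<dagger> x))\<^sup>2) sums (norm (Y\<dagger> x))\<^sup>2)" for j
    by (rule orthogonal_operator_series[OF P(1) S(1) real_sqrt_ge_zero[OF norm_ge_zero]
          XP[of _ j] XS[of _ j] nX[of _ j]]) blast
  then obtain Y where Y: "\<And>j x. (\<lambda>i. X i j x) sums blinfun_apply (Y j) x"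
    "\<And>j x. (\<lambda>i. (norm (X i j x))\<^sup>2) sums (norm (blinfun_apply (Y j) x))\<^sup>2"
    "\<And>j x. (\<lambda>i. (X i j)\<dagger> x) sums (Y j)\<dagger> x"
    "\<And>j x. (\<lambda>i. (norm ((X i j)\<dagger> x))\<^sup>2) sums (norm ((Y j)\<dagger> x))\<^sup>2"
    by metis
  have form: "(\<lambda>i. inner (T (R i x)) (R i x)) sums inner (T x) x"
    if T: "psd T" and R: "\<And>i. orth_proj (R i)" "\<And>i. R i o\<^sub>L T = T o\<^sub>L R i" "\<And>x. (\<lambda>n. R n x) sums x"
    for T :: "'a \<Rightarrow>\<^sub>L 'a" and R x
  proof -
    have "(\<lambda>i. inner (T (R i x)) x) sums inner (T x) x"
      by (intro bounded_linear.sums[OF bounded_linear_inner_left]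
          bounded_linear.sums[OF blinfun.bounded_linear_right] R(3))
    then show ?thesis using psd_compose_proj(2)[OF T R(1,2)] by simp
  qed
  have "Y j \<in> M" for j by (rule commuting_sums[OF XM Y(1)])
  moreover have "(norm (Y j x))\<^sup>2 = inner (B x) x" for j x
    using Y(2)[of j x] form[OF B(1) s(1) S(3,4), of x] sums_unique2 by (simp add: Xn)
  moreover have "\<exists>x. (Y j)\<dagger> x = 0 \<and> A x \<noteq> 0" if B0: "B \<noteq> 0" for j
  proof -
    have "\<exists>i. B o\<^sub>L S i \<noteq> 0"
    proof (rule ccontr)
      assume "\<not> ?thesis"
      then have "B (S i x) = 0" for i x by (metis blinfun_apply_blinfun_compose blinfun.zero_left)
      then have "(\<lambda>i. 0) sums B x" for x
        using bounded_linear.sums[OF blinfun.bounded_linear_right S(4), of B x] by simp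
      then have "B x = 0" for x using sums_unique2 sums_zero by metis
      then show False using B0 by (auto intro: blinfun_eqI simp: blinfun.zero_left)
    qed
    then obtain i where "B o\<^sub>L S i \<noteq> 0" by blast
    then obtain x where x: "(X i j)\<dagger> x = 0" "A (P i x) \<noteq> 0"
      using X[of i] unfolding decomposes_def by (metis blinfun_apply_blinfun_compose)
    \<comment> \<open>Cutting the kernel vector of block \<open>i\<close> down by \<open>P i\<close>
      makes all other blocks vanish on it. It stays nonzero because the block clause gives
      \<open>A (P i x) \<noteq> 0\<close>, not merely \<open>x \<noteq> 0\<close>.\<close>
    have "(X k j)\<dagger> (P i x) = 0" for k
    proof (cases "k = i")
      case True
      then show ?thesis using x XP' by simp
    next
      case False
      then show ?thesis using p(3)[of k i x] XP'[of k j "P i x"] by (simp add: blinfun.zero_right)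
    qed
    then have "(\<lambda>_. 0) sums (Y j)\<dagger> (P i x)" using Y(3)[of j "P i x"] by simp
    then have "(Y j)\<dagger> (P i x) = 0" by (rule sums_unique2) (rule sums_zero)
    then show ?thesis using x by blast
  qed
  moreover have "(\<lambda>j. (norm ((Y j)\<dagger> x))\<^sup>2) sums inner (A x) x" for x
    by (rule double_sums_swap[OF _ Xs form[OF A(1) p(1) P(3,4)] Y(4)]) simp
  ultimately show ?thesis unfolding decomposes_def by blast
qed

section \<open>The cases of equal norms\<close>

lemma decomposes_zero: "decomposes 0 0 (\<lambda>_. 0)"
  by (simp add: decomposes_def blinfun.zero_left)

text \<open>\<open>P\<close> splits into a sequence of nonzero projections \<open>E n\<close>. These
  and \<open>R\<close> are all range projections of isometries, so \<open>U n V\<dagger>\<close>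
  carries the range of \<open>R\<close> isometrically onto that of \<open>E n\<close>.\<close>

lemma decomposes_scaled_projections:
  assumes P: "orth_proj P" "P \<in> M" "P \<noteq> 0" and R: "orth_proj R" "R \<in> M" "R \<noteq> 0" and b: "0 < b"
  shows "\<exists>X. decomposes (b *\<^sub>R P) (b *\<^sub>R R) X"
proof -
  have nP: "1 / 2 < norm P"
  proof (rule ccontr)
    assume n: "\<not> ?thesis"
    obtain u where u: "P u \<noteq> 0" using P(3) by (metis blinfun_eqI blinfun.zero_left)
    have "norm (P (P u)) \<le> norm P * norm (P u)" by (rule norm_blinfun)
    also have "\<dots> \<le> 1 / 2 * norm (P u)" using n by (intro mult_right_mono) auto
    finally show False using u by (simp add: orth_projD(3)[OF P(1)])
  qed
  \<comment> \<open>The level 1/2 lies strictly between 0 and the norm of \<open>P\<close>.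
    Positivity of the form of \<open>P\<close> on the range of \<open>Q n\<close> forces that range
    into the range of \<open>P\<close>.\<close>
  obtain Q where Q: "orth_family Q" "\<And>n::nat. Q n \<in> M" "\<And>n. Q n \<noteq> 0" "\<And>n. Q n o\<^sub>L P = P o\<^sub>L Q n"
    "\<And>n x. Q n x = x \<Longrightarrow> 1 / 2 * (norm x)\<^sup>2 \<le> inner (P x) x"
    by (rule heavy_sequence[OF orth_proj_psd[OF P(1)] P(2,3), of "\<lambda>_. 1 / 2"])
      (use nP in \<open>auto intro: that\<close>)
  note q = orth_familyD[OF Q(1)]
  have QP: "Q n (P x) = P (Q n x)" for n x using Q(4) by (metis blinfun_apply_blinfun_compose)
  have PQ: "P (Q n x) = Q n x" for n x
  proof -
    define y where "y = Q n x - P (Q n x)"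
    have "Q n y = y" by (simp add: y_def blinfun.diff_right QP orth_projD(3)[OF q(1)])
    moreover have "P y = 0" by (simp add: y_def blinfun.diff_right orth_projD(3)[OF P(1)])
    ultimately have "y = 0" using Q(5)[of n y] by (simp add: mult_le_0_iff)
    then show ?thesis by (simp add: y_def)
  qed
  obtain F where F: "orth_family F" "\<And>n. F n \<in> M" "\<And>n. F n o\<^sub>L P = P o\<^sub>L F n"
    "\<And>x. (\<lambda>n. F n x) sums x" "\<And>n. F n o\<^sub>L Q n = Q n"
    by (rule complete_orth_family[OF Q(1,2,4), of 0], rule that)
  note f = orth_familyD[OF F(1)]
  define E where "E n = P o\<^sub>L F n" for n
  have PF: "F n (P x) = P (F n x)" for n x using F(3) by (metis blinfun_apply_blinfun_compose)
  have E: "orth_proj (E n)" "E n \<in> M" "E n \<noteq> 0" for n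
  proof -
    show "orth_proj (E n)" unfolding E_def using orth_proj_compose[OF P(1) f(1)] F(3) by simp
    show "E n \<in> M" using P F by (simp add: E_def)
    obtain u where u: "Q n u \<noteq> 0" using Q(3) by (metis blinfun_eqI blinfun.zero_left)
    have "E n (Q n u) = Q n u"
      using F(5)[of n] by (simp add: E_def) (metis PQ blinfun_apply_blinfun_compose)
    then show "E n \<noteq> 0" using u by (auto simp: blinfun.zero_left)
  qed
  obtain U where U: "\<And>n. U n \<in> M" "\<And>n. (U n)\<dagger> o\<^sub>L U n = id_blinfun" "\<And>n. U n o\<^sub>L (U n)\<dagger> = E n"
    using isometry_onto[OF E] by metis
  obtain V where V: "V \<in> M" "V\<dagger> o\<^sub>L V = id_blinfun" "V o\<^sub>L V\<dagger> = R"
    using isometry_onto[OF R] by blast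
  note nU = partial_isometry_norm(1)[OF U(2) orth_proj_id] and nV
      = partial_isometry_norm(1)[OF V(2) orth_proj_id]
  define X where "X n = sqrt b *\<^sub>R (U n o\<^sub>L V\<dagger>)" for n
  have Xn: "(norm (X n x))\<^sup>2 = inner ((b *\<^sub>R R) x) x" for n x
    using b power2_norm_apply[of "V\<dagger>" x]
    by (simp add: X_def blinfun.scaleR_left nU power_mult_distrib V(3))
  have Xa: "(norm ((X n)\<dagger> x))\<^sup>2 = b * inner (E n x) x" for n x
    using b power2_norm_apply[of "(U n)\<dagger>" x]
    by (simp add: X_def blinfun.scaleR_left nV power_mult_distrib U(3))
  have "X n \<in> M" for n using U V by (simp add: X_def)
  moreover have "\<exists>x. (X n)\<dagger> x = 0 \<and> (b *\<^sub>R P) x \<noteq> 0" for n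
  proof -
    obtain u where u: "E (Suc n) u \<noteq> 0" using E(3) by (metis blinfun_eqI blinfun.zero_left)
    define x where "x = E (Suc n) u"
    have "E n x = 0"
      using f(3)[of n "Suc n" "P u"] by (simp add: x_def E_def PF orth_projD(3)[OF P(1)]
          blinfun.zero_right flip: PF)
    then have "(X n)\<dagger> x = 0" using Xa[of n x] by simp
    moreover have "P x = x" by (simp add: x_def E_def orth_projD(3)[OF P(1)])
    ultimately show ?thesis using b u by (intro exI[of _ x]) (simp add: x_def blinfun.scaleR_left)
  qed
  moreover have "(\<lambda>n. (norm ((X n)\<dagger> x))\<^sup>2) sums inner ((b *\<^sub>R P) x) x" for x
  proof -
    have "(\<lambda>n. b * inner (P (F n x)) x) sums (b * inner (P x) x)"
      by (intro sums_mult bounded_linear.sums[OF bounded_linear_inner_left]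
          bounded_linear.sums[OF blinfun.bounded_linear_right] F(4))
    then show ?thesis by (simp add: Xa E_def blinfun.scaleR_left)
  qed
  ultimately show ?thesis using Xn unfolding decomposes_def by blast
qed

text \<open>\<open>S n\<close> is the layer of \<open>B\<close> between two consecutive levels
  \<open>t\<close>, so \<open>B S n\<close> has norm at most \<open>t n\<close>; it is matched with
  a piece of \<open>A\<close> that exceeds \<open>t (Suc n)\<close>. The layers exhaust the space
  because a vector outside all of them would be an eigenvector of \<open>B\<close> for
  \<open>norm B\<close>.\<close>

lemma decomposes_no_top_eigenvector:
  assumes A: "psd A" "A \<in> M" and B: "psd B" "B \<in> M" "B \<noteq> 0" and eq: "norm A = norm B"
    and top: "\<And>x. B x = norm B *\<^sub>R x \<Longrightarrow> x = 0"
  shows "\<exists>X. decomposes A B X"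
proof -
  define b where "b = norm B"
  have b: "0 < b" using B(3) by (simp add: b_def)
  have A0: "A \<noteq> 0" using b eq by (auto simp: b_def)
  define t where "t n = b * (1 - inverse (real (Suc n)))" for n
  have t0: "0 \<le> t n" for n
    using b inverse_le_1_iff[of "real (Suc n)"] by (simp add: t_def)
  have tb: "t n < b" for n using b by (simp add: t_def)
  have tS: "t n < t (Suc n)" for n using b by (simp add: t_def less_imp_inverse_less)
  have tlim: "t \<longlonglongrightarrow> b"
  proof -
    have "(\<lambda>n. b * (1 - inverse (real (Suc n)))) \<longlonglongrightarrow> b * (1 - 0)"
      by (intro tendsto_intros LIMSEQ_inverse_real_of_nat)
    then show ?thesis by (simp add: t_def[abs_def])
  qed
  have "\<forall>n. \<exists>E. spectral_cut B (t n) E"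
    using spectral_cut_exists[OF psdD(1)[OF B(1)]] by blast
  then obtain C where C: "\<And>n. spectral_cut B (t n) (C n)" by metis
  note c = spectral_cutD[OF C]
  have CM: "C n \<in> M" for n using c(2) M_bicommuting[OF B(2)] by blast
  have CB: "C n o\<^sub>L B = B o\<^sub>L C n" for n by (rule bicommuting_commute[OF c(2) refl])
  have tmono: "t m \<le> t n" if "m \<le> n" for m n
    using lift_Suc_mono_le[of t m n] tS that by (simp add: less_imp_le)
  have CC: "C n o\<^sub>L C m = C m" if "m \<le> n" for m n
    by (rule spectral_cut_mono[OF C C tmono[OF that]])
  have CC': "C m o\<^sub>L C n = C m" if "m \<le> n" for m n
    by (rule orth_proj_diff(2)[OF c(1) c(1) CC[OF that]])
  define S where "S n = (case n of 0 \<Rightarrow> C 0 | Suc m \<Rightarrow> C (Suc m) - C m)" for n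
  have CS: "C n o\<^sub>L S n = S n" for n
    by (cases n) (simp_all add: S_def orth_projD(2)[OF c(1)] blinfun_compose_diff CC)
  have Sp: "orth_proj (S n)" for n
    by (cases n) (simp_all add: S_def c(1) orth_proj_diff(1)[OF c(1) c(1) CC])
  have S0: "C m o\<^sub>L S n = 0" if "m < n" for m n
    using that by (cases n) (simp_all add: S_def blinfun_compose_diff CC')
  have SS: "S m o\<^sub>L S n = 0" if "m < n" for m n
    using that S0[of m n] S0[of "m - 1" n] by (cases m) (simp_all add: S_def[of m] S_def[of 0]
        S_def[of "Suc _"] blinfun_compose_diff)
  have S: "orth_family S" by (rule orth_familyI_less[OF Sp SS])
  have SM: "S n \<in> M" for n by (cases n) (simp_all add: S_def CM)
  have SB: "S n o\<^sub>L B = B o\<^sub>L S n" for n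
    by (cases n) (simp_all add: S_def CB blinfun_compose_diff)
  obtain G where G: "orth_proj G" "\<And>x. (\<lambda>i. S i x) sums blinfun_apply G x"
    "\<And>i. G o\<^sub>L S i = S i" "\<And>i. S i o\<^sub>L G = S i"
    using orth_family_sum[OF S] by metis
  have Gid: "G x = x" for x
  proof -
    define y where "y = x - G x"
    have Sy: "S n y = 0" for n
      using G(4)[of n] by (simp add: y_def blinfun.diff_right) (metis blinfun_apply_blinfun_compose)
    have Cy: "C n y = 0" for n
    proof (induction n)
      case 0
      then show ?case using Sy[of 0] by (simp add: S_def)
    next
      case (Suc n)
      then show ?case using Sy[of "Suc n"] by (simp add: S_def blinfun.diff_left)
    qed
    have "(\<lambda>n. t n * (norm y)\<^sup>2) \<longlonglongrightarrow> b * (norm y)\<^sup>2" by (intro tendsto_intros tlim)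
    then have "b * (norm y)\<^sup>2 \<le> inner (B y) y"
      using c(5)[OF Cy] by (intro LIMSEQ_le_const2) auto
    then have "B y = norm B *\<^sub>R y" unfolding b_def by (rule psd_top_eigenvector[OF B(1)])
    then have "y = 0" by (rule top)
    then show ?thesis by (simp add: y_def)
  qed
  have Ssum: "(\<lambda>i. S i x) sums x" for x using G(2)[of x] by (simp add: Gid)
  \<comment> \<open>The nonzero layer \<open>m\<close> is matched with whatever part of
    \<open>A\<close> the chosen pieces leave over; enlarging its partner only helps the norm
    inequality.\<close>
  obtain m where m: "B o\<^sub>L S m \<noteq> 0"
  proof (rule ccontr)
    assume "\<not> thesis"
    then have "B (S i x) = 0" for i x using that
        by (metis blinfun_apply_blinfun_compose blinfun.zero_left)
    then have "(\<lambda>i. 0) sums B x" for x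
      using bounded_linear.sums[OF blinfun.bounded_linear_right Ssum, of B x] by simp
    then have "B x = 0" for x using sums_unique2 sums_zero by metis
    then show False using B(3) by (auto intro: blinfun_eqI simp: blinfun.zero_left)
  qed
  obtain Q where Q: "orth_family Q" "\<And>n::nat. Q n \<in> M" "\<And>n. Q n \<noteq> 0" "\<And>n. Q n o\<^sub>L A = A o\<^sub>L Q n"
    "\<And>n x. Q n x = x \<Longrightarrow> t (Suc n) * (norm x)\<^sup>2 \<le> inner (A x) x"
    by (rule heavy_sequence[OF A A0, of "\<lambda>n. t (Suc n)"])
      (use t0 tb eq in \<open>auto intro: that simp: b_def\<close>)
  note q = orth_familyD[OF Q(1)]
  \<comment> \<open>A layer on which \<open>B\<close> is 0 can only produce 0, so it must be matched
    with no part of \<open>A\<close>.\<close>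
  define Q' where "Q' n = (if B o\<^sub>L S n = 0 then 0 else Q n)" for n
  have "orth_family Q'" using q by (auto simp: Q'_def orth_family_def)
  moreover have "Q' n \<in> M" "Q' n o\<^sub>L A = A o\<^sub>L Q' n" for n using Q by (auto simp: Q'_def)
  ultimately obtain P where P: "orth_family P" "\<And>n. P n \<in> M" "\<And>n. P n o\<^sub>L A = A o\<^sub>L P n"
    "\<And>x. (\<lambda>n. P n x) sums x" "\<And>n. P n o\<^sub>L Q' n = Q' n" "\<And>n. n \<noteq> m \<Longrightarrow> P n = Q' n"
    using complete_orth_family[of Q' A m] by metis
  have "\<exists>X. decomposes (A o\<^sub>L P n) (B o\<^sub>L S n) X" for n
  proof (cases "B o\<^sub>L S n = 0")
    case True
    then have "P n = 0" using P(6)[of n] m by (auto simp: Q'_def)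
    then show ?thesis using True decomposes_zero by (auto intro!: exI[of _ "\<lambda>_. 0"])
  next
    case False
    have "norm (B o\<^sub>L S n) \<le> t n"
    proof (rule psd_norm_le[OF psd_compose_proj(1)[OF B(1) Sp SB] t0])
      fix x
      have "C n (S n x) = S n x" using CS by (metis blinfun_apply_blinfun_compose)
      then have "inner (B (S n x)) (S n x) \<le> t n * (norm (S n x))\<^sup>2" by (rule c(3))
      also have "\<dots> \<le> t n * (norm x)\<^sup>2"
        by (intro mult_left_mono power_mono orth_proj_norm_le Sp t0) auto
      finally show "inner ((B o\<^sub>L S n) x) x \<le> t n * (norm x)\<^sup>2"
        by (simp only: psd_compose_proj(2)[OF B(1) Sp SB])
    qed
    moreover have "t (Suc n) \<le> norm (A o\<^sub>L P n)"
    proof -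
      obtain u where u: "Q n u \<noteq> 0" using Q(3) by (metis blinfun_eqI blinfun.zero_left)
      define x where "x = Q n u"
      have "P n x = x" using P(5)[of n] False by (simp add: x_def Q'_def)
          (metis blinfun_apply_blinfun_compose)
      then have "t (Suc n) * (norm x)\<^sup>2 \<le> norm (A o\<^sub>L P n) * (norm x)\<^sup>2"
        using Q(5)[of n x] inner_apply_le[of "A o\<^sub>L P n" x] orth_projD(3)[OF q(1), of n u]
        by (simp add: x_def)
      then show ?thesis using u by (simp add: x_def)
    qed
    ultimately have "norm (B o\<^sub>L S n) < norm (A o\<^sub>L P n)" using tS[of n] by linarith
    then show ?thesis
      using decomposes_larger_norm[OF psd_compose_proj(1)[OF A(1) orth_familyD(1)[OF P(1)] P(3)] _
          psd_compose_proj(1)[OF B(1) Sp SB] _ False] A B P(2) SM by blast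
  qed
  then show ?thesis
    by (intro decomposes_direct_sum[OF A B(1,2) P(1-4) S SM SB Ssum])
qed

lemma eigenprojection_exists:
  assumes T: "psd T" "T \<in> M"
  shows "\<exists>R. orth_proj R \<and> R \<in> M \<and> (\<forall>x. R x = x \<longleftrightarrow> T x = b *\<^sub>R x) \<and> T o\<^sub>L R = b *\<^sub>R R \<and> R o\<^sub>L T
      = b *\<^sub>R R"
proof -
  let ?L = "{x. T x = b *\<^sub>R x}"
  have "subspace ?L" by (auto simp: subspace_def blinfun_apply_simps algebra_simps)
  moreover have "closed ?L" by (intro closed_Collect_eq continuous_intros)
  ultimately obtain R where R: "orth_proj R" "\<And>x. R x = x \<longleftrightarrow> x \<in> ?L"
    using exists_orth_proj by blast
  have "R \<in> M"
  proof (rule commuting_proj[OF R])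
    show "X x \<in> ?L" if "X \<in> N" "x \<in> ?L" for X x
      using that commutingD[OF T(2) that(1)] by (simp add: blinfun.scaleR_right)
  qed (rule N_hadj)
  moreover have TR: "T o\<^sub>L R = b *\<^sub>R R"
    by (rule blinfun_eqI) (use R(2) orth_projD(3)[OF R(1)] in \<open>simp add: blinfun.scaleR_left\<close>)
  moreover have "R o\<^sub>L T = b *\<^sub>R R"
    by (metis TR hadj_compose hadj_scaleR orth_projD(1)[OF R(1)] psdD(1)[OF T(1)])
  ultimately show ?thesis using R by auto
qed

text \<open>The eigenprojection \<open>P\<close> of \<open>A\<close> is split properly:
  \<open>P1\<close> is spent on the eigenpart \<open>R\<close> of \<open>B\<close>, and
  \<open>P - P1\<close> keeps the norm of the rest of \<open>A\<close> at \<open>b\<close>. The rest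
  of \<open>B\<close> is nonzero and has no eigenvector for \<open>b\<close>, so one of the two
  earlier cases applies to it.\<close>

lemma decomposes_common_top_eigenvalue:
  assumes A: "psd A" "A \<in> M" and B: "psd B" "B \<in> M" "B \<noteq> 0" and eq: "norm A = norm B"
    and P: "orth_proj P" "P \<in> M" "P \<noteq> 0" "\<And>x. P x = x \<longleftrightarrow> A x = norm A *\<^sub>R x"
    and R: "orth_proj R" "R \<in> M" "R \<noteq> 0" "\<And>x. R x = x \<longleftrightarrow> B x = norm B *\<^sub>R x"
    and ne: "B \<noteq> norm B *\<^sub>R R"
  shows "\<exists>X. decomposes A B X"
proof -
  define b where "b = norm B"
  have b: "0 < b" using B(3) by (simp add: b_def)
  have eqb: "norm A = b" using eq by (simp add: b_def)
  have BR: "B o\<^sub>L R = b *\<^sub>R R"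
    by (rule blinfun_eqI) (use R(4) orth_projD(3)[OF R(1)] in \<open>simp add: blinfun.scaleR_left b_def\<close>)
  have RB: "R o\<^sub>L B = b *\<^sub>R R"
    by (metis BR hadj_compose hadj_scaleR orth_projD(1)[OF R(1)] psdD(1)[OF B(1)])
  obtain P1 where P1: "orth_proj P1" "P1 \<in> M" "P1 \<noteq> 0" "P1 \<noteq> P" "P o\<^sub>L P1 = P1"
    using proper_subprojection[OF P(1-3)] .
  have PP1: "P (P1 x) = P1 x" for x using P1(5) by (metis blinfun_apply_blinfun_compose)
  have AP: "A o\<^sub>L P1 = b *\<^sub>R P1"
    by (rule blinfun_eqI) (use P(4) PP1 in \<open>simp add: blinfun.scaleR_left eqb\<close>)
  have PA: "P1 o\<^sub>L A = b *\<^sub>R P1"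
    by (metis AP hadj_compose hadj_scaleR orth_projD(1)[OF P1(1)] psdD(1)[OF A(1)])
  \<comment> \<open>A projection and its complement, padded with zeros to the sequence that
    \<open>decomposes_direct_sum\<close> expects.\<close>
  define pick where "pick E n = (if n = 0 then E else if n = 1 then id_blinfun - E else 0)"
    for E :: "'a \<Rightarrow>\<^sub>L 'a" and n :: nat
  have pick: "orth_family (pick E)" "\<And>x. (\<lambda>n. pick E n x) sums x" "\<And>n. pick E n \<in> M"
    if E: "orth_proj E" "E \<in> M" for E
  proof -
    have z: "E o\<^sub>L (id_blinfun - E) = 0" "(id_blinfun - E) o\<^sub>L E = 0"
      by (simp_all add: blinfun_compose_diff orth_projD(2)[OF E(1)])
    show "orth_family (pick E)"
      using z E(1) orth_proj_compl[OF E(1)] by (auto simp: orth_family_def pick_def)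
    show "(\<lambda>n. pick E n x) sums x" for x
    proof -
      have "(\<lambda>n. (if n = 0 then E x else 0) + (if n = 1 then x - E x else 0))
          sums (E x + (x - E x))"
        by (intro sums_add sums_single[of _ "\<lambda>_. E x"] sums_single[of _ "\<lambda>_. x - E x"])
      moreover have "(\<lambda>n. (if n = 0 then E x else 0) + (if n = 1 then x - E x else 0))
          = (\<lambda>n. pick E n x)"
        by (auto simp: pick_def fun_eq_iff blinfun_apply_simps)
      ultimately show ?thesis by simp
    qed
    show "pick E n \<in> M" for n using E by (simp add: pick_def)
  qed
  have pA: "pick P1 n o\<^sub>L A = A o\<^sub>L pick P1 n" for n
    by (simp add: pick_def blinfun_compose_diff AP PA)
  have pB: "pick R n o\<^sub>L B = B o\<^sub>L pick R n" for n
    by (simp add: pick_def blinfun_compose_diff BR RB)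
  show ?thesis
  proof (rule decomposes_direct_sum[OF A B(1,2) pick(1,3)[OF P1(1,2)] pA pick(2)[OF P1(1,2)]
        pick(1,3)[OF R(1,2)] pB pick(2)[OF R(1,2)]])
    fix n :: nat
    consider "n = 0" | "n = 1" | "n > 1" by linarith
    then show "\<exists>X. decomposes (A o\<^sub>L pick P1 n) (B o\<^sub>L pick R n) X"
    proof cases
      case 1
      then show ?thesis
        using decomposes_scaled_projections[OF P1(1-3) R(1-3) b] by (simp add: pick_def AP BR)
    next
      case 3
      then show ?thesis using decomposes_zero by (auto simp: pick_def)
    next
      case 2
      define A' where "A' = A o\<^sub>L (id_blinfun - P1)"
      define B' where "B' = B o\<^sub>L (id_blinfun - R)"
      have pp: "pick P1 1 = id_blinfun - P1" "pick R 1 = id_blinfun - R" by (simp_all add: pick_def)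
      have A': "psd A'" "A' \<in> M"
        unfolding A'_def pp[symmetric]
        using psd_compose_proj(1)[OF A(1) orth_familyD(1)[OF pick(1)[OF P1(1,2)]] pA]
            pick(3)[OF P1(1,2)] A(2)
        by auto
      have B': "psd B'" "B' \<in> M" "B' \<noteq> 0"
      proof -
        show "psd B'" "B' \<in> M"
          unfolding B'_def pp[symmetric]
          using psd_compose_proj(1)[OF B(1) orth_familyD(1)[OF pick(1)[OF R(1,2)]] pB]
              pick(3)[OF R(1,2)] B(2)
          by auto
        show "B' \<noteq> 0" using ne by (simp add: B'_def blinfun_compose_diff BR b_def)
      qed
      have nA: "b \<le> norm A'"
      proof -
        obtain u where "(P - P1) u \<noteq> 0" using P1(4)
            by (metis blinfun_eqI blinfun.zero_left eq_iff_diff_eq_0)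
        define x where "x = (P - P1) u"
        have x0: "x \<noteq> 0" using \<open>(P - P1) u \<noteq> 0\<close> by (simp add: x_def)
        have P1P: "P1 (P u) = P1 u"
          using orth_proj_diff(2)[OF P(1) P1(1,5)] by (metis blinfun_apply_blinfun_compose)
        have "P x = x" "P1 x = 0"
          by (simp_all add: x_def blinfun_apply_simps PP1 P1P orth_projD(3)[OF P(1)]
              orth_projD(3)[OF P1(1)])
        then have "A' x = b *\<^sub>R x" using P(4)[of x] by (simp add: A'_def blinfun_apply_simps eqb)
        then have "b * norm x \<le> norm A' * norm x"
          using norm_blinfun[of A' x] b by simp
        then show ?thesis using x0 by simp
      qed
      have nB: "norm B' \<le> b"
      proof -
        have "norm B' \<le> norm B * norm (id_blinfun - R)" unfolding B'_def
            by (rule norm_blinfun_compose)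
        also have "\<dots> \<le> norm B * 1"
          by (intro mult_left_mono orth_proj_norm_le_1 orth_proj_compl R) auto
        finally show ?thesis by (simp add: b_def)
      qed
      have "\<exists>X. decomposes A' B' X"
      proof (cases "norm B' < norm A'")
        case True
        then show ?thesis by (rule decomposes_larger_norm[OF A' B'])
      next
        case False
        then have e: "norm A' = norm B'" "norm B' = b" using nA nB by auto
        show ?thesis
        proof (rule decomposes_no_top_eigenvector[OF A' B' e(1)])
          fix x assume x: "B' x = norm B' *\<^sub>R x"
          have RBx: "R (B y) = b *\<^sub>R R y" for y
            using arg_cong[OF RB, of "\<lambda>f. blinfun_apply f y"] by (simp add: blinfun.scaleR_left)
          have "b *\<^sub>R R x = R (B' x)" by (simp add: x e blinfun.scaleR_right)
          also have "\<dots> = 0"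
            by (simp add: B'_def RBx blinfun_apply_simps orth_projD(3)[OF R(1)])
          finally have Rx: "R x = 0" using b by simp
          have "B' x = b *\<^sub>R x" using x e by simp
          then have "B x = b *\<^sub>R x" using Rx by (simp add: B'_def blinfun_apply_simps)
          then have "R x = x" using R(4) by (simp add: b_def)
          then show "x = 0" using Rx by simp
        qed
      qed
      then show ?thesis using 2 by (simp add: A'_def B'_def pick_def)
    qed
  qed
qed

end

section \<open>Spectral measures from spectral cuts\<close>

section \<open>The spectral theorem\<close>

text \<open>By Pythagoras the squared distance of two members at \<open>x\<close> is the difference
  of their squared norms, and these decrease to a limit.\<close>

lemma decreasing_projections_limit:
  fixes P :: "nat \<Rightarrow> ('a::hilbert_space \<Rightarrow>\<^sub>L 'a)"
  assumes P: "\<And>n. orth_proj (P n)" "\<And>m n. m \<le> n \<Longrightarrow> P m o\<^sub>L P n = P n"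
  obtains z where "(\<lambda>n. P n x) \<longlonglongrightarrow> z" "\<And>n. P n z = z"
proof -
  have PP: "P m (P n x) = P n x" "P n (P m x) = P n x" if "m \<le> n" for m n x
    using P(2)[OF that] orth_proj_diff(2)[OF P(1) P(1) P(2)[OF that]]
    by (metis blinfun_apply_blinfun_compose)+
  have d: "(norm (P m x - P n x))\<^sup>2 = (norm (P m x))\<^sup>2 - (norm (P n x))\<^sup>2" if "m \<le> n" for m n
    using orth_proj_pythagoras[OF P(1), of "P m x" n] PP[OF that] by simp
  have "decseq (\<lambda>n. (norm (P n x))\<^sup>2)"
  proof (rule decseq_SucI)
    show "(norm (P (Suc n) x))\<^sup>2 \<le> (norm (P n x))\<^sup>2" for n
      using d[of n "Suc n"] zero_le_power2[of "norm (P n x - P (Suc n) x)"] by linarith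
  qed
  then have "convergent (\<lambda>n. (norm (P n x))\<^sup>2)"
    by (metis convergentI decseq_convergent zero_le_power2)
  then have c: "Cauchy (\<lambda>n. (norm (P n x))\<^sup>2)" by (rule convergent_Cauchy)
  have "Cauchy (\<lambda>n. P n x)"
  proof (rule metric_CauchyI)
    fix e :: real assume e: "0 < e"
    then obtain N where N: "\<And>m n. m \<ge> N \<Longrightarrow> n \<ge> N \<Longrightarrow> dist ((norm (P m x))\<^sup>2) ((norm (P n x))\<^sup>2) < e\<^sup>2"
      using c unfolding Cauchy_def by (meson zero_less_power)
    have *: "dist (P m x) (P n x) < e" if "m \<ge> N" "m \<le> n" for m n
    proof -
      have "(norm (P m x - P n x))\<^sup>2 < e\<^sup>2"
        using N[of m n] that d[OF that(2)] by (auto simp: dist_real_def)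
      then show ?thesis using e by (metis dist_norm less_imp_le power_less_imp_less_base)
    qed
    have "dist (P m x) (P n x) < e" if "m \<ge> N" "n \<ge> N" for m n
      using *[of m n] *[of n m] that by (cases "m \<le> n") (auto simp: dist_commute)
    then show "\<exists>N. \<forall>m\<ge>N. \<forall>n\<ge>N. dist (P m x) (P n x) < e" by blast
  qed
  then obtain z where z: "(\<lambda>n. P n x) \<longlonglongrightarrow> z" using Cauchy_convergent convergentD by blast
  have "P m z = z" for m
  proof -
    have "(\<lambda>n. P m (P (n + m) x)) \<longlonglongrightarrow> P m z"
      by (intro bounded_linear.tendsto[OF blinfun.bounded_linear_right]
          LIMSEQ_ignore_initial_segment z)
    then have "(\<lambda>n. P (n + m) x) \<longlonglongrightarrow> P m z" by (simp add: PP)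
    then show ?thesis using LIMSEQ_ignore_initial_segment[OF z, of m] LIMSEQ_unique by blast
  qed
  then show ?thesis using that z by blast
qed

locale spectral_cuts =
  fixes T :: "'a::hilbert_space \<Rightarrow>\<^sub>L 'a" and C :: "real \<Rightarrow> ('a \<Rightarrow>\<^sub>L 'a)"
  assumes T: "psd T" and C: "\<And>t. spectral_cut T t (C t)"
begin

lemmas c = spectral_cutD[OF C]

lemma cut_mono: "l \<le> m \<Longrightarrow> C m (C l x) = C l x" "l \<le> m \<Longrightarrow> C l (C m x) = C l x"
  using spectral_cut_mono[OF C C] orth_proj_diff(2)[OF c(1) c(1) spectral_cut_mono[OF C C]]
  by (metis blinfun_apply_blinfun_compose)+

lemma cut_low: "t < 0 \<Longrightarrow> C t = 0"
proof (rule blinfun_eqI)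
  fix x assume t: "t < 0"
  define y where "y = C t x"
  have "inner (T y) y \<le> t * (norm y)\<^sup>2" by (rule c(3)) (simp add: y_def orth_projD(3)[OF c(1)])
  then have "0 \<le> t * (norm y)\<^sup>2" using psdD(2)[OF T, of y] by linarith
  then have "y = 0" using t by (simp add: zero_le_mult_iff)
  then show "C t x = blinfun_apply 0 x" by (simp add: y_def blinfun.zero_left)
qed

lemma cut_high: "norm T \<le> t \<Longrightarrow> C t = id_blinfun"
proof (rule blinfun_eqI)
  fix x assume t: "norm T \<le> t"
  define y where "y = x - C t x"
  have "C t y = 0" by (simp add: y_def blinfun.diff_right orth_projD(3)[OF c(1)])
  moreover have "norm T * (norm y)\<^sup>2 \<le> t * (norm y)\<^sup>2" using t by (intro mult_right_mono) auto
  ultimately have "y = 0" using c(4)[of t y] inner_apply_le[of T y] by linarith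
  then show "C t x = id_blinfun x" by (simp add: y_def)
qed

definition F :: "'a \<Rightarrow> real \<Rightarrow> real" where "F x t = inner (C t x) x"

lemma F_diff:
  assumes "s \<le> t"
  shows "orth_proj (C t - C s)" "F x t - F x s = (norm ((C t - C s) x))\<^sup>2"
proof -
  show 1: "orth_proj (C t - C s)"
    by (rule orth_proj_diff(1)[OF c(1) c(1) spectral_cut_mono[OF C C assms]])
  show "F x t - F x s = (norm ((C t - C s) x))\<^sup>2"
    unfolding orth_proj_inner_self[OF 1, symmetric] F_def
        by (simp add: blinfun_apply_simps inner_simps)
qed

lemma F_mono: "s \<le> t \<Longrightarrow> F x s \<le> F x t"
  using F_diff(2)[of s t x] by (metis diff_ge_0_iff_ge zero_le_power2)

text \<open>The limit \<open>z\<close> of \<open>C (u n) x\<close> lies below every cut at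
  \<open>u n > a\<close>. Its component off \<open>C a\<close> would have form at most
  \<open>a\<close> in the limit, against the strict inequality in \<open>spectral_cut\<close>; so
  \<open>z = C a x\<close>.\<close>

lemma F_right_continuous: "continuous (at_right a) (F x)"
proof (rule continuous_at_right_real_increasing[THEN iffD2, OF F_mono], assumption, intro allI impI)
  fix e :: real assume e: "0 < e"
  define u where "u n = a + inverse (real (Suc n))" for n
  have "u n \<le> u m" if "m \<le> n" for m n
    using that unfolding u_def by (intro add_left_mono le_imp_inverse_le) auto
  then have "C (u m) o\<^sub>L C (u n) = C (u n)" if "m \<le> n" for m n
    using that by (intro spectral_cut_mono[OF C C])
  then obtain z where z: "(\<lambda>n. C (u n) x) \<longlonglongrightarrow> z" "\<And>n. C (u n) z = z"
    using decreasing_projections_limit[of "\<lambda>n. C (u n)" x] c(1) by metis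
  have ule: "a \<le> u n" for n by (simp add: u_def)
  define y where "y = z - C a z"
  have uy: "C (u n) y = y" for n by (simp add: y_def blinfun.diff_right z cut_mono(1)[OF ule])
  have ul: "u \<longlonglongrightarrow> a"
    using LIMSEQ_inverse_real_of_nat_add[of a] by (simp add: u_def[abs_def])
  have "(\<lambda>n. u n * (norm y)\<^sup>2) \<longlonglongrightarrow> a * (norm y)\<^sup>2" by (intro tendsto_intros ul)
  then have "inner (T y) y \<le> a * (norm y)\<^sup>2"
    using c(3)[OF uy] by (intro LIMSEQ_le_const) auto
  moreover have "C a y = 0" by (simp add: y_def blinfun.diff_right orth_projD(3)[OF c(1)])
  ultimately have "y = 0" using c(4)[of a y] by linarith
  then have Cz: "C a z = z" by (simp add: y_def)
  have "(\<lambda>n. C a (C (u n) x)) \<longlonglongrightarrow> C a z"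
    by (intro bounded_linear.tendsto[OF blinfun.bounded_linear_right] z)
  then have "(\<lambda>n. C a x) \<longlonglongrightarrow> z" by (simp add: cut_mono(2)[OF ule] Cz)
  then have "C a x = z" by (simp add: LIMSEQ_const_iff)
  then have "(\<lambda>n. F x (u n)) \<longlonglongrightarrow> F x a"
    unfolding F_def by (intro tendsto_inner tendsto_const) (use z in simp)
  then have "\<forall>\<^sub>F n in sequentially. F x (u n) < F x a + e"
    by (rule order_tendstoD(1)[rotated, where a="F x a + e", simplified] | rule order_tendstoD(2))
        (use e in simp)
  then obtain n where "F x (u n) < F x a + e" using eventually_happens' sequentially_bot by blast
  then show "\<exists>d>0. F x (a + d) - F x a < e"
    by (intro exI[of _ "inverse (real (Suc n))"]) (auto simp: u_def)
qed

definition mu :: "'a \<Rightarrow> real measure" where "mu x = interval_measure (F x)"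

lemma sets_mu [simp, measurable_cong]: "sets (mu x) = sets borel"
  and space_mu [simp]: "space (mu x) = UNIV"
  by (simp_all add: mu_def)

lemma mu_Ioc: "s \<le> t \<Longrightarrow> emeasure (mu x) {s<..t} = ennreal (F x t - F x s)"
  unfolding mu_def by (rule emeasure_interval_measure_Ioc) (auto intro: F_mono F_right_continuous)

lemma mu_Ioc_full: "s < 0 \<Longrightarrow> norm T \<le> t \<Longrightarrow> emeasure (mu x) {s<..t} = ennreal ((norm x)\<^sup>2)"
  using mu_Ioc[of s t x] norm_ge_zero[of T]
  by (simp add: F_def cut_low cut_high blinfun.zero_left power2_norm_eq_inner del: norm_ge_zero)

lemma mu_UNIV: "emeasure (mu x) UNIV = ennreal ((norm x)\<^sup>2)"
proof -
  let ?A = "\<lambda>n::nat. {- 1 - real n<..norm T + real n}"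
  have "incseq ?A" by (auto simp: incseq_def)
  then have "(SUP n. emeasure (mu x) (?A n)) = emeasure (mu x) (\<Union>n. ?A n)"
    by (intro SUP_emeasure_incseq) auto
  moreover have "(\<Union>n. ?A n) = UNIV"
  proof -
    have "y \<in> ?A (nat \<lceil>\<bar>y\<bar>\<rceil>)" for y
    proof -
      have "\<bar>y\<bar> \<le> real (nat \<lceil>\<bar>y\<bar>\<rceil>)" by linarith
      then show ?thesis using norm_ge_zero[of T] unfolding greaterThanAtMost_iff by linarith
    qed
    then show ?thesis by blast
  qed
  moreover have "emeasure (mu x) (?A n) = ennreal ((norm x)\<^sup>2)" for n
    by (rule mu_Ioc_full) auto
  ultimately show ?thesis by simp
qed

text \<open>The masses of one set under all the measures \<open>mu x\<close> are the quadratic form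
  of a single projection. Since the form determines the projection, the relation defines the
  spectral measure without passing through sesquilinear forms.\<close>

definition represents :: "('a \<Rightarrow>\<^sub>L 'a) \<Rightarrow> real set \<Rightarrow> bool" where
  "represents P S \<longleftrightarrow> orth_proj P \<and> (\<forall>x. emeasure (mu x) S = ennreal (inner (P x) x))"

lemma representsD:
  assumes "represents P S"
  shows "orth_proj P" "emeasure (mu x) S = ennreal (inner (P x) x)" "0 \<le> inner (P x) x"
  using assms orth_proj_inner_self[of P x] by (auto simp: represents_def)

lemma represents_unique:
  assumes "represents P S" "represents Q S"
  shows "P = Q"
proof (rule sa_eqI)
  show "inner (P x) x = inner (Q x) x" for x
    using representsD(2,3)[OF assms(1), of x] representsD(2,3)[OF assms(2), of x] by simp
qed (use assms representsD(1) orth_projD(1) in blast)+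

text \<open>The form of \<open>P + Q\<close> is the mass of a disjoint union, hence at most the
  total mass \<open>(norm x)\<^sup>2\<close>; this forces the two projections to be
  orthogonal.\<close>

lemma represents_disjoint:
  assumes P: "represents P S" "represents Q R" and S: "S \<in> sets borel" "R \<in> sets borel" "S \<inter> R = {}"
  shows "P o\<^sub>L Q = 0" "represents (P + Q) (S \<union> R)"
proof -
  note p = representsD[OF P(1)] and q = representsD[OF P(2)]
  have e: "emeasure (mu x) (S \<union> R) = ennreal (inner (P x) x + inner (Q x) x)" for x
    using S p(3) q(3) by (subst plus_emeasure[symmetric]) (auto simp: p(2) q(2))
  show z: "P o\<^sub>L Q = 0"
  proof (rule orth_proj_le_1_product_zero[OF p(1) q(1)])
    show "inner (P x) x + inner (Q x) x \<le> (norm x)\<^sup>2" for x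
      using emeasure_mono[of "S \<union> R" UNIV "mu x"] by (simp add: e mu_UNIV)
  qed
  show "represents (P + Q) (S \<union> R)"
    using orth_proj_add[OF p(1) q(1) z]
        by (simp add: represents_def e blinfun_apply_simps inner_simps)
qed

lemma represents_union:
  assumes A: "\<And>i::nat. A i \<in> sets borel" "disjoint_family A" and P: "\<And>i. represents (P i) (A i)"
  obtains Q where "represents Q (\<Union>i. A i)" "\<And>x. (\<lambda>i. P i x) sums blinfun_apply Q x"
proof -
  have "orth_family P"
    using representsD(1)[OF P] represents_disjoint(1)[OF P P A(1) A(1)] A(2)
    by (auto simp: orth_family_def disjoint_family_on_def)
  then obtain Q where Q: "orth_proj Q" "\<And>x. (\<lambda>i. P i x) sums blinfun_apply Q x"
    using orth_family_sum by metis
  have "emeasure (mu x) (\<Union>i. A i) = ennreal (inner (Q x) x)" for x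
  proof -
    have s: "(\<lambda>i. inner (P i x) x) sums inner (Q x) x"
      by (rule bounded_linear.sums[OF bounded_linear_inner_left Q(2)])
    have "emeasure (mu x) (\<Union>i. A i) = (\<Sum>i. emeasure (mu x) (A i))"
      using A by (intro suminf_emeasure[symmetric]) auto
    also have "\<dots> = ennreal (inner (Q x) x)"
      unfolding representsD(2)[OF P] suminf_ennreal2[OF representsD(3)[OF P] sums_summable[OF s]]
        sums_unique[OF s] ..
    finally show ?thesis .
  qed
  then show ?thesis using that Q by (auto simp: represents_def)
qed

text \<open>Induction over the Dynkin system generated by half-open intervals, where
  \<open>C b - C a\<close> does it. Complements and disjoint unions are exactly the operations under
  which projections with given forms can be combined.\<close>

lemma represents_ex:
  assumes "S \<in> sets borel"
  shows "\<exists>P. represents P S \<and> P \<in> bicommuting T"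
proof -
  have S: "S \<in> sigma_sets UNIV (range (\<lambda>(a, b). {a<..b::real}))"
    using assms unfolding borel_sigma_sets_Ioc by simp
  have bor: "A \<in> sets borel" if "A \<in> sigma_sets UNIV (range (\<lambda>(a, b). {a<..b::real}))" for A
    using that unfolding borel_sigma_sets_Ioc by simp
  have "Int_stable (range (\<lambda>(a, b). {a<..b::real}))"
    by (auto simp: Int_stable_def image_iff)
  moreover have "range (\<lambda>(a, b). {a<..b::real}) \<subseteq> Pow UNIV" by simp
  ultimately show ?thesis
    using S
  proof (induction S rule: sigma_sets_induct_disjoint)
    case (basic A)
    then obtain a b where A: "A = {a<..b}" by auto
    show ?case
    proof (cases "a \<le> b")
      case True
      then have "represents (C b - C a) A"
        by (simp add: represents_def F_diff(1) A mu_Ioc F_diff(2)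
            orth_proj_inner_self[OF F_diff(1)])
      then show ?thesis using c(2) by blast
    qed (auto simp: A represents_def blinfun.zero_left intro!: exI[of _ 0])
  next
    case empty
    show ?case by (auto simp: represents_def blinfun.zero_left intro!: exI[of _ 0])
  next
    case (compl A)
    then obtain P where P: "represents P A" "P \<in> bicommuting T" by blast
    note p = representsD[OF P(1)]
    have "emeasure (mu x) (UNIV - A) = ennreal (inner ((id_blinfun - P) x) x)" for x
    proof -
      have "emeasure (mu x) (UNIV - A) = emeasure (mu x) UNIV - emeasure (mu x) A"
        using emeasure_compl[of A "mu x"] bor[OF compl(1)] p(2)[of x] by simp
      then show ?thesis
        using p(2,3) mu_UNIV
        by (simp add: ennreal_minus blinfun_apply_simps inner_simps power2_norm_eq_inner)
    qed
    then show ?case using orth_proj_compl[OF p(1)] P(2)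
      by (intro exI[of _ "id_blinfun - P"]) (simp add: represents_def)
  next
    case (union A)
    obtain P where P: "\<And>i. represents (P i) (A i)" "\<And>i. P i \<in> bicommuting T"
      using union(3) by metis
    have "A i \<in> sets borel" for i using bor union(2) by auto
    then obtain Q where Q: "represents Q (\<Union>i. A i)" "\<And>x. (\<lambda>i. P i x) sums blinfun_apply Q x"
      using represents_union[OF _ union(1) P(1)] by metis
    show ?case using Q(1) commuting_sums[OF P(2) Q(2)] by blast
  qed
qed

lemma mu_finite: "finite_measure (mu x)"
  by (rule finite_measureI) (simp add: mu_UNIV)

lemma mu_support: "AE t in mu x. - 1 < t \<and> t \<le> norm T"
proof (rule AE_I')
  interpret finite_measure "mu x" by (rule mu_finite)
  have "emeasure (mu x) (UNIV - {- 1<..norm T}) = 0"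
    using emeasure_compl[of "{- 1<..norm T}" "mu x"] mu_UNIV[of x] mu_Ioc_full[of "- 1" "norm T" x]
    by simp
  then show "UNIV - {- 1<..norm T} \<in> null_sets (mu x)" by auto
qed auto

lemma mu_integrable: "integrable (mu x) (\<lambda>t. t)"
proof -
  interpret finite_measure "mu x" by (rule mu_finite)
  show ?thesis
  proof (rule integrable_const_bound[of _ "norm T + 1"])
    show "AE t in mu x. norm t \<le> norm T + 1"
      using mu_support[of x]
    proof (rule AE_mp, intro AE_I2 impI)
      fix t :: real assume "- 1 < t \<and> t \<le> norm T"
      then have "- t \<le> norm T + 1" "t \<le> norm T + 1" using norm_ge_zero[of T] by linarith+
      then show "norm t \<le> norm T + 1" by (simp add: abs_le_iff)
    qed
  qed simp
qed

text \<open>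
  Both sides, restricted to \<open>{s<..t}\<close>, lie between \<open>s\<close> and \<open>t\<close> times the mass
  of this interval; summing over finer and finer partitions shows that they agree.
\<close>

lemma mu_integral: "inner (T x) x = (\<integral>t. t \<partial>mu x)"
proof -
  interpret finite_measure "mu x" by (rule mu_finite)
  define g where "g s = inner (T (C s x)) (C s x) - (\<integral>t\<in>{- 1<..s}. t \<partial>mu x)" for s
  have si: "set_integrable (mu x) A (\<lambda>t. t)" if "A \<in> sets borel" for A
    unfolding set_integrable_def using that by (intro integrable_mult_indicator mu_integrable) auto
  \<comment> \<open>The increments of both quantities lie between \<open>s\<close> and
    \<open>t\<close> times the mass of the interval, so \<open>g\<close> changes by at most length
    times mass, which is of second order.\<close>
  have inc: "\<bar>g t - g s\<bar> \<le> (t - s) * (F x t - F x s)" if st: "- 1 \<le> s" "s \<le> t" for s t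
  proof -
    define y where "y = (C t - C s) x"
    have dF: "F x t - F x s = (norm y)\<^sup>2" unfolding y_def by (rule F_diff(2)[OF st(2)])
    have y: "C t y = y" "C s y = 0"
      by (simp_all add: y_def blinfun_apply_simps cut_mono[OF st(2)] orth_projD(3)[OF c(1)])
    have "inner (T (C t x)) (C t x) = inner (T (C s (C t x))) (C s (C t x))
        + inner (T (C t x - C s (C t x))) (C t x - C s (C t x))"
    proof -
      have co: "C s (T z) = T (C s z)" for z by (rule bicommuting_commute'[OF c(2)])
      define w where "w = C t x"
      have "inner (T (C s w)) w = inner (T (C s w)) (C s w)" "inner (T w) (C s w)
          = inner (T (C s w)) (C s w)"
        by (metis co orth_proj_inner[OF c(1)] orth_projD(3)[OF c(1)])+
      then show ?thesis unfolding w_def[symmetric] by (simp add: blinfun_apply_simps inner_simps)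
    qed
    then have a: "inner (T (C t x)) (C t x) = inner (T (C s x)) (C s x) + inner (T y) y"
      by (simp add: cut_mono[OF st(2)] y_def blinfun.diff_left)
    have "{- 1<..t} = {- 1<..s} \<union> {s<..t}" using st by auto
    then have b: "(\<integral>u\<in>{- 1<..t}. u \<partial>mu x) = (\<integral>u\<in>{- 1<..s}. u \<partial>mu x) + (\<integral>u\<in>{s<..t}. u \<partial>mu x)"
      by (simp add: set_integral_Un si)
    have m: "measure (mu x) {s<..t} = (norm y)\<^sup>2"
      unfolding measure_def mu_Ioc[OF st(2)] dF by simp
    have const: "(\<integral>u\<in>{s<..t}. r \<partial>mu x) = r * (norm y)\<^sup>2" for r :: real
      using set_integral_const[of "{s<..t}" "mu x" r] m
          by (simp add: mult.commute emeasure_eq_measure)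
    have sc: "set_integrable (mu x) {s<..t} (\<lambda>_. r)" for r :: real
      unfolding set_integrable_def by (intro integrable_mult_indicator) auto
    have "s * (norm y)\<^sup>2 \<le> (\<integral>u\<in>{s<..t}. u \<partial>mu x)"
      unfolding const[symmetric] by (intro set_integral_mono sc si) auto
    moreover have "(\<integral>u\<in>{s<..t}. u \<partial>mu x) \<le> t * (norm y)\<^sup>2"
      unfolding const[symmetric] by (intro set_integral_mono sc si) auto
    moreover have "s * (norm y)\<^sup>2 \<le> inner (T y) y" "inner (T y) y \<le> t * (norm y)\<^sup>2"
      using c(5)[OF y(2)] c(3)[OF y(1)] by auto
    ultimately show ?thesis
      unfolding g_def a b dF by (simp add: left_diff_distrib abs_le_iff)
  qed
  define L where "L = norm T + 1"
  have L: "0 < L" by (simp add: L_def add_nonneg_pos)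
  \<comment> \<open>\<open>L\<close> is the distance from -1, below the spectrum, to
    \<open>norm T\<close>. Over \<open>Suc n\<close> steps of length \<open>h\<close> the masses
    telescope to \<open>(norm x)\<^sup>2\<close>, so the total error is at most \<open>h\<close>
    times this.\<close>
  have bound: "\<bar>g (norm T) - g (- 1)\<bar> \<le> L * (norm x)\<^sup>2 / real (Suc n)" for n
  proof -
    define h where "h = L / real (Suc n)"
    define p where "p k = - 1 + h * real k" for k
    have h: "0 \<le> h" using L by (simp add: h_def)
    have "\<bar>g (p k) - g (p 0)\<bar> \<le> h * (F x (p k) - F x (p 0))" for k
    proof (induction k)
      case (Suc k)
      have "\<bar>g (p (Suc k)) - g (p k)\<bar> \<le> (p (Suc k) - p k) * (F x (p (Suc k)) - F x (p k))"
        by (rule inc) (use h in \<open>auto simp: p_def algebra_simps\<close>)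
      also have "p (Suc k) - p k = h" by (simp add: p_def algebra_simps)
      finally show ?case using Suc by (simp add: right_diff_distrib)
    qed simp
    from this[of "Suc n"] have "\<bar>g (p (Suc n)) - g (p 0)\<bar> \<le> h * (F x (p (Suc n)) - F x (p 0))" .
    moreover have "p (Suc n) = norm T" "p 0 = - 1" by (simp_all add: p_def h_def L_def)
    ultimately show ?thesis
      by (simp add: h_def F_def cut_low cut_high blinfun.zero_left power2_norm_eq_inner)
  qed
  have "(\<lambda>n. L * (norm x)\<^sup>2 / real (Suc n)) \<longlonglongrightarrow> 0"
    by (rule LIMSEQ_Suc) (rule lim_const_over_n)
  then have "\<bar>g (norm T) - g (- 1)\<bar> \<le> 0"
    using bound by (intro LIMSEQ_le_const) auto
  moreover have "g (- 1) = 0"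
      by (simp add: g_def cut_low blinfun.zero_left blinfun.zero_right set_lebesgue_integral_def)
  ultimately have "g (norm T) = 0" by simp
  then have "inner (T x) x = (\<integral>t\<in>{- 1<..norm T}. t \<partial>mu x)" by (simp add: g_def cut_high)
  also have "\<dots> = (\<integral>t. t \<partial>mu x)"
    unfolding set_lebesgue_integral_def
  proof (rule integral_cong_AE)
    show "AE t in mu x. indicator {- 1<..norm T} t *\<^sub>R t = t"
      using mu_support[of x] by (rule eventually_mono) (simp add: indicator_def)
  qed auto
  finally show ?thesis .
qed

end

theorem spectral_theorem_psd:
  fixes T :: "'a::hilbert_space \<Rightarrow>\<^sub>L 'a"
  assumes T: "psd T"
  obtains E :: "real set \<Rightarrow> ('a \<Rightarrow>\<^sub>L 'a)" and \<mu> a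
  where "\<And>S. S \<in> sets borel \<Longrightarrow> orth_proj (E S)" "\<And>S. S \<in> sets borel \<Longrightarrow> E S \<in> bicommuting T"
    "E UNIV = id_blinfun" "E {-a..a} = id_blinfun"
    "\<And>S R. S \<in> sets borel \<Longrightarrow> R \<in> sets borel \<Longrightarrow> E (S \<inter> R) = E S o\<^sub>L E R"
    "\<And>F x. range F \<subseteq> sets borel \<Longrightarrow> disjoint_family F \<Longrightarrow>
        (\<lambda>i::nat. blinfun_apply (E (F i)) x) sums E (\<Union>i. F i) x"
    "\<And>x. sets (\<mu> x) = sets borel"
    "\<And>S x. S \<in> sets borel \<Longrightarrow> emeasure (\<mu> x) S = ennreal (inner (E S x) x)"
    "\<And>x. integrable (\<mu> x) (\<lambda>t. t)" "\<And>x. inner (T x) x = (\<integral>t. t \<partial>\<mu> x)"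
proof -
  have "\<forall>t. \<exists>E. spectral_cut T t E" using spectral_cut_exists psdD(1)[OF T] by blast
  then obtain C where "\<And>t. spectral_cut T t (C t)" by metis
  then interpret spectral_cuts T C using T by unfold_locales
  obtain E where E: "\<And>S. S \<in> sets borel \<Longrightarrow> represents (E S) S"
    "\<And>S. S \<in> sets borel \<Longrightarrow> E S \<in> bicommuting T"
    using represents_ex by metis
  have full: "E S = id_blinfun" if "S \<in> sets borel" "{- 1<..norm T} \<subseteq> S" for S
  proof (rule represents_unique[OF E(1)[OF that(1)]])
    have "emeasure (mu x) S = ennreal ((norm x)\<^sup>2)" for x
      using emeasure_mono[of S UNIV "mu x"] emeasure_mono[OF that(2), of "mu x"] that(1)
      by (simp add: mu_UNIV mu_Ioc_full)
    then show "represents id_blinfun S" by (simp add: represents_def power2_norm_eq_inner)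
  qed
  have add: "(\<lambda>i. E (F i) x) sums E (\<Union>i. F i) x"
    if F: "range F \<subseteq> sets borel" "disjoint_family F" for F :: "nat \<Rightarrow> real set" and x
  proof -
    have FB: "F i \<in> sets borel" for i using F by auto
    then obtain Q where Q: "represents Q (\<Union>i. F i)" "\<And>x. (\<lambda>i. E (F i) x) sums blinfun_apply Q x"
      using represents_union[OF FB F(2) E(1)[OF FB]] by metis
    have "E (\<Union>i. F i) = Q" by (rule represents_unique[OF E(1) Q(1)]) (use FB in auto)
    then show ?thesis using Q by simp
  qed
  have un: "E (S \<union> R) = E S + E R" "E S o\<^sub>L E R = 0"
    if SR: "S \<in> sets borel" "R \<in> sets borel" "S \<inter> R = {}" for S R
    using represents_disjoint[OF E(1)[OF SR(1)] E(1)[OF SR(2)] SR]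
      represents_unique[OF E(1)[of "S \<union> R"]] SR by auto
  have mult: "E (S \<inter> R) = E S o\<^sub>L E R" if SR: "S \<in> sets borel" "R \<in> sets borel" for S R
  proof -
    \<comment> \<open>Multiplicativity follows from additivity: the common part and the two
      differences are disjoint, so all mixed products vanish.\<close>
    define A B D where "A = S \<inter> R" and "B = S - R" and "D = R - S"
    have m: "A \<in> sets borel" "B \<in> sets borel" "D \<in> sets borel" using SR
        by (auto simp: A_def B_def D_def)
    have "E S = E A + E B"
    proof -
      have "S = A \<union> B" "A \<inter> B = {}" by (auto simp: A_def B_def)
      then show ?thesis using un(1)[of A B] m by simp
    qed
    moreover have "E R = E A + E D"
    proof -
      have "R = A \<union> D" "A \<inter> D = {}" by (auto simp: A_def D_def)
      then show ?thesis using un(1)[of A D] m by simp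
    qed
    moreover have "E A o\<^sub>L E D = 0" "E B o\<^sub>L E A = 0" "E B o\<^sub>L E D = 0"
      by (rule un(2); use m in \<open>auto simp: A_def B_def D_def\<close>)+
    ultimately show ?thesis
      using orth_projD(2)[OF representsD(1)[OF E(1)[OF m(1)]]]
          by (simp add: blinfun_compose_add A_def)
  qed
  have sub: "{- 1<..norm T} \<subseteq> {- (norm T + 1)..norm T + 1}"
    using norm_ge_zero[of T] by (auto simp del: norm_ge_zero)
  show ?thesis
    by (rule that[of E "norm T + 1" mu, OF representsD(1)[OF E(1)] E(2) _ _ mult _ _
          representsD(2)[OF E(1)] mu_integrable mu_integral])
      (use full sub add in auto)
qed

section \<open>Transfer to complex Hilbert spaces\<close>

section \<open>Complex Hilbert spaces as real ones\<close>

lemma scaleC_zero_left: "0 *\<^sub>C x = 0"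
  using scaleC_add_left[of 0 0 x] by simp

lemma scaleC_one [simp]: "1 *\<^sub>C x = x"
  using scaleR_scaleC[of 1 x] by simp

lemma scaleC_cartesian: "c *\<^sub>C x = Re c *\<^sub>R x + Im c *\<^sub>R (\<i> *\<^sub>C x)"
proof -
  have "c *\<^sub>C x = (complex_of_real (Re c) + complex_of_real (Im c) * \<i>) *\<^sub>C x"
    by (metis complex_eq mult.commute)
  then show ?thesis by (simp only: scaleC_add_left scaleR_scaleC scaleC_scaleC)
qed

lemma cinner_scaleC_right: "cinner x (c *\<^sub>C y) = cnj c * cinner x y"
  by (metis cinner_commute cinner_scaleC_left complex_cnj_mult)

lemma cinner_cartesian: "cinner x y = Complex (inner x y) (inner x (\<i> *\<^sub>C y))"
  by (simp add: complex_eq_iff inner_eq_Re_cinner cinner_scaleC_right)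

lemma inner_i_left: "inner (\<i> *\<^sub>C x) y = - inner x (\<i> *\<^sub>C y)"
  by (simp add: inner_eq_Re_cinner cinner_scaleC_right cinner_scaleC_left)

lemma i_i: "\<i> *\<^sub>C \<i> *\<^sub>C x = - x"
  using scaleR_scaleC[of "- 1" x] by (simp add: scaleC_scaleC)

lift_definition mult_i :: "'a::chilbert_space \<Rightarrow>\<^sub>L 'a" is "\<lambda>x. \<i> *\<^sub>C x"
proof (rule bounded_linear_intro[of _ 1])
  show "\<i> *\<^sub>C (x + y) = \<i> *\<^sub>C x + \<i> *\<^sub>C y" for x y :: 'a by (rule scaleC_add_right)
  show "\<i> *\<^sub>C r *\<^sub>R x = r *\<^sub>R (\<i> *\<^sub>C x)" for r and x :: 'a
    by (simp add: scaleR_scaleC scaleC_scaleC mult.commute)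
  show "norm (\<i> *\<^sub>C x) \<le> norm x * 1" for x :: 'a
    using inner_i_left[of x "\<i> *\<^sub>C x"] by (simp add: norm_eq_sqrt_inner i_i)
qed

lemma hadj_mult_i: "mult_i\<dagger> = - mult_i"
  by (rule hadj_eqI) (simp add: mult_i.rep_eq inner_i_left blinfun.minus_left)

text \<open>Both signs are listed because multiplication by \<open>\<i>\<close> is skew: with its
  negative it forms a set closed under adjoints.\<close>

lemma bounded_ops_eq: "bounded_ops = commuting {mult_i, - mult_i}"
proof (intro set_eqI iffI)
  fix T :: "'a \<Rightarrow>\<^sub>L 'a"
  assume "T \<in> bounded_ops"
  then show "T \<in> commuting {mult_i, - mult_i}"
    by (auto intro!: commutingI simp: bounded_ops_def mult_i.rep_eq blinfun.minus_left blinfun.minus_right)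
next
  fix T :: "'a \<Rightarrow>\<^sub>L 'a"
  assume "T \<in> commuting {mult_i, - mult_i}"
  then have Ti: "T (\<i> *\<^sub>C x) = \<i> *\<^sub>C T x" for x
    using commutingD[of T _ mult_i x] by (simp add: mult_i.rep_eq)
  have "T (c *\<^sub>C x) = c *\<^sub>C T x" for c x
  proof -
    have "T (c *\<^sub>C x) = Re c *\<^sub>R T x + Im c *\<^sub>R (\<i> *\<^sub>C T x)"
      by (subst scaleC_cartesian) (simp only: blinfun.add_right blinfun.scaleR_right Ti)
    then show ?thesis by (simp only: scaleC_cartesian[symmetric])
  qed
  then show "T \<in> bounded_ops" by (simp add: bounded_ops_def)
qed

lemma mult_i_hadj_closed: "X \<in> {mult_i, - mult_i} \<Longrightarrow> X\<dagger> \<in> {mult_i, - mult_i}"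
  using hadj_scaleR[of "- 1" mult_i] by (auto simp: hadj_mult_i)

lemma bounded_ops_hadj: "T \<in> bounded_ops \<Longrightarrow> T\<dagger> \<in> bounded_ops"
  unfolding bounded_ops_eq by (rule commuting_hadj[OF _ mult_i_hadj_closed])

lemma adj_eq_hadj:
  assumes "T \<in> bounded_ops"
  shows "adj T = T\<dagger>"
  unfolding adj_def
proof (rule the_equality)
  show "\<forall>x y. cinner (T x) y = cinner x (T\<dagger> y)"
    using bounded_ops_hadj[OF assms]
    by (auto simp: cinner_cartesian inner_hadj bounded_ops_def)
  show "S = T\<dagger>" if "\<forall>x y. cinner (T x) y = cinner x (blinfun_apply S y)" for S
    by (rule hadj_eqI[symmetric]) (simp add: inner_eq_Re_cinner that)
qed

lemma is_projection_iff: "is_projection P \<longleftrightarrow> P \<in> bounded_ops \<and> orth_proj P"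
  by (auto simp: is_projection_def orth_proj_def adj_eq_hadj)

text \<open>Self-adjointness is built into \<open>psd\<close> but has to be derived from
  \<open>positive_op\<close>: polarise the vanishing imaginary part of the form, then replace
  \<open>y\<close> by \<open>\<i> *\<^sub>C y\<close>.\<close>

lemma positive_op_iff: "positive_op T \<longleftrightarrow> T \<in> bounded_ops \<and> psd T"
proof
  assume p: "positive_op T"
  then have T: "T \<in> bounded_ops" by (simp add: positive_op_def)
  then have Ti: "T (\<i> *\<^sub>C x) = \<i> *\<^sub>C T x" for x by (simp add: bounded_ops_def)
  have re: "0 \<le> inner (T x) x" and im: "inner (T x) (\<i> *\<^sub>C x) = 0" for x
    using p by (auto simp: positive_op_def cinner_cartesian complex_nonneg_Reals_iff)
  have "T\<dagger> = T"
  proof (rule hadj_eqI)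
    fix x y
    have *: "inner (T x) (\<i> *\<^sub>C y) + inner (T y) (\<i> *\<^sub>C x) = 0" for y
      using im[of "x + y"] im[of x] im[of y]
      by (simp add: blinfun.add_right scaleC_add_right inner_simps)
    from *[of "\<i> *\<^sub>C y"] show "inner (T x) y = inner x (T y)"
      by (simp add: i_i Ti inner_i_left inner_commute)
  qed
  then show "T \<in> bounded_ops \<and> psd T" using T re by (simp add: psd_def)
next
  assume T: "T \<in> bounded_ops \<and> psd T"
  have "inner (T x) (\<i> *\<^sub>C x) = 0" for x
  proof -
    have "inner (T x) (\<i> *\<^sub>C x) = inner x (T (\<i> *\<^sub>C x))" using T by (intro sa_inner psdD) simp
    also have "\<dots> = inner x (\<i> *\<^sub>C T x)" using T by (simp add: bounded_ops_def)
    also have "\<dots> = - inner (T x) (\<i> *\<^sub>C x)" using inner_i_left[of x "T x"]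
        by (simp add: inner_commute)
    finally show ?thesis by simp
  qed
  then show "positive_op T"
    using T by (auto simp: positive_op_def cinner_cartesian complex_nonneg_Reals_iff psdD)
qed

lemma null_projection_nonzero:
  assumes C: "C \<in> bounded_ops" and x: "C x = 0" "x \<noteq> 0"
  shows "null_projection C \<noteq> 0"
proof -
  let ?L = "{x. C x = 0}"
  have "subspace ?L" by (auto simp: subspace_def blinfun_apply_simps)
  moreover have "closed ?L" by (intro closed_Collect_eq continuous_intros)
  ultimately obtain P where P: "orth_proj P" "range (blinfun_apply P) = ?L" "\<And>x. P x = x \<longleftrightarrow> x \<in> ?L"
    using exists_orth_proj by blast
  have "P \<in> bounded_ops"
    unfolding bounded_ops_eq
  proof (rule commuting_proj[OF P(1,3)])
    show "X x \<in> ?L" if "X \<in> {mult_i, - mult_i}" "x \<in> ?L" for X x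
      using that commutingD[OF C[unfolded bounded_ops_eq] that(1)] by (simp add: blinfun.zero_right)
  qed (rule mult_i_hadj_closed)
  then have ip: "is_projection P" using P by (simp add: is_projection_iff)
  have "null_projection C = P"
    unfolding null_projection_def projection_onto_def
  proof (rule the_equality)
    show "Q = P" if "is_projection Q \<and> range (blinfun_apply Q) = ?L" for Q
      using that P orth_proj_range[of Q] orth_proj_range[of P]
      by (intro orth_proj_range_eqI) (auto simp: is_projection_iff)
  qed (use ip P in blast)
  then show ?thesis using P(3)[of x] x by (auto simp: blinfun.zero_left)
qed

lemma limitin_strong_operator_topology:
  "limitin strong_operator_topology f l F \<longleftrightarrow> (\<forall>x. ((\<lambda>n. blinfun_apply (f n) x) \<longlongrightarrow> blinfun_apply l x)
      F)"
proof
  assume "limitin strong_operator_topology f l F"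
  then have "limitin euclidean ((\<lambda>T. blinfun_apply T x) \<circ> f) (blinfun_apply l x) F" for x
    by (rule continuous_map_limit[OF strong_operator_topology_continuous_evaluation])
  then show "\<forall>x. ((\<lambda>n. blinfun_apply (f n) x) \<longlongrightarrow> blinfun_apply l x) F" by (simp add: o_def)
next
  assume *: "\<forall>x. ((\<lambda>n. blinfun_apply (f n) x) \<longlongrightarrow> blinfun_apply l x) F"
  have "limitin (product_topology (\<lambda>_. euclidean) UNIV) (\<lambda>n. blinfun_apply (f n))
      (blinfun_apply l) F"
    using * by (subst limitin_componentwise) auto
  then have L: "limitin euclidean (\<lambda>n. blinfun_apply (f n)) (blinfun_apply l) F"
    by (simp add: euclidean_product_topology)
  show "limitin strong_operator_topology f l F"
    unfolding limitin_def
  proof (intro conjI allI impI)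
    show "l \<in> topspace strong_operator_topology" by (simp add: strong_operator_topology_topspace)
    fix U assume "openin strong_operator_topology U \<and> l \<in> U"
    then obtain V where "open V" "U = blinfun_apply -` V" "blinfun_apply l \<in> V"
      by (auto simp: strong_operator_topology_def openin_pullback_topology)
    then show "\<forall>\<^sub>F n in F. f n \<in> U" using L by (auto simp: tendsto_def)
  qed
qed

section \<open>The top spectral projection\<close>

text \<open>The real spectral projections lie in the bicommutant of \<open>T\<close>, hence commute
  with multiplication by \<open>\<i>\<close> and are complex-linear.\<close>

lemma spectral_measure_exists:
  assumes T: "T \<in> bounded_ops" "psd T"
  shows "\<exists>E. spectral_measure_of T E"
proof -
  obtain E :: "real set \<Rightarrow> ('a \<Rightarrow>\<^sub>L 'a)" and \<mu> a where
    E: "\<And>S. S \<in> sets borel \<Longrightarrow> orth_proj (E S)" "\<And>S. S \<in> sets borel \<Longrightarrow> E S \<in> bicommuting T"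
      "E UNIV = id_blinfun" "E {-a..a} = id_blinfun"
      "\<And>S R. S \<in> sets borel \<Longrightarrow> R \<in> sets borel \<Longrightarrow> E (S \<inter> R) = E S o\<^sub>L E R"
    and add: "\<And>F x. range F \<subseteq> sets borel \<Longrightarrow> disjoint_family F \<Longrightarrow>
        (\<lambda>i::nat. blinfun_apply (E (F i)) x) sums E (\<Union>i. F i) x"
    and m: "\<And>x. sets (\<mu> x) = sets borel"
      "\<And>S x. S \<in> sets borel \<Longrightarrow> emeasure (\<mu> x) S = ennreal (inner (E S x) x)"
      "\<And>x. integrable (\<mu> x) (\<lambda>t. t)" "\<And>x. inner (T x) x = (\<integral>t. t \<partial>\<mu> x)"
    by (rule spectral_theorem_psd[OF T(2)], rule that)
  have EB: "E S \<in> bounded_ops" if "S \<in> sets borel" for S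
    using E(2)[OF that] commuting_bicommuting[OF T(1)[unfolded bounded_ops_eq]]
        unfolding bounded_ops_eq by blast
  have sm: "scalar_measure E x = \<mu> x" for x
  proof -
    have sp: "space (\<mu> x) = UNIV" using m(1)[of x] by (metis sets_eq_imp_space_eq space_borel)
    have "scalar_measure E x = measure_of (space (\<mu> x)) (sets (\<mu> x)) (emeasure (\<mu> x))"
      unfolding scalar_measure_def sp m(1)
    proof (rule measure_of_eq)
      fix S :: "real set" assume "S \<in> sigma_sets UNIV (sets borel)"
      then have "S \<in> sets borel" by (metis sets.sigma_sets_eq space_borel)
      then show "ennreal (Re (cinner (E S x) x)) = emeasure (\<mu> x) S"
        by (simp add: m(2) inner_eq_Re_cinner)
    qed simp
    then show ?thesis by (simp add: measure_of_of_measure)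
  qed
  have "projection_valued_measure E"
    unfolding projection_valued_measure_def limitin_strong_operator_topology
    using E EB add by (auto simp: is_projection_iff sums_def blinfun.sum_left)
  moreover have "cinner (T x) x = complex_of_real (inner (T x) x)" for x
  proof -
    have "cinner (T x) x \<in> \<real>\<^sub>\<ge>\<^sub>0" using T positive_op_iff[of T] by (simp add: positive_op_def)
    then show ?thesis by (simp add: complex_nonneg_Reals_iff complex_eq_iff inner_eq_Re_cinner)
  qed
  ultimately have "spectral_measure_of T E"
    unfolding spectral_measure_of_def sm using E(4) m by auto
  then show ?thesis by blast
qed

text \<open>Identifies the value at the top point for an arbitrary spectral measure of
  \<open>T\<close>, which makes the description in \<open>spectral_projection\<close> unique there.
  Only the first moment enters: a function of constant sign with integral 0 vanishes almost
  everywhere, and this is applied to \<open>t - norm T\<close>.\<close>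

lemma spectral_measure_top:
  assumes T: "psd T" and E: "spectral_measure_of T E"
  shows "orth_proj (E {norm T})" "E {norm T} x = x \<longleftrightarrow> T x = norm T *\<^sub>R x"
proof -
  have pvm: "projection_valued_measure E" using E by (simp add: spectral_measure_of_def)
  have Ep: "orth_proj (E S)" if "S \<in> sets borel" for S
    using pvm that by (auto simp: projection_valued_measure_def is_projection_iff)
  have add: "(\<lambda>i. E (F i) x) sums E (\<Union>i. F i) x"
    if "range F \<subseteq> sets borel" "disjoint_family F" for F :: "nat \<Rightarrow> real set" and x
    using pvm that unfolding projection_valued_measure_def limitin_strong_operator_topology
    by (simp add: sums_def blinfun.sum_left)
  have E0: "E {} x = 0" for x
  proof -
    have "(\<lambda>i::nat. E {} x) sums E {} x"
      using add[of "\<lambda>_. {}" x] by (simp add: disjoint_family_on_def)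
    then have "(\<lambda>i::nat. E {} x) \<longlonglongrightarrow> 0" by (intro summable_LIMSEQ_zero sums_summable)
    then show ?thesis by (simp add: LIMSEQ_const_iff)
  qed
  have nn: "0 \<le> inner (E S x) x" if "S \<in> sets borel" for S x
    by (simp add: orth_proj_inner_self[OF Ep[OF that]])
  have em: "emeasure (scalar_measure E x) S = ennreal (inner (E S x) x)" if S: "S \<in> sets borel"
      for S x
  proof -
    have "emeasure (scalar_measure E x) S = ennreal (Re (cinner (E S x) x))"
    proof (rule emeasure_measure_of[OF scalar_measure_def])
      show "positive (sets (scalar_measure E x)) (\<lambda>S. ennreal (Re (cinner (E S x) x)))"
        by (simp add: positive_def E0 flip: inner_eq_Re_cinner)
      show "countably_additive (sets (scalar_measure E x)) (\<lambda>S. ennreal (Re (cinner (E S x) x)))"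
        unfolding countably_additive_def inner_eq_Re_cinner[symmetric]
      proof (intro allI impI)
        fix F :: "nat \<Rightarrow> real set"
        assume "range F \<subseteq> sets (scalar_measure E x)" and d: "disjoint_family F"
        moreover have "sets (scalar_measure E x) = sets borel"
          unfolding scalar_measure_def
              by (metis sets.sigma_sets_eq sets_measure_of space_borel sets.space_closed)
        ultimately have F: "range F \<subseteq> sets borel" by simp
        have s: "(\<lambda>i. inner (E (F i) x) x) sums inner (E (\<Union>i. F i) x) x"
          by (rule bounded_linear.sums[OF bounded_linear_inner_left add[OF F d]])
        have n: "0 \<le> inner (E (F i) x) x" for i using F by (intro nn) auto
        show "(\<Sum>i. ennreal (inner (E (F i) x) x)) = ennreal (inner (E (\<Union>i. F i) x) x)"
          unfolding suminf_ennreal2[OF n sums_summable[OF s]] sums_unique[OF s] ..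
      qed
      show "S \<in> sets (scalar_measure E x)"
        unfolding scalar_measure_def using S by simp
    qed simp
    then show ?thesis by (simp add: inner_eq_Re_cinner)
  qed
  define m where "m = scalar_measure E"
  have ms [simp, measurable_cong]: "sets (m x) = sets borel" for x
    unfolding m_def scalar_measure_def
        by (metis sets.sigma_sets_eq sets_measure_of space_borel sets.space_closed)
  then have sp: "space (m x) = UNIV" for x using sets_eq_imp_space_eq[OF ms] by simp
  have EU: "E UNIV = id_blinfun" using pvm by (simp add: projection_valued_measure_def)
  have tot: "emeasure (m x) UNIV = ennreal ((norm x)\<^sup>2)" for x
    unfolding m_def by (simp add: em EU power2_norm_eq_inner)
  have fin: "finite_measure (m x)" for x by (rule finite_measureI) (simp add: sp tot)
  have int: "integrable (m x) (\<lambda>t. t)" and itg: "inner (T x) x = (\<integral>t. t \<partial>m x)" for x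
    using E unfolding spectral_measure_of_def m_def
    by (auto simp: inner_eq_Re_cinner)
  have meas: "measure (m x) UNIV = (norm x)\<^sup>2" for x by (simp add: measure_def tot)
  have conc: "AE t in m x. t \<in> S" if S: "S \<in> sets borel" "E S x = x" for S x
  proof -
    have "emeasure (m x) (UNIV - S) = 0"
      using emeasure_compl[of S "m x"] tot[of x] em[OF S(1), of x] S
          by (simp add: m_def[symmetric] sp power2_norm_eq_inner)
    then show ?thesis using S(1) by (intro AE_I[of _ _ "UNIV - S"]) (auto simp: sp)
  qed
  have conc': "E S x = x" if S: "S \<in> sets borel" and ae: "AE t in m x. t \<in> S" for S x
  proof -
    have "emeasure (m x) S = emeasure (m x) UNIV"
      using ae S by (intro emeasure_eq_AE) auto
    then have "(norm (E S x))\<^sup>2 = (norm x)\<^sup>2"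
      using em[OF S, of x] tot[of x] nn[OF S] by (simp add: m_def orth_proj_inner_self[OF Ep[OF S]])
    then show ?thesis using orth_proj_pythagoras[OF Ep[OF S], of x] by simp
  qed
  let ?n = "norm T"
  have shift: "(\<integral>t. (t - ?n) \<partial>m x) = inner (T x) x - ?n * (norm x)\<^sup>2" "integrable (m x)
      (\<lambda>t. t - ?n)" for x
  proof -
    interpret finite_measure "m x" by (rule fin)
    show "integrable (m x) (\<lambda>t. t - ?n)" using int by auto
    show "(\<integral>t. (t - ?n) \<partial>m x) = inner (T x) x - ?n * (norm x)\<^sup>2"
      using int[of x] by (simp add: itg meas sp)
  qed
  \<comment> \<open>On the range of this projection \<open>t - norm T\<close> is positive almost
    everywhere, yet its integral is at most 0. The measure is thus concentrated on the empty
    set.\<close>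
  have above: "E {?n<..} = 0"
  proof (rule blinfun_eqI)
    fix x
    define y where "y = E {?n<..} x"
    have "E {?n<..} y = y" by (simp add: y_def orth_projD(3)[OF Ep])
    then have ae: "AE t in m y. ?n < t" using conc[of "{?n<..}" y] by simp
    have "0 \<le> (\<integral>t. (t - ?n) \<partial>m y)"
      by (rule integral_nonneg_AE) (use ae in \<open>auto elim: eventually_mono\<close>)
    moreover have "(\<integral>t. (t - ?n) \<partial>m y) \<le> 0" using inner_apply_le[of T y] by (simp add: shift)
    ultimately have "(\<integral>t. (t - ?n) \<partial>m y) = 0" by simp
    moreover have "AE t in m y. 0 \<le> t - ?n" using ae by eventually_elim simp
    ultimately have "AE t in m y. t - ?n = 0"
      using integral_nonneg_eq_0_iff_AE[OF shift(2)[of y]] by simp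
    with ae have "AE t in m y. t \<in> {}" by eventually_elim simp
    then have "E {} y = y" by (intro conc') auto
    then have "y = 0" by (simp add: E0)
    then show "E {?n<..} x = blinfun_apply 0 x" by (simp add: y_def blinfun.zero_left)
  qed
  show "orth_proj (E {?n})" by (rule Ep) simp
  show "E {?n} x = x \<longleftrightarrow> T x = ?n *\<^sub>R x"
  proof
    assume "E {?n} x = x"
    then have "AE t in m x. t - ?n = 0" using conc[of "{?n}" x] by simp
    then have "(\<integral>t. (t - ?n) \<partial>m x) = 0" by (intro integral_eq_zero_AE)
    then show "T x = ?n *\<^sub>R x" by (intro psd_top_eigenvector[OF T]) (simp add: shift)
  next
    assume e: "T x = ?n *\<^sub>R x"
    have "E {..?n} x = x"
    proof -
      have "emeasure (m x) {?n<..} = 0" using em[of "{?n<..}" x]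
          by (simp add: m_def above blinfun.zero_left)
      then have "AE t in m x. t \<in> {..?n}"
        by (intro AE_I[of _ _ "{?n<..}"]) (auto simp: sp)
      then show ?thesis by (intro conc') auto
    qed
    then have ae: "AE t in m x. t \<le> ?n" using conc[of "{..?n}" x] by simp
    have "(\<integral>t. (?n - t) \<partial>m x) = - (\<integral>t. (t - ?n) \<partial>m x)"
      by (subst integral_minus[symmetric]) simp
    also have "\<dots> = 0" by (simp add: shift e power2_norm_eq_inner)
    finally have "(\<integral>t. (?n - t) \<partial>m x) = 0" .
    moreover have "integrable (m x) (\<lambda>t. ?n - t)"
      using integrable_minus[OF shift(2)[of x]] by simp
    moreover have "AE t in m x. 0 \<le> ?n - t" using ae by eventually_elim simp
    ultimately have "AE t in m x. ?n - t = 0"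
      using integral_nonneg_eq_0_iff_AE[of "m x" "\<lambda>t. ?n - t"] by blast
    then have "AE t in m x. t \<in> {?n}" by eventually_elim simp
    then show "E {?n} x = x" by (intro conc') auto
  qed
qed

lemma top_projection_props:
  assumes T: "T \<in> bounded_ops" "psd T"
  shows "orth_proj (top_projection T)" "top_projection T x = x \<longleftrightarrow> T x = norm T *\<^sub>R x"
proof -
  obtain E where E: "spectral_measure_of T E" using spectral_measure_exists[OF T] by blast
  have "top_projection T = E {norm T}"
    unfolding spectral_projection_def
  proof (rule the_equality)
    fix P assume "\<exists>E. spectral_measure_of T E \<and> P = E {norm T}"
    then obtain E' where E': "spectral_measure_of T E'" "P = E' {norm T}" by blast
    show "P = E {norm T}"
      unfolding E'(2)
      using spectral_measure_top[OF T(2) E] spectral_measure_top[OF T(2) E'(1)]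
      by (intro orth_proj_range_eqI) auto
  qed (use E in blast)
  then show "orth_proj (top_projection T)" "top_projection T x = x \<longleftrightarrow> T x = norm T *\<^sub>R x"
    using spectral_measure_top[OF T(2) E] by simp_all
qed

section \<open>Sums of operators equivalent to a given one\<close>

text \<open>The remainders \<open>D n\<close> lie between 0 and \<open>A\<close>, so
  \<open>psd_norm_apply\<close> bounds \<open>(norm (D n x))\<^sup>2\<close> by a multiple of their
  form, and convergence of forms becomes strong convergence.\<close>

lemma sot_sums_of_quadratic_form:
  assumes A: "psd A" and C: "\<And>j. psd (C j)"
    and s: "\<And>x. (\<lambda>j. inner (C j x) x) sums inner (A x) x"
  shows "sot_sums C A"
  unfolding sot_sums_def limitin_strong_operator_topology
proof
  fix x
  define D where "D n = A - (\<Sum>j<n. C j)" for n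
  have Din: "inner (D n x) x = inner (A x) x - (\<Sum>j<n. inner (C j x) x)" for n x
    by (simp add: D_def blinfun_apply_simps inner_simps inner_sum_left)
  have "(\<Sum>j<n. C j)\<dagger> = (\<Sum>j<n. C j)" for n
    by (induction n) (simp_all add: psdD(1)[OF C])
  moreover have "(\<Sum>j<n. inner (C j x) x) \<le> inner (A x) x" for n x
    using sum_le_suminf[of "\<lambda>j. inner (C j x) x" "{..<n}"] s[of x] psdD(2)[OF C]
    by (simp add: sums_iff)
  ultimately have Dp: "psd (D n)" for n
    unfolding psd_def Din by (simp add: D_def psdD(1)[OF A])
  have "inner (D n x) x \<le> norm A * (norm x)\<^sup>2" for n x
    using inner_apply_le[of A x] sum_nonneg[of "{..<n}" "\<lambda>j. inner (C j x) x"] psdD(2)[OF C]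
    by (simp add: Din)
  then have "(norm (D n x))\<^sup>2 \<le> norm A * inner (D n x) x" for n
    by (rule psd_norm_apply[OF Dp])
  moreover have "(\<lambda>n. norm A * inner (D n x) x) \<longlonglongrightarrow> norm A * (inner (A x) x - inner (A x) x)"
    unfolding Din using s[of x] by (intro tendsto_intros) (simp add: sums_def)
  ultimately have "(\<lambda>n. (norm (D n x))\<^sup>2) \<longlonglongrightarrow> 0"
    by (intro tendsto_sandwich[of "\<lambda>_. 0"
        "\<lambda>n. (norm (D n x))\<^sup>2" sequentially "\<lambda>n. norm A * inner (D n x) x"])
      auto
  then have "(\<lambda>n. sqrt ((norm (D n x))\<^sup>2)) \<longlonglongrightarrow> sqrt 0" by (intro tendsto_intros)
  then have "(\<lambda>n. D n x) \<longlonglongrightarrow> 0" by (simp add: tendsto_norm_zero_iff)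
  then have "(\<lambda>n. A x - D n x) \<longlonglongrightarrow> A x - 0" by (intro tendsto_intros)
  then show "(\<lambda>n. (\<Sum>j<n. C j) x) \<longlonglongrightarrow> A x" by (simp add: D_def blinfun.diff_left)
qed

section \<open>The complex algebra as a commutant over the reals\<close>

locale sigma_finite_type_III =
  fixes R :: "('a::chilbert_space \<Rightarrow>\<^sub>L 'a) set"
  assumes type_III: "type_III_factor R" and sf: "sigma_finite_algebra R"
begin

lemma vn: "von_neumann_algebra R"
  using type_III by (simp add: type_III_factor_def vn_factor_def)

lemma R_bounded: "T \<in> R \<Longrightarrow> T \<in> bounded_ops"
  using vn by (auto simp: von_neumann_algebra_def)

lemma R_hadj: "T \<in> R \<Longrightarrow> T\<dagger> \<in> R"
  using vn adj_eq_hadj[OF R_bounded] by (metis von_neumann_algebra_def)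

definition N :: "('a \<Rightarrow>\<^sub>L 'a) set" where "N = {mult_i, - mult_i} \<union> commutant R"

lemma commutant_eq: "commutant S = commuting ({mult_i, - mult_i} \<union> S)"
  by (auto simp: commutant_def bounded_ops_eq commuting_def)

lemma commuting_N: "commuting N = R"
  using vn commutant_eq[of "commutant R"] by (simp add: von_neumann_algebra_def N_def)

lemma R_compose: "S \<in> R \<Longrightarrow> T \<in> R \<Longrightarrow> S o\<^sub>L T \<in> R"
  using commuting_compose[of S N T] by (simp add: commuting_N)

lemma projections_eq: "projections R = {P \<in> R. orth_proj P}"
  using R_bounded by (auto simp: projections_def is_projection_iff)

lemma positive_part_eq: "positive_part R = {T \<in> R. psd T}"
  using R_bounded by (auto simp: positive_part_def positive_op_iff)

lemma equiv_in_iff: "equiv_in R B C \<longleftrightarrow> (\<exists>X\<in>R. B = X o\<^sub>L X\<dagger> \<and> C = X\<dagger> o\<^sub>L X)"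
  unfolding equiv_in_def using adj_eq_hadj[OF R_bounded] by auto

sublocale type_III_commutant N
  rewrites "commuting N = R"
proof -
  show "type_III_commutant N"
  proof
    show "X\<dagger> \<in> N" if "X \<in> N" for X
    proof -
      have "X\<dagger> \<in> commutant R" if "X \<in> commutant R"
        using that R_hadj mult_i_hadj_closed unfolding commutant_eq by (intro commuting_hadj) auto
      then show ?thesis using that mult_i_hadj_closed unfolding N_def by blast
    qed
    show "P = 0 \<or> P = id_blinfun"
      if P: "orth_proj P" "P \<in> commuting N" "P \<in> commuting (commuting N)" for P
    proof -
      have "P \<in> R \<inter> commutant R"
        using P R_bounded unfolding commuting_N by (auto simp: commutant_def commuting_def)
      then obtain k where k: "\<And>x. P x = k *\<^sub>C x"
        using type_III unfolding type_III_factor_def vn_factor_def by blast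
      have e: "(k * k) *\<^sub>C x = k *\<^sub>C x" for x :: 'a
        using orth_projD(3)[OF P(1), of x] by (simp add: k scaleC_scaleC)
      show ?thesis
      proof (cases "k = 0 \<or> k = 1")
        case True
        then show ?thesis by (auto intro!: blinfun_eqI simp: k scaleC_zero_left blinfun.zero_left)
      next
        case False
        \<comment> \<open>\<open>k * k - k\<close> acts as 0. When it is a nonzero number, only the
          trivial space is possible, and there \<open>P = 0\<close>.\<close>
        have "k *\<^sub>C x = 0" for x :: 'a
        proof -
          have "k * k - k = (k - 1) * k" by (simp add: algebra_simps)
          then have "k *\<^sub>C x = (inverse (k - 1) * (k * k - k)) *\<^sub>C x"
            using False by (simp add: mult.assoc[symmetric])
          also have "\<dots> = inverse (k - 1) *\<^sub>C ((k * k) *\<^sub>C x + (- k) *\<^sub>C x)"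
            by (simp add: scaleC_scaleC flip: scaleC_add_left)
          also have "(k * k) *\<^sub>C x + (- k) *\<^sub>C x = 0"
            unfolding e by (simp add: scaleC_zero_left flip: scaleC_add_left)
          also have "inverse (k - 1) *\<^sub>C (0::'a) = 0"
            using scaleC_add_right[of "inverse (k - 1)" "0::'a" 0] by simp
          finally show ?thesis .
        qed
        then show ?thesis by (auto intro!: blinfun_eqI simp: k blinfun.zero_left)
      qed
    qed
    show "\<exists>V\<in>commuting N. V\<dagger> o\<^sub>L V = F \<and> F o\<^sub>L (V o\<^sub>L V\<dagger>) = V o\<^sub>L V\<dagger> \<and> V o\<^sub>L V\<dagger> \<noteq> F"
      if F: "orth_proj F" "F \<in> commuting N" "F \<noteq> 0" for F
    proof -
      have "infinite_projection R F"
        using type_III F unfolding commuting_N type_III_factor_def projections_eq by blast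
      then obtain Q where Q: "range (blinfun_apply Q) \<subseteq> range (blinfun_apply F)" "Q \<noteq> F"
          "equiv_in R Q F"
        unfolding infinite_projection_def by blast
      obtain V where V: "V \<in> R" "Q = V o\<^sub>L V\<dagger>" "F = V\<dagger> o\<^sub>L V" using Q(3) unfolding equiv_in_iff
          by blast
      have "F o\<^sub>L Q = Q"
      proof (rule blinfun_eqI)
        show "(F o\<^sub>L Q) x = Q x" for x
          using Q(1) orth_proj_range[OF F(1), of "Q x"] by auto
      qed
      then show ?thesis using V Q(2) unfolding commuting_N by blast
    qed
    show "countable \<A>"
      if "\<A> \<subseteq> {P \<in> commuting N. orth_proj P \<and> P \<noteq> 0}" "\<And>P Q. P \<in> \<A> \<Longrightarrow> Q \<in> \<A> \<Longrightarrow> P \<noteq> Q \<Longrightarrow> P o\<^sub>L Q = 0"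
      for \<A>
    proof -
      have "\<A> \<subseteq> projections R - {0}" using that(1) by (auto simp: projections_eq commuting_N)
      then show ?thesis using sf that(2) unfolding sigma_finite_algebra_def by blast
    qed
  qed
qed (rule commuting_N)

text \<open>Nonzero projections are infinite by type III; the zero projection has no subprojection
  besides itself. Infiniteness in the last two conditions thus asks only that the norm of
  \<open>A\<close> be an eigenvalue.\<close>

lemma infinite_iff: "P \<in> R \<Longrightarrow> orth_proj P \<Longrightarrow> infinite_projection R P \<longleftrightarrow> P \<noteq> 0"
proof
  assume P: "P \<in> R" "orth_proj P"
  show "infinite_projection R P" if "P \<noteq> 0"
    using type_III that P unfolding type_III_factor_def projections_eq by blast
  assume "infinite_projection R P"
  then obtain Q where Q: "range (blinfun_apply Q) \<subseteq> range (blinfun_apply P)" "Q \<noteq> P"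
    unfolding infinite_projection_def by blast
  show "P \<noteq> 0"
  proof
    assume p: "P = 0"
    then have "Q x = 0" for x using Q(1) by (auto simp: blinfun.zero_left)
    then have "Q = 0" by (auto intro: blinfun_eqI simp: blinfun.zero_left)
    then show False using p Q(2) by simp
  qed
qed

lemma top:
  assumes "T \<in> positive_part R"
  shows "orth_proj (top_projection T)" "top_projection T x = x \<longleftrightarrow> T x = norm T *\<^sub>R x"
    "top_projection T \<in> R" "T o\<^sub>L top_projection T = norm T *\<^sub>R top_projection T"
proof -
  have T: "T \<in> R" "psd T" "T \<in> bounded_ops" using assms R_bounded by (auto simp: positive_part_eq)
  note tp = top_projection_props[OF T(3,2)]
  obtain P where P: "orth_proj P" "P \<in> R" "\<And>x. P x = x \<longleftrightarrow> T x = norm T *\<^sub>R x"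
    "T o\<^sub>L P = norm T *\<^sub>R P"
    using eigenprojection_exists[OF T(2,1), of "norm T"] by blast
  have "top_projection T = P" using tp P by (intro orth_proj_range_eqI) auto
  then show "orth_proj (top_projection T)" "top_projection T x = x \<longleftrightarrow> T x = norm T *\<^sub>R x"
    "top_projection T \<in> R" "T o\<^sub>L top_projection T = norm T *\<^sub>R top_projection T"
    using P by simp_all
qed

lemma top_nonzero:
  assumes "T \<in> positive_part R" "T x = norm T *\<^sub>R x" "x \<noteq> 0"
  shows "top_projection T \<noteq> 0"
  using top(2)[OF assms(1), of x] assms(2,3) by (auto simp: blinfun.zero_left)

section \<open>Necessity, sufficiency and their assembly\<close>

lemma condition_necessary:
  assumes A: "A \<in> positive_part R" and B: "B \<in> positive_part R" "B \<noteq> 0"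
    and C: "\<And>j. C j \<in> positive_part R \<and> equiv_in R (C j) B" and s: "sot_sums C A"
  shows "condition1 A B \<or> condition2 A B \<or> condition3 R A B \<or> condition4 R A B"
proof -
  have AB: "psd A" "psd B" "A \<in> R" "B \<in> R" using A B by (auto simp: positive_part_eq)
  have Cp: "psd (C j)" for j using C by (auto simp: positive_part_eq)
  obtain X where X: "\<And>j. X j \<in> R" "\<And>j. C j = X j o\<^sub>L (X j)\<dagger>" "\<And>j. B = (X j)\<dagger> o\<^sub>L X j"
    using C unfolding equiv_in_iff by metis
  have Bx: "(X j)\<dagger> (X j x) = B x" for j x using X(3)[of j] by (metis blinfun_apply_blinfun_compose)
  have Cin: "inner (C j x) x = (norm ((X j)\<dagger> x))\<^sup>2" for j x
    by (simp add: X(2) inner_hadj[of "X j"] power2_norm_eq_inner)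
  have Cs: "(\<lambda>j. C j x) sums A x" for x
    using s unfolding sot_sums_def limitin_strong_operator_topology
        by (simp add: sums_def blinfun.sum_left)
  have Cs': "(\<lambda>j. inner (C j x) x) sums inner (A x) x" for x
    by (rule bounded_linear.sums[OF bounded_linear_inner_left Cs])
  have fin: "(\<Sum>j\<in>J. inner (C j x) x) \<le> inner (A x) x" if "finite J" for J x
    using sum_le_suminf[of "\<lambda>j. inner (C j x) x" J] Cs'[of x] psdD(2)[OF Cp] that
    by (simp add: sums_iff)
  have le: "inner (C j x) x \<le> inner (A x) x" for j x using fin[of "{j}" x] by simp
  define b where "b = norm B"
  have b: "0 < b" using B(2) by (simp add: b_def)
  have nn: "norm B \<le> norm A"
  proof -
    have "norm ((X 0)\<dagger>) \<le> sqrt (norm A)"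
    proof (rule norm_blinfun_bound)
      fix x
      have "(norm ((X 0)\<dagger> x))\<^sup>2 \<le> norm A * (norm x)\<^sup>2"
        using le[of 0 x] inner_apply_le[of A x] by (simp add: Cin)
      then show "norm ((X 0)\<dagger> x) \<le> sqrt (norm A) * norm x"
        using real_le_rsqrt by (fastforce simp: real_sqrt_mult)
    qed simp
    then have "norm (X 0) \<le> sqrt (norm A)" by simp
    then have "norm ((X 0)\<dagger>) * norm (X 0) \<le> sqrt (norm A) * sqrt (norm A)"
      by (intro mult_mono) auto
    then show ?thesis using norm_blinfun_compose[of "(X 0)\<dagger>" "X 0"] X(3)[of 0] by simp
  qed
  show ?thesis
  proof (cases "norm A = norm B \<and> top_projection B \<noteq> 0")
    case False
    then show ?thesis using nn unfolding condition1_def condition2_def by linarith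
  next
    case True
    then have eq: "norm A = b" "norm B = b" by (auto simp: b_def)
    obtain v where "top_projection B v \<noteq> 0" using True by (metis blinfun_eqI blinfun.zero_left)
    then obtain u where u: "u \<noteq> 0" "B u = b *\<^sub>R u"
      using top(2)[OF B(1)] orth_projD(3)[OF top(1)[OF B(1)]] eq by metis
    \<comment> \<open>\<open>C 0 y = X 0 (B u) = b y\<close>, so the form of \<open>C 0\<close> at
      \<open>y\<close> is already the maximum that \<open>A\<close> permits; as
      \<open>C 0 \<le> A\<close>, the form of \<open>A\<close> attains it too.\<close>
    define y where "y = X 0 u"
    have ny: "(norm y)\<^sup>2 = b * (norm u)\<^sup>2"
      using power2_norm_apply[of "X 0" u] by (simp add: y_def Bx u power2_norm_eq_inner)
    then have y0: "y \<noteq> 0" using b u by auto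
    have "inner (C 0 y) y = b * (norm y)\<^sup>2"
    proof -
      have "(X 0)\<dagger> y = b *\<^sub>R u" by (simp add: y_def Bx u)
      then show ?thesis by (simp add: Cin ny power_mult_distrib) (simp add: power2_eq_square)
    qed
    then have "norm A * (norm y)\<^sup>2 \<le> inner (A y) y" using le[of 0 y] by (simp add: eq)
    then have "A y = norm A *\<^sub>R y" by (rule psd_top_eigenvector[OF AB(1)])
    then have inf: "infinite_projection R (top_projection A)"
      using top_nonzero[OF A _ y0] infinite_iff[OF top(3)[OF A] top(1)[OF A]] by blast
    show ?thesis
    proof (cases "B = norm B *\<^sub>R top_projection B")
      case False
      then show ?thesis using True inf by (simp add: condition3_def)
    next
      case Beq: True
      define Q where "Q = top_projection B"
      have Q: "orth_proj Q" "B = b *\<^sub>R Q" using top(1)[OF B(1)] Beq by (simp_all add: Q_def eq)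
      \<comment> \<open>Dividing by \<open>sqrt b\<close> turns the \<open>X j\<close> into partial
        isometries with initial projection \<open>Q\<close>, and the \<open>C j\<close> into
        \<open>b\<close> times their final projections.\<close>
      define V where "V j = (1 / sqrt b) *\<^sub>R X j" for j
      have VV: "(V j)\<dagger> o\<^sub>L V j = Q" for j
        by (rule blinfun_eqI) (use b in \<open>simp add: V_def blinfun_apply_simps Bx Q(2)\<close>)
      define p where "p j = V j o\<^sub>L (V j)\<dagger>" for j
      have pp: "orth_proj (p j)" for j
      proof -
        have "p j o\<^sub>L V j = V j"
          using partial_isometry_initial(1)[OF VV Q(1)]
              by (simp add: p_def blinfun_compose_assoc VV)
        then show ?thesis
          unfolding orth_proj_def by (simp add: p_def blinfun_compose_assoc[symmetric])
      qed
      have Cpj: "C j = b *\<^sub>R p j" for j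
        by (rule blinfun_eqI) (use b in \<open>simp add: X(2) p_def V_def blinfun_apply_simps\<close>)
      \<comment> \<open>Any two of the \<open>C j\<close> add up to at most \<open>A\<close>, hence
        to at most \<open>b\<close>. Two projections whose sum is at most 1 are orthogonal.\<close>
      have "p i o\<^sub>L p j = 0" if "i \<noteq> j" for i j
      proof (rule orth_proj_le_1_product_zero[OF pp pp])
        fix x
        have "b * (inner (p i x) x + inner (p j x) x) \<le> b * (norm x)\<^sup>2"
          using fin[of "{i, j}" x] that inner_apply_le[of A x]
          by (simp add: Cpj blinfun.scaleR_left eq distrib_left)
        then show "inner (p i x) x + inner (p j x) x \<le> (norm x)\<^sup>2" using b by simp
      qed
      then have "orth_family p" using pp by (simp add: orth_family_def)
      then obtain G where G: "orth_proj G" "\<And>x. (\<lambda>j. p j x) sums blinfun_apply G x"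
        using orth_family_sum by metis
      have AG: "A = b *\<^sub>R G"
      proof (rule blinfun_eqI)
        fix x
        have "(\<lambda>j. b *\<^sub>R p j x) sums (b *\<^sub>R G x)" by (rule sums_scaleR_right[OF G(2)])
        then show "A x = (b *\<^sub>R G) x"
          using Cs[of x] sums_unique2 by (simp add: Cpj blinfun.scaleR_left)
      qed
      have "top_projection A = G"
      proof (rule orth_proj_range_eqI[OF top(1)[OF A] G(1)])
        have Ax: "A x = b *\<^sub>R G x" for x using AG by (simp add: blinfun.scaleR_left)
        show "top_projection A x = x \<longleftrightarrow> G x = x" for x
          unfolding top(2)[OF A] using b by (simp add: eq Ax)
      qed
      then show ?thesis using True Beq inf AG eq by (simp add: condition4_def)
    qed
  qed
qed

lemma condition_sufficient:
  assumes A: "A \<in> positive_part R" and B: "B \<in> positive_part R" "B \<noteq> 0"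
    and "condition1 A B \<or> condition2 A B \<or> condition3 R A B \<or> condition4 R A B"
  shows "\<exists>X. decomposes A B X"
proof -
  have AB: "psd A" "A \<in> R" "psd B" "B \<in> R" using A B by (auto simp: positive_part_eq)
  consider "condition1 A B" | "condition2 A B" | "condition3 R A B" | "condition4 R A B"
      using assms(4) by blast
  then show ?thesis
  proof cases
    case 1
    then show ?thesis using decomposes_larger_norm[OF AB B(2)] by (simp add: condition1_def)
  next
    case 2
    then have "x = 0" if "B x = norm B *\<^sub>R x" for x
      using that top_nonzero[OF B(1)] by (auto simp: condition2_def)
    then show ?thesis using 2 decomposes_no_top_eigenvector[OF AB B(2)]
        by (simp add: condition2_def)
  next
    case 3
    then have "top_projection A \<noteq> 0"
      using infinite_iff[OF top(3)[OF A] top(1)[OF A]] unfolding condition3_def by blast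
    then show ?thesis
      using 3 decomposes_common_top_eigenvalue[OF AB B(2) _ top(1)[OF A] top(3)[OF A] _ top(2)[OF A]
          top(1)[OF B(1)] top(3)[OF B(1)] _ top(2)[OF B(1)]]
      by (simp add: condition3_def)
  next
    case 4
    then have "top_projection A \<noteq> 0"
      using infinite_iff[OF top(3)[OF A] top(1)[OF A]] unfolding condition4_def by blast
    moreover have "top_projection B \<noteq> 0" using 4 B(2) by (auto simp: condition4_def)
    ultimately have "\<exists>X. decomposes (norm B *\<^sub>R top_projection A) (norm B *\<^sub>R top_projection B) X"
      using decomposes_scaled_projections[OF top(1)[OF A] top(3)[OF A] _ top(1)[OF B(1)]
          top(3)[OF B(1)], of "norm B"]
        B(2) by simp
    then show ?thesis using 4 unfolding condition4_def by metis
  qed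
qed

lemma decomposition_of_decomposes:
  assumes A: "A \<in> positive_part R" and B: "B \<in> positive_part R" "B \<noteq> 0" and X: "decomposes A B X"
  shows "\<exists>C. (\<forall>j. C j \<in> positive_part R \<and> equiv_in R (C j) B \<and> null_projection (C j) \<noteq> 0)
      \<and> sot_sums C A"
proof (intro exI[of _ "\<lambda>j. X j o\<^sub>L (X j)\<dagger>"] conjI allI)
  fix j
  have XR: "X j \<in> R" using X by (simp add: decomposes_def)
  show C: "X j o\<^sub>L (X j)\<dagger> \<in> positive_part R"
    using XR psd_hadj_compose(2)[of "X j"] by (simp add: positive_part_eq R_compose R_hadj)
  have "B = (X j)\<dagger> o\<^sub>L X j"
  proof (rule sa_eqI)
    show "B\<dagger> = B" using B by (auto simp: positive_part_eq psdD)
    show "inner (B x) x = inner (((X j)\<dagger> o\<^sub>L X j) x) x" for x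
      unfolding power2_norm_apply[symmetric] using X by (simp add: decomposes_def)
  qed simp
  then show "equiv_in R (X j o\<^sub>L (X j)\<dagger>) B" using XR unfolding equiv_in_iff by blast
  obtain x where x: "(X j)\<dagger> x = 0" "A x \<noteq> 0" using X B(2) unfolding decomposes_def by blast
  show "null_projection (X j o\<^sub>L (X j)\<dagger>) \<noteq> 0"
  proof (rule null_projection_nonzero)
    show "X j o\<^sub>L (X j)\<dagger> \<in> bounded_ops" using C R_bounded by (simp add: positive_part_eq)
    show "(X j o\<^sub>L (X j)\<dagger>) x = 0" using x by (simp add: blinfun.zero_right)
    show "x \<noteq> 0" using x(2) by (auto simp: blinfun.zero_right)
  qed
next
  show "sot_sums (\<lambda>j. X j o\<^sub>L (X j)\<dagger>) A"
  proof (rule sot_sums_of_quadratic_form)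
    show "psd A" using A by (simp add: positive_part_eq)
    show "psd (X j o\<^sub>L (X j)\<dagger>)" for j by (rule psd_hadj_compose)
    have "inner ((X j o\<^sub>L (X j)\<dagger>) x) x = (norm ((X j)\<dagger> x))\<^sup>2" for j x
      using power2_norm_apply[of "(X j)\<dagger>" x] by simp
    then show "(\<lambda>j. inner ((X j o\<^sub>L (X j)\<dagger>) x) x) sums inner (A x) x" for x
      using X by (simp only: decomposes_def)
  qed
qed

end

theorem corollary5p4:
  fixes M :: "('a::chilbert_space \<Rightarrow>\<^sub>L 'a) set" and A B :: "'a \<Rightarrow>\<^sub>L 'a"
  assumes "type_III_factor M" and "sigma_finite_algebra M"
    and "A \<in> positive_part M" and "B \<in> positive_part M" and "B \<noteq> 0"
  shows "((\<exists>C. (\<forall>j. C j \<in> positive_part M \<and> equiv_in M (C j) B) \<and> sot_sums C A) \<longleftrightarrow>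
            condition1 A B \<or> condition2 A B \<or> condition3 M A B \<or> condition4 M A B) \<and>
         (\<not> (condition1 A B \<and> condition2 A B) \<and>
          \<not> (condition1 A B \<and> condition3 M A B) \<and>
          \<not> (condition1 A B \<and> condition4 M A B) \<and>
          \<not> (condition2 A B \<and> condition3 M A B) \<and>
          \<not> (condition2 A B \<and> condition4 M A B) \<and>
          \<not> (condition3 M A B \<and> condition4 M A B)) \<and>
         (condition1 A B \<or> condition2 A B \<or> condition3 M A B \<or> condition4 M A B \<longrightarrow>
            (\<exists>C. (\<forall>j. C j \<in> positive_part M \<and> equiv_in M (C j) B \<and> null_projection (C j) \<noteq> 0) \<and>
                 sot_sums C A))"
proof -
  interpret sigma_finite_type_III M using assms(1,2) by unfold_locales
  let ?cond = "condition1 A B \<or> condition2 A B \<or> condition3 M A B \<or> condition4 M A B"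
  have suf: "\<exists>C. (\<forall>j. C j \<in> positive_part M \<and> equiv_in M (C j) B \<and> null_projection (C j) \<noteq> 0) \<and>
      sot_sums C A" if ?cond
    using condition_sufficient[OF assms(3-5) that] decomposition_of_decomposes[OF assms(3-5)]
        by blast
  moreover have ?cond if "\<exists>C. (\<forall>j. C j \<in> positive_part M \<and> equiv_in M (C j) B) \<and> sot_sums C A"
    using that condition_necessary[OF assms(3-5)] by blast
  moreover have "\<not> (condition1 A B \<and> condition2 A B)" "\<not> (condition1 A B \<and> condition3 M A B)"
    "\<not> (condition1 A B \<and> condition4 M A B)" "\<not> (condition2 A B \<and> condition3 M A B)"
    "\<not> (condition3 M A B \<and> condition4 M A B)"
    by (auto simp: condition1_def condition2_def condition3_def condition4_def)
  \<comment> \<open>Here \<open>B \<noteq> 0\<close> decides: both conditions together would make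
    \<open>B\<close> a multiple of the zero projection.\<close>
  moreover have "\<not> (condition2 A B \<and> condition4 M A B)"
    using assms(5) by (auto simp: condition2_def condition4_def)
  ultimately show ?thesis by blast
qed

end
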